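(* Let $(\mathfrak H_i,J_i)$ and $(\mathfrak H_i',J_i')$, $i=1,2$, be Hilbert spaces with symmetries, where $\nu_-(J_1'),\nu_-(J_2')<\infty$, put $\widetilde{\mathfrak H}_i=\mathfrak H_i\oplus\mathfrak H_i'$, $\widetilde J_i=J_i\oplus J_i'$, and let $P_2$ be the orthogonal projection of $\widetilde{\mathfrak H}_2$ onto $\mathfrak H_2$. Let $T\in[\mathfrak H_1,\mathfrak H_2]$ with $\kappa_1:=\nu_-(J_1-T^*J_2T)<\infty$ and $\kappa_2:=\nu_-(J_2-TJ_1T^* )<\infty$. Assume that $$0\le\kappa_1-\nu_-(J_2')=\widetilde\kappa_1<\infty,\qquad 0\le\kappa_2-\nu_-(J_1')=\widetilde\kappa_2<\infty .$$ Then the following problem is solvable: find all bounded operators $\widetilde T\in[\widetilde{\mathfrak H}_1,\widetilde{\mathfrak H}_2]$ such that $$P_2\widetilde T\restriction\mathfrak H_1=T,\qquad \nu_-(\widetilde J_1-\widetilde T^*\widetilde J_2\widetilde T)=\widetilde\kappa_1,\qquad \nu_-(\widetilde J_2-\widetilde T\widetilde J_1\widetilde T^* )=\widetilde\kappa_2 .$$ Moreover, the formula $$\widetilde T=\begin{pmatrix}T&D_{T^*}\Gamma_1\\ \Gamma_2D_T&-\Gamma_2L_T^*J_{T^*}\Gamma_1+D_{\Gamma_2^*}\Gamma D_{\Gamma_1}\end{pmatrix}$$ establishes a one-to-one correspondence between the set of all solutions $\widetilde T$ to this problem and the set of triplets $\{\Gamma_1,\Gamma_2,\Gamma\}$ where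 $\Gamma_1\in[\mathfrak H_1',\mathfrak D_{T^*}]$ and $\Gamma_2^*\in[\mathfrak H_2',\mathfrak D_T]$ are $J$-contractions and $\Gamma\in[\mathfrak D_{\Gamma_1},\mathfrak D_{\Gamma_2^*}]$ is a Hilbert space contraction.
   Context: $[\mathfrak H,\mathfrak K]$ denotes bounded everywhere defined operators; adjoints are Hilbert space adjoints; a symmetry $J$ satisfies $J=J^*=J^{-1}$. For bounded selfadjoint $X$, $\nu_-(X)$ is the dimension of its spectral subspace for $(-\infty,0)$, $|X|=(X^2)^{1/2}$, and $\operatorname{sign}(X)$ is defined by the functional calculus with $\operatorname{sign}(t)=1$ for $t\ge0$, $-1$ for $t<0$. Defect operators of $T$: $D_T=|J_1-T^*J_2T|^{1/2}$, $J_T=\operatorname{sign}(J_1-T^*J_2T)$, $\mathfrak D_T=\overline{\operatorname{ran}}D_T$; $D_{T^*}=|J_2-TJ_1T^*|^{1/2}$, $J_{T^*}=\operatorname{sign}(J_2-TJ_1T^* )$, $\mathfrak D_{T^*}=\overline{\operatorname{ran}}D_{T^*}$. $J_T$ and $J_{T^*}$ are also regarded as symmetries on $\mathfrak D_T$ and $\mathfrak D_{T^*}$, which become Kreĭn spaces. The link operator $L_T\in[\mathfrak D_T,\mathfrak D_{T^*}]$ is the unique bounded operator satisfying $D_{T^*}L_T=TJ_1D_T\restriction\mathfrak D_T$. $\Gamma_1\in[\mathfrak H_1',\mathfrak D_{T^*}]$ is a $J$-contraction if $J_1'-\Gamma_1^*J_{T^*}\Gamma_1\ge0$, and $\Gamma_2^*\in[\mathfrak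 H_2',\mathfrak D_T]$ is a $J$-contraction if $J_2'-\Gamma_2J_T\Gamma_2^*\ge0$. Then $D_{\Gamma_1}=(J_1'-\Gamma_1^*J_{T^*}\Gamma_1)^{1/2}$, $D_{\Gamma_2^*}=(J_2'-\Gamma_2J_T\Gamma_2^* )^{1/2}$, $\mathfrak D_{\Gamma_1}=\overline{\operatorname{ran}}D_{\Gamma_1}$, $\mathfrak D_{\Gamma_2^*}=\overline{\operatorname{ran}}D_{\Gamma_2^*}$. *)

theory Defs
  imports "HOL-Analysis.Analysis" "HOL-Library.Extended_Nat"
begin

section \<open>Complex Hilbert spaces\<close>

text \<open>
  A complex inner product space is a real inner product space together with a complex scalar
  multiplication and a complex inner product (linear in the first argument) whose real part is
  the given real inner product; norm and topology are therefore those of the library class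
  \<^class>\<open>real_inner\<close>.
\<close>

class complex_inner = real_inner +
  fixes scaleC :: "complex \<Rightarrow> 'a \<Rightarrow> 'a" (infixr \<open>*\<^sub>C\<close> 75)
    and cinner :: "'a \<Rightarrow> 'a \<Rightarrow> complex"
  assumes scaleC_add_right: "a *\<^sub>C (x + y) = a *\<^sub>C x + a *\<^sub>C y"
    and scaleC_add_left: "(a + b) *\<^sub>C x = a *\<^sub>C x + b *\<^sub>C x"
    and scaleC_scaleC: "a *\<^sub>C b *\<^sub>C x = (a * b) *\<^sub>C x"
    and scaleC_of_real: "complex_of_real r *\<^sub>C x = r *\<^sub>R x"
    and cinner_commute: "cinner x y = cnj (cinner y x)"
    and cinner_add_left: "cinner (x + y) z = cinner x z + cinner y z"
    and cinner_scaleC_left: "cinner (a *\<^sub>C x) y = a * cinner x y"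
    and inner_eq_Re_cinner: "x \<bullet> y = Re (cinner x y)"

class chilbert_space = complex_inner + complete_space

lemma scaleC_one: "1 *\<^sub>C x = (x :: 'a::complex_inner)"
  using scaleC_of_real [of 1 x] by simp

global_interpretation complex_vector: vector_space "scaleC :: complex \<Rightarrow> 'a \<Rightarrow> 'a::complex_inner"
  defines cspan = complex_vector.span
    and cdim = complex_vector.dim
  by unfold_locales (simp_all add: scaleC_add_right scaleC_add_left scaleC_scaleC scaleC_one)

text \<open>The orthogonal sum of two spaces is their product type.\<close>

instantiation prod :: (complex_inner, complex_inner) complex_inner
begin

definition scaleC_prod :: "complex \<Rightarrow> 'a \<times> 'b \<Rightarrow> 'a \<times> 'b"
  where "scaleC_prod c p = (c *\<^sub>C fst p, c *\<^sub>C snd p)"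

definition cinner_prod :: "'a \<times> 'b \<Rightarrow> 'a \<times> 'b \<Rightarrow> complex"
  where "cinner_prod p q = cinner (fst p) (fst q) + cinner (snd p) (snd q)"

instance
proof
  fix a b :: complex and r :: real and x y z :: "'a \<times> 'b"
  show "a *\<^sub>C (x + y) = a *\<^sub>C x + a *\<^sub>C y"
    by (simp add: scaleC_prod_def scaleC_add_right)
  show "(a + b) *\<^sub>C x = a *\<^sub>C x + b *\<^sub>C x"
    by (simp add: scaleC_prod_def scaleC_add_left)
  show "a *\<^sub>C b *\<^sub>C x = (a * b) *\<^sub>C x"
    by (simp add: scaleC_prod_def scaleC_scaleC)
  show "complex_of_real r *\<^sub>C x = r *\<^sub>R x"
    by (simp add: scaleC_prod_def scaleC_of_real prod_eq_iff)
  show "cinner x y = cnj (cinner y x)"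
    unfolding cinner_prod_def complex_cnj_add
    by (metis cinner_commute)
  show "cinner (x + y) z = cinner x z + cinner y z"
    by (simp add: cinner_prod_def cinner_add_left)
  show "cinner (a *\<^sub>C x) y = a * cinner x y"
    by (simp add: cinner_prod_def scaleC_prod_def cinner_scaleC_left algebra_simps)
  show "x \<bullet> y = Re (cinner x y)"
    by (simp add: cinner_prod_def inner_prod_def inner_eq_Re_cinner)
qed

end

instance prod :: (chilbert_space, chilbert_space) chilbert_space ..

section \<open>Bounded operators between closed subspaces\<close>

text \<open>
  The bounded operators from a closed subspace \<open>M\<close> of one Hilbert space into a closed subspace
  \<open>N\<close> of another. An operator on \<open>M\<close> is a function that is \<^const>\<open>undefined\<close> off \<open>M\<close>, so that
  equality of operators on \<open>M\<close> is equality of functions. For \<open>M = UNIV\<close> this is no restriction.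
\<close>

definition bops :: "'a::complex_inner set \<Rightarrow> 'b::complex_inner set \<Rightarrow> ('a \<Rightarrow> 'b) set"
  where "bops M N = {A \<in> M \<rightarrow>\<^sub>E N.
     (\<forall>x\<in>M. \<forall>y\<in>M. A (x + y) = A x + A y) \<and>
     (\<forall>c. \<forall>x\<in>M. A (c *\<^sub>C x) = c *\<^sub>C A x) \<and>
     (\<exists>K. \<forall>x\<in>M. norm (A x) \<le> K * norm x)}"

abbreviation bop :: "('a::complex_inner \<Rightarrow> 'b::complex_inner) \<Rightarrow> bool"
  where "bop A \<equiv> A \<in> bops UNIV UNIV"

lemma bop_iff: "bop A \<longleftrightarrow> bounded_linear A \<and> (\<forall>c x. A (c *\<^sub>C x) = c *\<^sub>C A x)"
proof
  assume A: "bop A"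
  have "A (r *\<^sub>R x) = r *\<^sub>R A x" for r x
    using A unfolding bops_def by (simp flip: scaleC_of_real)
  moreover obtain K where "\<And>x. norm (A x) \<le> norm x * K"
    using A unfolding bops_def by (auto simp: mult.commute)
  ultimately show "bounded_linear A \<and> (\<forall>c x. A (c *\<^sub>C x) = c *\<^sub>C A x)"
    using A unfolding bops_def by (intro conjI bounded_linear_intro [of A K]) auto
next
  assume A: "bounded_linear A \<and> (\<forall>c x. A (c *\<^sub>C x) = c *\<^sub>C A x)"
  then interpret bounded_linear A by blast
  from bounded obtain K where "\<forall>x. norm (A x) \<le> norm x * K" by blast
  then show "bop A"
    using A add unfolding bops_def by (auto simp: mult.commute)
qed

definition adj_on :: "'a::complex_inner set \<Rightarrow> 'b::complex_inner set \<Rightarrow> ('a \<Rightarrow> 'b) \<Rightarrow> 'b \<Rightarrow> 'a"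
  where "adj_on M N A =
    (THE B. B \<in> bops N M \<and> (\<forall>x\<in>M. \<forall>y\<in>N. cinner (A x) y = cinner x (B y)))"

abbreviation adj :: "('a::complex_inner \<Rightarrow> 'b::complex_inner) \<Rightarrow> 'b \<Rightarrow> 'a"
  where "adj \<equiv> adj_on UNIV UNIV"

definition symmetry :: "('a::complex_inner \<Rightarrow> 'a) \<Rightarrow> bool"
  where "symmetry J \<longleftrightarrow> bop J \<and> bij J \<and> adj J = J \<and> inv J = J"

definition positive_op :: "('a::complex_inner \<Rightarrow> 'a) \<Rightarrow> bool"
  where "positive_op A \<longleftrightarrow> bop A \<and> (\<forall>x. cinner (A x) x \<in> \<real>\<^sub>\<ge>\<^sub>0)"

definition sqrt_op :: "('a::complex_inner \<Rightarrow> 'a) \<Rightarrow> 'a \<Rightarrow> 'a"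
  where "sqrt_op A = (THE S. positive_op S \<and> S \<circ> S = A)"

definition abs_op :: "('a::complex_inner \<Rightarrow> 'a) \<Rightarrow> 'a \<Rightarrow> 'a"
  where "abs_op X = sqrt_op (X \<circ> X)"

section \<open>Functional calculus of bounded selfadjoint operators\<close>

definition orth_projection :: "('a::complex_inner \<Rightarrow> 'a) \<Rightarrow> bool"
  where "orth_projection P \<longleftrightarrow> bop P \<and> adj P = P \<and> P \<circ> P = P"

definition projection_valued_measure :: "(real set \<Rightarrow> 'a::complex_inner \<Rightarrow> 'a) \<Rightarrow> bool"
  where "projection_valued_measure E \<longleftrightarrow>
    (\<forall>A\<in>sets borel. orth_projection (E A)) \<and> E UNIV = id \<and>
    (\<forall>A :: nat \<Rightarrow> real set. range A \<subseteq> sets borel \<and> disjoint_family A \<longrightarrow>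
       (\<forall>x. (\<lambda>n. E (A n) x) sums E (\<Union>n. A n) x))"

definition scalar_measure :: "(real set \<Rightarrow> 'a::complex_inner \<Rightarrow> 'a) \<Rightarrow> 'a \<Rightarrow> real measure"
  where "scalar_measure E x =
    measure_of UNIV (sets borel) (\<lambda>A. ennreal (Re (cinner (E A x) x)))"

text \<open>\<open>B\<close> is the weak integral of the bounded Borel function \<open>f\<close> against \<open>E\<close>.\<close>

definition is_spectral_integral ::
    "(real set \<Rightarrow> 'a::complex_inner \<Rightarrow> 'a) \<Rightarrow> (real \<Rightarrow> real) \<Rightarrow> ('a \<Rightarrow> 'a) \<Rightarrow> bool"
  where "is_spectral_integral E f B \<longleftrightarrow>
    bop B \<and> (\<forall>x. cinner (B x) x = complex_of_real (LINT t|scalar_measure E x. f t))"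

text \<open>
  The spectral measure of a bounded selfadjoint operator (unique on Borel sets, by the spectral
  theorem). Boundedness of the operator is expressed by the bounded support, which also makes the
  identity function integrable below. Values off the Borel sets are irrelevant, hence the choice
  operator \<open>SOME\<close>.
\<close>

definition spectral_measure :: "('a::complex_inner \<Rightarrow> 'a) \<Rightarrow> real set \<Rightarrow> 'a \<Rightarrow> 'a"
  where "spectral_measure X = (SOME E. projection_valued_measure E \<and>
    (\<exists>c. E {-c..c} = id) \<and> is_spectral_integral E (\<lambda>t. t) X)"

definition functional_calculus :: "(real \<Rightarrow> real) \<Rightarrow> ('a::complex_inner \<Rightarrow> 'a) \<Rightarrow> 'a \<Rightarrow> 'a"
  where "functional_calculus f X = (THE B. is_spectral_integral (spectral_measure X) f B)"

definition sign_op :: "('a::complex_inner \<Rightarrow> 'a) \<Rightarrow> 'a \<Rightarrow> 'a"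
  where "sign_op = functional_calculus (\<lambda>t. if t \<ge> 0 then 1 else -1)"

definition ecdim :: "'a::complex_inner set \<Rightarrow> enat"
  where "ecdim V = (if \<exists>B. finite B \<and> V \<subseteq> cspan B then enat (cdim V) else \<infinity>)"

definition nu_minus :: "('a::complex_inner \<Rightarrow> 'a) \<Rightarrow> enat"
  where "nu_minus X = ecdim (range (spectral_measure X {..<0}))"

section \<open>Defect operators and the link operator\<close>

text \<open>
  In the constants below, \<open>J\<close> and \<open>K\<close> are the symmetries on the domain space and on the range space
  of \<open>T\<close>. The suffix \<open>star\<close> marks the objects belonging to the adjoint of \<open>T\<close>.
\<close>

definition defect_form ::
    "('a::complex_inner \<Rightarrow> 'a) \<Rightarrow> ('b::complex_inner \<Rightarrow> 'b) \<Rightarrow> ('a \<Rightarrow> 'b) \<Rightarrow> 'a \<Rightarrow> 'a"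
  where "defect_form J K T = (\<lambda>x. J x - adj T (K (T x)))"

definition defect_form_star ::
    "('a::complex_inner \<Rightarrow> 'a) \<Rightarrow> ('b::complex_inner \<Rightarrow> 'b) \<Rightarrow> ('a \<Rightarrow> 'b) \<Rightarrow> 'b \<Rightarrow> 'b"
  where "defect_form_star J K T = (\<lambda>y. K y - T (J (adj T y)))"

definition defect_op where "defect_op J K T = sqrt_op (abs_op (defect_form J K T))"
definition defect_op_star where "defect_op_star J K T = sqrt_op (abs_op (defect_form_star J K T))"

definition defect_sign where "defect_sign J K T = sign_op (defect_form J K T)"
definition defect_sign_star where "defect_sign_star J K T = sign_op (defect_form_star J K T)"

definition defect_space where "defect_space J K T = closure (range (defect_op J K T))"
definition defect_space_star where "defect_space_star J K T = closure (range (defect_op_star J K T))"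

definition link_op ::
    "('a::complex_inner \<Rightarrow> 'a) \<Rightarrow> ('b::complex_inner \<Rightarrow> 'b) \<Rightarrow> ('a \<Rightarrow> 'b) \<Rightarrow> 'a \<Rightarrow> 'b"
  where "link_op J K T = (THE L. L \<in> bops (defect_space J K T) (defect_space_star J K T) \<and>
    (\<forall>x\<in>defect_space J K T. defect_op_star J K T (L x) = T (J (defect_op J K T x))))"

section \<open>Parameters\<close>

text \<open>
  \<open>J'\<close> is the symmetry on the whole space on which \<open>G\<close> (with values in the closed subspace \<open>N\<close>)
  is defined; \<open>S\<close> is the symmetry of the Krein space \<open>N\<close>.
\<close>

definition contraction_form :: "('a::complex_inner \<Rightarrow> 'a) \<Rightarrow> ('b::complex_inner \<Rightarrow> 'b) \<Rightarrow>
    'b set \<Rightarrow> ('a \<Rightarrow> 'b) \<Rightarrow> 'a \<Rightarrow> 'a"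
  where "contraction_form J' S N G = (\<lambda>x. J' x - adj_on UNIV N G (S (G x)))"

definition J_contraction :: "('a::complex_inner \<Rightarrow> 'a) \<Rightarrow> ('b::complex_inner \<Rightarrow> 'b) \<Rightarrow>
    'b set \<Rightarrow> ('a \<Rightarrow> 'b) \<Rightarrow> bool"
  where "J_contraction J' S N G \<longleftrightarrow> G \<in> bops UNIV N \<and> positive_op (contraction_form J' S N G)"

definition contraction_defect_op where
  "contraction_defect_op J' S N G = sqrt_op (contraction_form J' S N G)"

definition contraction_defect_space where
  "contraction_defect_space J' S N G = closure (range (contraction_defect_op J' S N G))"

text \<open>
  The triplets \<open>(\<Gamma>1, \<Gamma>2, \<Gamma>)\<close>. The second component is the operator \<open>\<Gamma>2\<close> on the defect space of
  \<open>T\<close>; it is its adjoint that is a J-contraction.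
\<close>

definition parameter_triplets ::
    "('h1::complex_inner \<Rightarrow> 'h1) \<Rightarrow> ('k1::complex_inner \<Rightarrow> 'k1) \<Rightarrow>
     ('h2::complex_inner \<Rightarrow> 'h2) \<Rightarrow> ('k2::complex_inner \<Rightarrow> 'k2) \<Rightarrow> ('h1 \<Rightarrow> 'h2) \<Rightarrow>
     (('k1 \<Rightarrow> 'h2) \<times> ('h1 \<Rightarrow> 'k2) \<times> ('k1 \<Rightarrow> 'k2)) set"
  where "parameter_triplets J1 J1' J2 J2' T =
    {(\<Gamma>1, \<Gamma>2, \<Gamma>).
       let \<DD> = defect_space J1 J2 T; \<DD>s = defect_space_star J1 J2 T;
           S = defect_sign J1 J2 T; Ss = defect_sign_star J1 J2 T;
           \<Gamma>2s = adj_on \<DD> UNIV \<Gamma>2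
       in J_contraction J1' Ss \<DD>s \<Gamma>1 \<and>
          \<Gamma>2 \<in> bops \<DD> UNIV \<and> J_contraction J2' S \<DD> \<Gamma>2s \<and>
          \<Gamma> \<in> bops (contraction_defect_space J1' Ss \<DD>s \<Gamma>1)
                   (contraction_defect_space J2' S \<DD> \<Gamma>2s) \<and>
          (\<forall>x\<in>contraction_defect_space J1' Ss \<DD>s \<Gamma>1. norm (\<Gamma> x) \<le> norm x)}"

definition block_completion ::
    "('h1::complex_inner \<Rightarrow> 'h1) \<Rightarrow> ('k1::complex_inner \<Rightarrow> 'k1) \<Rightarrow>
     ('h2::complex_inner \<Rightarrow> 'h2) \<Rightarrow> ('k2::complex_inner \<Rightarrow> 'k2) \<Rightarrow> ('h1 \<Rightarrow> 'h2) \<Rightarrow>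
     ('k1 \<Rightarrow> 'h2) \<times> ('h1 \<Rightarrow> 'k2) \<times> ('k1 \<Rightarrow> 'k2) \<Rightarrow> 'h1 \<times> 'k1 \<Rightarrow> 'h2 \<times> 'k2"
  where "block_completion J1 J1' J2 J2' T = (\<lambda>(\<Gamma>1, \<Gamma>2, \<Gamma>) (x, x').
    let \<DD> = defect_space J1 J2 T; \<DD>s = defect_space_star J1 J2 T;
        D = defect_op J1 J2 T; Ds = defect_op_star J1 J2 T;
        S = defect_sign J1 J2 T; Ss = defect_sign_star J1 J2 T;
        Ls = adj_on \<DD> \<DD>s (link_op J1 J2 T);
        D\<Gamma>1 = contraction_defect_op J1' Ss \<DD>s \<Gamma>1;
        D\<Gamma>2s = contraction_defect_op J2' S \<DD> (adj_on \<DD> UNIV \<Gamma>2)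
    in (T x + Ds (\<Gamma>1 x'),
        \<Gamma>2 (D x) + (- \<Gamma>2 (Ls (Ss (\<Gamma>1 x'))) + D\<Gamma>2s (\<Gamma> (D\<Gamma>1 x')))))"

text \<open>The block sums \<open>map_prod J1 J1'\<close> and \<open>map_prod J2 J2'\<close> are the symmetries on the products.\<close>

definition completion_solutions ::
    "('h1::complex_inner \<Rightarrow> 'h1) \<Rightarrow> ('k1::complex_inner \<Rightarrow> 'k1) \<Rightarrow>
     ('h2::complex_inner \<Rightarrow> 'h2) \<Rightarrow> ('k2::complex_inner \<Rightarrow> 'k2) \<Rightarrow> ('h1 \<Rightarrow> 'h2) \<Rightarrow>
     enat \<Rightarrow> enat \<Rightarrow> ('h1 \<times> 'k1 \<Rightarrow> 'h2 \<times> 'k2) set"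
  where "completion_solutions J1 J1' J2 J2' T m n =
    {Tt. bop Tt \<and> (\<forall>x. fst (Tt (x, 0)) = T x) \<and>
         nu_minus (defect_form (map_prod J1 J1') (map_prod J2 J2') Tt) = m \<and>
         nu_minus (defect_form_star (map_prod J1 J1') (map_prod J2 J2') Tt) = n}"

end

(*
Spectral theory enters only through the spectral projection onto the negative subspace of a bounded
selfadjoint operator X; nu_minus X is then the largest dimension of a subspace on which the form of X
is negative definite.  The Julia operator (x, e) |-> (T x + D_s e, D x - L^* S_s e) is isometric between
indefinite inner product spaces.  Adding an auxiliary variable y in H_2' to the defect form of a
completion therefore gives one form that can be diagonalised in two ways: on one side it is the defect
form of the completion plus J_2', on the other side the defect form of T plus the form
Q(v, y) = <J_1' v - G_1^* S_s G_1 v, v> + 2 Re <Y v, y> + <J_2' y - G_2 S G_2^* y, y>.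
Counting negative squares, the completion has the minimal index exactly if Q >= 0, which says that
G_1 and G_2^* are J-contractions and that Y = D_2 G D_1 with a contraction G.  The adjoint of the
completion leads to the same Q, so both index conditions hold simultaneously.
*)
theory Submission
  imports Defs
begin

section \<open>Complex Hilbert spaces\<close>

text \<open>The form \<open>Q\<close> can be written down only for a completion with off-diagonal
  entries \<open>D_s G_1\<close> and \<open>G_2 D\<close>, and reaching this shape is the main
  obstacle: \<open>A = J_1 - T^* J_2 T\<close> is indefinite, so no norm identity bounds the lower
  left entry \<open>C\<close> by \<open>D\<close>. Minimality of the index is therefore used twice.
  It first makes \<open>\<langle>A x, x\<rangle> + 2 Re \<langle>C x, y\<rangle> + \<langle>J_2' y,
  y\<rangle>\<close> nonnegative on the complement, for this form, of the negative subspace of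
  \<open>A\<close>; this bounds \<open>C\<close>, and the finite-dimensional rest is handled with a
  basis. Afterwards it gives \<open>Q \<ge> 0\<close>. Both times an additional negative direction
  would embed a space of dimension \<open>k + 1\<close> in one of dimension at most
  \<open>k = \<kappa>_1\<close>, hence the finiteness. The link operator meets the same lack of
  definiteness: \<open>A\<close> and \<open>B = J_2 - T J_1 T^*\<close> are intertwined, and the
  comparison of \<open>|A|\<close> with \<open>|B|\<close> comes from Krein's lemma on symmetrisable
  operators. Solvability rests on \<open>\<nu>_-(J_2') \<le> \<kappa>_1\<close> and its dual:
  negative basis vectors of \<open>J_2'\<close> are sent to those of \<open>A\<close>, which yields
  a J-contraction, and \<open>\<Gamma> = 0\<close> completes the triplet.\<close>

instance chilbert_space \<subseteq> banach ..

lemma cinner_add_right: "cinner x (y + z) = cinner x y + cinner (x::'a::complex_inner) z"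
  by (metis cinner_commute cinner_add_left complex_cnj_add)

lemma cinner_scaleC_right: "cinner x (a *\<^sub>C y) = cnj a * cinner (x::'a::complex_inner) y"
  by (metis cinner_commute cinner_scaleC_left complex_cnj_mult)

lemma scaleR_cinner_left: "cinner (r *\<^sub>R x) y = r *\<^sub>R cinner (x::'a::complex_inner) y"
  by (metis scaleC_of_real cinner_scaleC_left scaleR_conv_of_real)

lemma scaleR_cinner_right: "cinner x (r *\<^sub>R y) = r *\<^sub>R cinner (x::'a::complex_inner) y"
  by (metis scaleC_of_real cinner_scaleC_right scaleR_conv_of_real complex_cnj_complex_of_real)

lemma cinner_self: "cinner x x = of_real ((norm (x::'a::complex_inner))\<^sup>2)"
proof -
  have "Im (cinner x x) = 0"
    using cinner_commute [of x x] by (simp add: complex_eq_iff)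
  moreover have "Re (cinner x x) = (norm x)\<^sup>2"
    by (metis inner_eq_Re_cinner power2_norm_eq_inner)
  ultimately show ?thesis by (simp add: complex_eq_iff)
qed

lemma cmod_cinner_self: "cmod (cinner x x) = (norm (x::'a::complex_inner))\<^sup>2"
  unfolding cinner_self norm_of_real by simp

lemma norm_scaleC: "norm (a *\<^sub>C x) = cmod a * norm (x::'a::complex_inner)"
proof -
  have "complex_of_real ((norm (a *\<^sub>C x))\<^sup>2) = (a * cnj a) * of_real ((norm x)\<^sup>2)"
    unfolding cinner_self [symmetric] by (simp add: cinner_scaleC_left cinner_scaleC_right)
  also have "\<dots> = of_real ((cmod a * norm x)\<^sup>2)"
    by (simp add: complex_norm_square power_mult_distrib del: of_real_power)
  finally have "(norm (a *\<^sub>C x))\<^sup>2 = (cmod a * norm x)\<^sup>2"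
    using of_real_eq_iff by blast
  then show ?thesis by simp
qed

lemma Re_cinner_le: "\<bar>Re (cinner x y)\<bar> \<le> norm x * norm (y::'a::complex_inner)"
  using Cauchy_Schwarz_ineq2 [of x y] by (simp add: inner_eq_Re_cinner)

text \<open>The real inequality suffices: multiplying \<open>x\<close> by the unimodular
  \<open>a\<close> makes the inner product equal to its modulus.\<close>

lemma norm_cinner_le: "cmod (cinner x y) \<le> norm x * norm (y::'a::complex_inner)"
proof (cases "cinner x y = 0")
  case False
  define a where "a = cnj (cinner x y) / cmod (cinner x y)"
  have a: "cmod a = 1" using False by (simp add: a_def norm_divide)
  have "cinner (a *\<^sub>C x) y = cmod (cinner x y)"
    using False complex_norm_square [of "cinner x y"]
    by (simp add: a_def cinner_scaleC_left field_simps power2_eq_square)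
  then have "cmod (cinner x y) = Re (cinner (a *\<^sub>C x) y)" by simp
  also have "\<dots> \<le> norm (a *\<^sub>C x) * norm y" using Re_cinner_le [of "a *\<^sub>C x" y] by linarith
  finally show ?thesis using a by (simp add: norm_scaleC)
qed simp

lemma bounded_bilinear_cinner: "bounded_bilinear (cinner :: 'a::complex_inner \<Rightarrow> 'a \<Rightarrow> complex)"
  by standard (auto simp: cinner_add_left cinner_add_right scaleR_cinner_left scaleR_cinner_right
      intro!: exI [of _ 1] norm_cinner_le)

interpretation cinner: bounded_bilinear "cinner :: 'a::complex_inner \<Rightarrow> 'a \<Rightarrow> complex"
  by (rule bounded_bilinear_cinner)

declare cinner.zero_left [simp] cinner.zero_right [simp]

lemmas cinner_simps = cinner_add_left cinner_add_right cinner.diff_left cinner.diff_right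
  cinner.minus_left cinner.minus_right cinner_scaleC_left cinner_scaleC_right

lemma Re_cinner_commute: "Re (cinner x y) = Re (cinner y (x::'a::complex_inner))"
  by (subst cinner_commute) simp

lemma cinner_eq_zeroI: "(\<And>x. cinner x y = 0) \<Longrightarrow> y = (0::'a::complex_inner)"
  using cinner_self [of y] by simp

lemma cinner_eqI: "(\<And>x. cinner x y = cinner x z) \<Longrightarrow> y = (z::'a::complex_inner)"
  using cinner_eq_zeroI [of "y - z"] by (simp add: cinner.diff_right)

lemma cinner_eqI_left: "(\<And>x. cinner y x = cinner z x) \<Longrightarrow> y = (z::'a::complex_inner)"
  by (rule cinner_eqI) (metis cinner_commute)

lemma norm_add_sq: "(norm (x + y))\<^sup>2 = (norm x)\<^sup>2 + 2 * Re (cinner x y) + (norm (y::'a::complex_inner))\<^sup>2"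
  by (simp add: power2_norm_eq_inner inner_add inner_commute flip: inner_eq_Re_cinner)

lemma norm_add_sq_orthogonal:
  "cinner x y = 0 \<Longrightarrow> (norm (x + y))\<^sup>2 = (norm x)\<^sup>2 + (norm (y::'a::complex_inner))\<^sup>2"
  by (simp add: norm_add_sq)

text \<open>The first variation at a minimum. Evaluating at \<open>- b / (a + 1)\<close> rather than
  at the vertex \<open>- b / a\<close> treats \<open>a = 0\<close> without a case
  distinction.\<close>

lemma nonneg_quadratic_coeffs:
  fixes a b :: real
  assumes "\<And>t. 0 \<le> a * t\<^sup>2 + 2 * t * b" and "a \<ge> 0"
  shows "b = 0"
proof -
  define t where "t = - b / (a + 1)"
  have "a * t\<^sup>2 + 2 * t * b = - (a + 2) * (b / (a + 1))\<^sup>2"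
  proof -
    define c where "c = b / (a + 1)"
    have c: "b = c * (a + 1)" "t = - c" using \<open>a \<ge> 0\<close> by (simp_all add: c_def t_def)
    show ?thesis unfolding c_def [symmetric] c(2) by (subst c(1)) (simp add: power2_eq_square algebra_simps)
  qed
  with assms(1)[of t] have "(a + 2) * (b / (a + 1))\<^sup>2 \<le> 0"
    by (simp only: mult_minus_left)
  then have "(b / (a + 1))\<^sup>2 = 0"
    using \<open>a \<ge> 0\<close> by (smt (verit) mult_pos_pos zero_le_power2)
  then show ?thesis using \<open>a \<ge> 0\<close> by simp
qed

text \<open>
  The minimiser of \<open>\<parallel>x\<parallel>\<^sup>2 - 2 f x\<close> over \<open>M\<close> gives the Riesz representation for \<open>M = UNIV\<close> and the
  orthogonal projection onto \<open>M\<close> for \<open>f = inner a\<close>.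
\<close>

lemma riesz_on_closed_subspace:
  fixes f :: "'a::{real_inner,complete_space} \<Rightarrow> real"
  assumes M: "closed M" "subspace M" and f: "bounded_linear f"
  shows "\<exists>z\<in>M. \<forall>x\<in>M. z \<bullet> x = f x"
proof -
  interpret f: bounded_linear f by (rule f)
  obtain K where K: "\<And>x. norm (f x) \<le> norm x * K" using f.bounded by blast
  define \<phi> where "\<phi> x = x \<bullet> x - 2 * f x" for x
  have low: "- K\<^sup>2 \<le> \<phi> x" for x
  proof -
    have "\<phi> x \<ge> (norm x)\<^sup>2 - 2 * (norm x * K)"
      using K [of x] by (simp add: \<phi>_def power2_norm_eq_inner)
    moreover have "0 \<le> (norm x - K)\<^sup>2" by simp
    ultimately show ?thesis by (simp add: power2_diff algebra_simps)
  qed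
  define m where "m = Inf (\<phi> ` M)"
  have "0 \<in> M" using M by (simp add: subspace_0)
  have bdd: "bdd_below (\<phi> ` M)" using low by (meson bdd_belowI2)
  have m: "m \<le> \<phi> x" if "x \<in> M" for x
    unfolding m_def using that bdd by (rule cINF_lower [rotated])
  have "\<exists>x\<in>M. \<phi> x < m + 1 / Suc n" for n
    using cInf_lessD [of "\<phi> ` M" "m + 1 / Suc n"] \<open>0 \<in> M\<close> by (auto simp: m_def)
  then obtain X where X: "\<And>n. X n \<in> M" "\<And>n. \<phi> (X n) < m + 1 / Suc n" by metis
  \<comment> \<open>The parallelogram law: the midpoint of \<open>x\<close> and \<open>y\<close>
    lies in \<open>M\<close>, so its value is at least \<open>m\<close>. It makes a minimising
    sequence Cauchy.\<close>
  have par: "(norm (x - y))\<^sup>2 \<le> 2 * \<phi> x + 2 * \<phi> y - 4 * m" if "x \<in> M" "y \<in> M" for x y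
  proof -
    have "(1/2) *\<^sub>R (x + y) \<in> M" using that M by (simp add: subspace_add subspace_scale)
    from m [OF this] have "m \<le> \<phi> ((1/2) *\<^sub>R (x + y))" .
    also have "4 * \<dots> = (x + y) \<bullet> (x + y) - 4 * f x - 4 * f y"
      by (simp add: \<phi>_def f.add f.scale inner_simps inner_commute algebra_simps)
    finally have "4 * m \<le> (x + y) \<bullet> (x + y) - 4 * f x - 4 * f y" by linarith
    then show ?thesis
      unfolding power2_norm_eq_inner
      by (simp add: \<phi>_def inner_add inner_diff inner_commute)
  qed
  have "Cauchy X"
  proof (rule metric_CauchyI)
    fix e :: real assume "0 < e"
    then obtain N where N: "inverse (real (Suc N)) < e\<^sup>2 / 4"
      using reals_Archimedean [of "e\<^sup>2 / 4"] by auto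
    have "dist (X i) (X j) < e" if "i \<ge> N" "j \<ge> N" for i j
    proof -
      have "(norm (X i - X j))\<^sup>2 < 2 * (m + 1 / Suc i) + 2 * (m + 1 / Suc j) - 4 * m"
        using par [OF X(1) X(1), of i j] X(2)[of i] X(2)[of j] by (simp only: distrib_left)
      also have "\<dots> = 2 / Suc i + 2 / Suc j" by simp
      also have "\<dots> \<le> 2 / Suc N + 2 / Suc N"
        using that by (intro add_mono divide_left_mono) auto
      also have "\<dots> = 4 * inverse (real (Suc N))" by (simp add: inverse_eq_divide)
      also have "\<dots> < e\<^sup>2" using N by linarith
      finally show ?thesis using \<open>0 < e\<close> by (simp add: dist_norm power_less_imp_less_base)
    qed
    then show "\<exists>N. \<forall>i\<ge>N. \<forall>j\<ge>N. dist (X i) (X j) < e" by blast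
  qed
  then obtain z where z: "X \<longlonglongrightarrow> z" using Cauchy_convergent convergent_def by blast
  have "z \<in> M" using closed_sequentially [OF M(1) X(1) z] .
  have "(\<lambda>n. \<phi> (X n)) \<longlonglongrightarrow> \<phi> z"
    unfolding \<phi>_def by (intro tendsto_intros z f.tendsto)
  moreover have "(\<lambda>n. m + 1 / Suc n) \<longlonglongrightarrow> m"
    using LIMSEQ_inverse_real_of_nat_add [of m] by (simp add: inverse_eq_divide)
  ultimately have "\<phi> z \<le> m"
    using X(2) by (intro LIMSEQ_le) (auto intro: less_imp_le)
  have "z \<bullet> x = f x" if "x \<in> M" for x
  proof -
    have "0 \<le> (x \<bullet> x) * t\<^sup>2 + 2 * t * (z \<bullet> x - f x)" for t
    proof -
      have "z + t *\<^sub>R x \<in> M" using \<open>z \<in> M\<close> that M by (simp add: subspace_add subspace_scale)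
      from m [OF this] \<open>\<phi> z \<le> m\<close> have "\<phi> z \<le> \<phi> (z + t *\<^sub>R x)" by linarith
      then show ?thesis
        by (simp add: \<phi>_def f.add f.scale inner_add inner_commute algebra_simps power2_eq_square)
    qed
    from nonneg_quadratic_coeffs [OF this] show ?thesis by simp
  qed
  with \<open>z \<in> M\<close> show ?thesis by blast
qed

subsection \<open>Bounded operators\<close>

lemma bop_bounded_linear: "bop A \<Longrightarrow> bounded_linear A"
  and bop_scaleC: "bop A \<Longrightarrow> A (c *\<^sub>C x) = c *\<^sub>C A x"
  by (simp_all add: bop_iff)

lemma bopI:
  assumes "\<And>x y. A (x + y) = A x + A y" "\<And>c x. A (c *\<^sub>C x) = c *\<^sub>C A x"
    "\<And>x. norm (A x) \<le> K * norm x"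
  shows "bop A"
  using assms unfolding bops_def by auto

lemma bop_add: "bop A \<Longrightarrow> A (x + y) = A x + A y"
  and bop_diff: "bop A \<Longrightarrow> A (x - y) = A x - A y"
  and bop_minus: "bop A \<Longrightarrow> A (- x) = - A x"
  and bop_zero: "bop A \<Longrightarrow> A 0 = 0"
  and bop_sum: "bop A \<Longrightarrow> A (sum f I) = (\<Sum>i\<in>I. A (f i))"
  and bop_scaleR: "bop A \<Longrightarrow> A (r *\<^sub>R x) = r *\<^sub>R A x"
  using bop_bounded_linear [of A]
  by (simp_all add: linear_simps linear_sum bounded_linear.linear)

lemma bop_tendsto: "bop A \<Longrightarrow> (f \<longlongrightarrow> l) F \<Longrightarrow> ((\<lambda>x. A (f x)) \<longlongrightarrow> A l) F"
  using bop_bounded_linear bounded_linear.tendsto by blast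

lemma bop_continuous_on: "bop A \<Longrightarrow> continuous_on S A"
  by (simp add: bop_bounded_linear linear_continuous_on)

lemma bop_bound: "bop A \<Longrightarrow> \<exists>K\<ge>0. \<forall>x. norm (A x) \<le> K * norm x"
  using bounded_linear.nonneg_bounded [OF bop_bounded_linear] by (metis mult.commute)

lemma scaleC_Pair [simp]: "c *\<^sub>C (x, y) = (c *\<^sub>C x, c *\<^sub>C y)"
  by (simp add: scaleC_prod_def)

lemma cinner_Pair: "cinner (a, b) (c, d) = cinner a c + cinner b d"
  by (simp add: cinner_prod_def)

lemma bounded_linear_scaleC: "bounded_linear (\<lambda>x::'a::complex_inner. c *\<^sub>C x)"
proof (rule bounded_linear_intro [of _ "cmod c"])
  show "c *\<^sub>C r *\<^sub>R x = r *\<^sub>R c *\<^sub>C x" for r and x :: 'a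
    by (simp flip: scaleC_of_real add: scaleC_scaleC mult.commute)
qed (simp_all add: scaleC_add_right norm_scaleC mult.commute)

lemma scaleC_minus_scaleR: "c *\<^sub>C r *\<^sub>R x = r *\<^sub>R c *\<^sub>C (x::'a::complex_inner)"
  by (simp flip: scaleC_of_real add: scaleC_scaleC mult.commute)

lemma bop_id: "bop (\<lambda>x. x)" and bop_0: "bop (\<lambda>x. 0)"
  by (simp_all add: bop_iff bounded_linear_ident)

lemma bop_compose: "bop A \<Longrightarrow> bop B \<Longrightarrow> bop (\<lambda>x. A (B x))"
  by (auto simp: bop_iff intro: bounded_linear_compose [of A B])

lemma bop_plus: "bop A \<Longrightarrow> bop B \<Longrightarrow> bop (\<lambda>x. A x + B x)"
  and bop_sub: "bop A \<Longrightarrow> bop B \<Longrightarrow> bop (\<lambda>x. A x - B x)"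
  and bop_scaleR_op: "bop A \<Longrightarrow> bop (\<lambda>x. r *\<^sub>R A x)"
  by (simp_all add: bop_iff bounded_linear_add bounded_linear_sub
      bounded_linear_const_scaleR scaleC_add_right complex_vector.scale_right_diff_distrib
      scaleC_minus_scaleR)

lemma bop_fst: "bop fst" and bop_snd: "bop snd"
  by (simp_all add: bop_iff bounded_linear_fst bounded_linear_snd scaleC_prod_def)

lemma bop_Pair: "bop A \<Longrightarrow> bop B \<Longrightarrow> bop (\<lambda>x. (A x, B x))"
  by (simp add: bop_iff bounded_linear_Pair)

lemma subspace_imp_real: "complex_vector.subspace M \<Longrightarrow> subspace (M::'a::complex_inner set)"
  unfolding subspace_def complex_vector.subspace_def by (metis scaleC_of_real)

lemma complex_linear_bop: "bop A \<Longrightarrow> Vector_Spaces.linear scaleC scaleC A"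
  by unfold_locales (simp_all add: bop_add bop_scaleC)

text \<open>The real theorem represents \<open>Re f\<close>; complex linearity recovers
  \<open>Im f\<close> by testing with \<open>\<i> *\<^sub>C x\<close>.\<close>

lemma riesz_complex:
  fixes f :: "'a::chilbert_space \<Rightarrow> complex"
  assumes M: "closed M" "complex_vector.subspace M" and f: "bounded_linear f"
    and lin: "\<And>c x. f (c *\<^sub>C x) = c * f x"
  shows "\<exists>z\<in>M. \<forall>x\<in>M. cinner x z = f x"
proof -
  have "bounded_linear (\<lambda>x. Re (f x))"
    using f bounded_linear_compose bounded_linear_Re by blast
  from riesz_on_closed_subspace [OF M(1) subspace_imp_real [OF M(2)] this]
  obtain z where z: "z \<in> M" "\<And>x. x \<in> M \<Longrightarrow> Re (cinner x z) = Re (f x)"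
    by (metis inner_eq_Re_cinner inner_commute)
  have "cinner x z = f x" if "x \<in> M" for x
  proof (rule complex_eqI)
    have "Re (cinner (\<i> *\<^sub>C x) z) = Re (f (\<i> *\<^sub>C x))"
      using that M(2) by (intro z(2)) (simp add: complex_vector.subspace_scale)
    then show "Im (cinner x z) = Im (f x)" by (simp add: lin cinner_scaleC_left)
  qed (use z that in auto)
  with z show ?thesis by blast
qed

subsection \<open>Adjoints and orthogonal projections\<close>

text \<open>Adjointness as a relation, which avoids computing with the description in
  \<open>adj_on\<close>. If \<open>A\<close> is bounded and linear, then so is
  \<open>B\<close>.\<close>

definition adjoint_pair :: "('a::complex_inner \<Rightarrow> 'b::complex_inner) \<Rightarrow> ('b \<Rightarrow> 'a) \<Rightarrow> bool"
  where "adjoint_pair A B \<longleftrightarrow> (\<forall>x y. cinner (A x) y = cinner x (B y))"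

lemma bop_of_adjoint_pair:
  assumes A: "bop A" and B: "adjoint_pair A B"
  shows "bop B"
proof -
  obtain K where K: "K \<ge> 0" "\<And>x. norm (A x) \<le> K * norm x" using bop_bound [OF A] by blast
  show ?thesis
  proof (rule bopI [of _ K])
    show "B (x + y) = B x + B y" for x y
      using B by (intro cinner_eqI) (simp add: adjoint_pair_def cinner_add_right flip: B[unfolded adjoint_pair_def, rule_format])
    show "B (c *\<^sub>C x) = c *\<^sub>C B x" for c x
      by (intro cinner_eqI) (simp add: cinner_scaleC_right flip: B[unfolded adjoint_pair_def, rule_format])
    show "norm (B y) \<le> K * norm y" for y
    proof (cases "B y = 0")
      case False
      have "(norm (B y))\<^sup>2 = cmod (cinner (B y) (B y))" by (simp add: cmod_cinner_self)
      also have "\<dots> = cmod (cinner (A (B y)) y)" using B by (simp add: adjoint_pair_def)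
      also have "\<dots> \<le> norm (A (B y)) * norm y" by (rule norm_cinner_le)
      also have "\<dots> \<le> K * norm (B y) * norm y" using K by (simp add: mult_right_mono)
      finally have "norm (B y) * norm (B y) \<le> norm (B y) * (K * norm y)"
        by (simp add: power2_eq_square mult_ac)
      then show ?thesis using False by simp
    qed (use K in simp)
  qed
qed

lemma adjoint_pair_exists:
  fixes A :: "'a::chilbert_space \<Rightarrow> 'b::complex_inner"
  assumes A: "bop A"
  shows "\<exists>B. adjoint_pair A B"
proof -
  have "\<exists>z. \<forall>x. cinner x z = cinner (A x) y" for y
  proof -
    have "bounded_linear (\<lambda>x. cinner (A x) y)"
      using bounded_linear_compose [OF cinner.bounded_linear_left bop_bounded_linear [OF A]] .
    from riesz_complex [OF closed_UNIV complex_vector.subspace_UNIV this]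
    show ?thesis by (auto simp: bop_scaleC [OF A] cinner_scaleC_left)
  qed
  then show ?thesis unfolding adjoint_pair_def by metis
qed

lemma adjoint_pair_sym: "adjoint_pair A B \<Longrightarrow> adjoint_pair B A"
  unfolding adjoint_pair_def by (metis cinner_commute)

lemma adj_on_eqI:
  assumes M: "complex_vector.subspace M" and B: "B \<in> bops N M"
    "\<And>x y. x \<in> M \<Longrightarrow> y \<in> N \<Longrightarrow> cinner (A x) y = cinner x (B y)"
  shows "adj_on M N A = B"
  unfolding adj_on_def
proof (rule the_equality)
  fix C assume C: "C \<in> bops N M \<and> (\<forall>x\<in>M. \<forall>y\<in>N. cinner (A x) y = cinner x (C y))"
  show "C = B"
  proof
    fix y
    show "C y = B y"
    proof (cases "y \<in> N")
      case True
      then have "C y \<in> M" "B y \<in> M" using B C by (auto simp: bops_def)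
      then have *: "C y - B y \<in> M" using M by (simp add: complex_vector.subspace_diff)
      then have "cinner (C y - B y) (C y) = cinner (C y - B y) (B y)"
        using B(2)[OF * True] C * True by simp
      then have "cinner (C y - B y) (C y - B y) = 0" by (simp add: cinner.diff_right)
      then show ?thesis by (simp add: cinner_self)
    next
      case False
      then show ?thesis using B(1) C by (auto simp: bops_def PiE_def extensional_def)
    qed
  qed
qed (use B in auto)

lemma adj_eqI: "adjoint_pair A B \<Longrightarrow> bop B \<Longrightarrow> adj A = B"
  by (rule adj_on_eqI) (auto simp: adjoint_pair_def)

lemma
  fixes A :: "'a::chilbert_space \<Rightarrow> 'b::complex_inner"
  assumes "bop A"
  shows adjoint_pair_adj: "adjoint_pair A (adj A)" and bop_adj: "bop (adj A)"
  using adjoint_pair_exists [OF assms] bop_of_adjoint_pair [OF assms] adj_eqI [of A] by auto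

lemma cinner_adj:
  fixes A :: "'a::chilbert_space \<Rightarrow> 'b::complex_inner"
  assumes "bop A"
  shows "cinner (A x) y = cinner x (adj A y)" "cinner y (A x) = cinner (adj A y) x"
  using adjoint_pair_adj [OF assms] adjoint_pair_sym [OF adjoint_pair_adj [OF assms]]
  by (simp_all add: adjoint_pair_def)

lemma adj_adj:
  fixes A :: "'a::chilbert_space \<Rightarrow> 'b::chilbert_space"
  assumes "bop A" shows "adj (adj A) = A"
  by (rule adj_eqI [OF adjoint_pair_sym [OF adjoint_pair_adj [OF assms]] assms])

section \<open>Selfadjoint and positive operators through their quadratic forms\<close>

definition selfadjoint :: "('a::complex_inner \<Rightarrow> 'a) \<Rightarrow> bool"
  where "selfadjoint A \<longleftrightarrow> bop A \<and> adjoint_pair A A"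

lemma selfadjoint_bop: "selfadjoint A \<Longrightarrow> bop A"
  by (simp add: selfadjoint_def)

lemma selfadjoint_cinner: "selfadjoint A \<Longrightarrow> cinner (A x) y = cinner x (A y)"
  by (simp add: selfadjoint_def adjoint_pair_def)

lemma selfadjointI: "bop A \<Longrightarrow> (\<And>x y. cinner (A x) y = cinner x (A y)) \<Longrightarrow> selfadjoint A"
  by (simp add: selfadjoint_def adjoint_pair_def)

lemma selfadjoint_iff:
  fixes A :: "'a::chilbert_space \<Rightarrow> 'a"
  shows "selfadjoint A \<longleftrightarrow> bop A \<and> adj A = A"
  by (metis selfadjoint_def adj_eqI adjoint_pair_adj)

lemma selfadjoint_Re:
  assumes "selfadjoint A" shows "cinner (A x) x = of_real (Re (cinner (A x) x))"
proof -
  have "cnj (cinner (A x) x) = cinner (A x) x"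
    using assms by (metis selfadjoint_cinner cinner_commute)
  then show ?thesis by (simp add: complex_eq_iff)
qed

lemma selfadjoint_id: "selfadjoint (\<lambda>x. x)"
  by (simp add: selfadjointI bop_id)

lemma selfadjoint_zero: "selfadjoint (\<lambda>x. 0)"
  by (rule selfadjointI) (auto simp: bop_0)

lemma selfadjoint_plus: "selfadjoint A \<Longrightarrow> selfadjoint B \<Longrightarrow> selfadjoint (\<lambda>x. A x + B x)"
  by (rule selfadjointI)
     (simp_all add: bop_plus selfadjoint_bop selfadjoint_cinner [of A] selfadjoint_cinner [of B] cinner_simps)

lemma selfadjoint_sub: "selfadjoint A \<Longrightarrow> selfadjoint B \<Longrightarrow> selfadjoint (\<lambda>x. A x - B x)"
  by (rule selfadjointI)
     (simp_all add: bop_sub selfadjoint_bop selfadjoint_cinner [of A] selfadjoint_cinner [of B] cinner_simps)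

lemma selfadjoint_scaleR: "selfadjoint A \<Longrightarrow> selfadjoint (\<lambda>x. r *\<^sub>R A x)"
  by (rule selfadjointI)
     (simp_all add: bop_scaleR_op selfadjoint_bop selfadjoint_cinner [of A] scaleR_cinner_left scaleR_cinner_right)

lemma selfadjoint_compose:
  assumes "selfadjoint A" "selfadjoint B" "\<And>x. A (B x) = B (A x)"
  shows "selfadjoint (\<lambda>x. A (B x))"
proof (rule selfadjointI)
  show "bop (\<lambda>x. A (B x))" using bop_compose assms(1,2) selfadjoint_bop by blast
  show "cinner (A (B x)) y = cinner x (A (B y))" for x y
    using assms(3) selfadjoint_cinner [OF assms(1)] selfadjoint_cinner [OF assms(2)] by simp
qed

text \<open>Polarisation with \<open>x + y\<close> kills the symmetric part of the sesquilinear
  form, and \<open>\<i> *\<^sub>C x\<close> in place of \<open>x\<close> the rest. Over the reals a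
  rotation by a right angle would be a counterexample.\<close>

lemma form_zero_imp_zero:
  fixes A :: "'a::complex_inner \<Rightarrow> 'a"
  assumes A: "bop A" and 0: "\<And>x. cinner (A x) x = 0"
  shows "A x = 0"
proof -
  have *: "cinner (A x) y + cinner (A y) x = 0" for x y
    using 0 [of "x + y"] 0 [of x] 0 [of y] by (simp add: bop_add [OF A] cinner_simps add.commute)
  have "cinner (A x) y = 0" for x y
    using * [of x y] * [of "\<i> *\<^sub>C x" y]
    by (simp add: bop_scaleC [OF A] cinner_simps complex_eq_iff)
  from this [of x "A x"] show ?thesis by (simp add: cinner_self)
qed

lemma form_eq_imp_eq:
  assumes "bop A" "bop B" "\<And>x. cinner (A x) x = cinner (B x) x"
  shows "A = B"
  using form_zero_imp_zero [OF bop_sub [OF assms(1,2)]] assms(3)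
  by (auto simp: cinner.diff_left)

text \<open>A quadratic form with real values is hermitian, again by polarisation with
  \<open>x\<close> and \<open>\<i> *\<^sub>C x\<close>.\<close>

lemma positive_op_selfadjoint:
  assumes "positive_op A" shows "selfadjoint A"
proof (rule selfadjointI)
  show A: "bop A" using assms by (simp add: positive_op_def)
  have r: "Im (cinner (A x) x) = 0" for x
    using assms by (auto simp: positive_op_def complex_nonneg_Reals_iff)
  fix x y
  have "Im (cinner (A x) y + cinner (A y) x) = 0" for x y
    using r [of "x + y"] r [of x] r [of y] by (simp add: bop_add [OF A] cinner_simps)
  from this [of x y] this [of "\<i> *\<^sub>C x" y] have "cinner (A x) y = cnj (cinner (A y) x)"
    by (simp add: bop_scaleC [OF A] cinner_simps complex_eq_iff)
  then show "cinner (A x) y = cinner x (A y)" by (metis cinner_commute)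
qed

lemma positive_op_iff:
  "positive_op A \<longleftrightarrow> selfadjoint A \<and> (\<forall>x. 0 \<le> Re (cinner (A x) x))"
proof
  assume "positive_op A"
  then show "selfadjoint A \<and> (\<forall>x. 0 \<le> Re (cinner (A x) x))"
    using positive_op_selfadjoint by (auto simp: positive_op_def complex_nonneg_Reals_iff)
next
  assume A: "selfadjoint A \<and> (\<forall>x. 0 \<le> Re (cinner (A x) x))"
  then have "cinner (A x) x \<in> \<real>\<^sub>\<ge>\<^sub>0" for x
    by (subst selfadjoint_Re) auto
  then show "positive_op A" using A by (simp add: positive_op_def selfadjoint_bop)
qed

lemma orth_projection_iff:
  fixes P :: "'a::chilbert_space \<Rightarrow> 'a"
  shows "orth_projection P \<longleftrightarrow> selfadjoint P \<and> (\<forall>x. P (P x) = P x)"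
  by (auto simp: orth_projection_def selfadjoint_iff fun_eq_iff)

section \<open>Orthogonal projections onto closed subspaces\<close>

definition proj_onto :: "'a::complex_inner set \<Rightarrow> 'a \<Rightarrow> 'a"
  where "proj_onto M x = (THE y. y \<in> M \<and> (\<forall>z\<in>M. cinner z y = cinner z x))"

context
  fixes M :: "'a::chilbert_space set"
  assumes M: "closed M" "complex_vector.subspace M"
begin

lemma proj_onto_ex1: "\<exists>!y. y \<in> M \<and> (\<forall>z\<in>M. cinner z y = cinner z x)"
proof -
  have "\<exists>y\<in>M. \<forall>z\<in>M. cinner z y = cinner z x"
    by (rule riesz_complex [OF M])
       (simp_all add: cinner.bounded_linear_left cinner_scaleC_left)
  moreover have "y = y'" if "y \<in> M" "y' \<in> M" "\<forall>z\<in>M. cinner z y = cinner z x"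
    "\<forall>z\<in>M. cinner z y' = cinner z x" for y y'
  proof -
    have "y - y' \<in> M" using that M by (simp add: complex_vector.subspace_diff)
    then have "cinner (y - y') (y - y') = 0" using that by (simp add: cinner.diff_right)
    then show ?thesis by (simp add: cinner_self)
  qed
  ultimately show ?thesis by blast
qed

lemma proj_onto_in: "proj_onto M x \<in> M"
  and proj_onto_cinner: "z \<in> M \<Longrightarrow> cinner z (proj_onto M x) = cinner z x"
  unfolding proj_onto_def using theI' [OF proj_onto_ex1, of x] by auto

lemma proj_onto_eqI: "y \<in> M \<Longrightarrow> (\<And>z. z \<in> M \<Longrightarrow> cinner z y = cinner z x) \<Longrightarrow> proj_onto M x = y"
  using proj_onto_ex1 [of x] proj_onto_in [of x] proj_onto_cinner [of _ x] by blast

lemma proj_onto_id: "x \<in> M \<Longrightarrow> proj_onto M x = x"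
  by (rule proj_onto_eqI) auto

lemma proj_onto_iff: "proj_onto M x = x \<longleftrightarrow> x \<in> M"
  using proj_onto_in proj_onto_id by metis

lemma selfadjoint_proj_onto: "selfadjoint (proj_onto M)"
proof (rule selfadjointI)
  show sym: "cinner (proj_onto M x) y = cinner x (proj_onto M y)" for x y
    by (metis proj_onto_in proj_onto_cinner cinner_commute)
  show "bop (proj_onto M)"
  proof (rule bopI [of _ 1])
    show "proj_onto M (x + y) = proj_onto M x + proj_onto M y" for x y
      using M by (intro proj_onto_eqI) (auto simp: proj_onto_in cinner_add_right proj_onto_cinner complex_vector.subspace_add)
    show "proj_onto M (c *\<^sub>C x) = c *\<^sub>C proj_onto M x" for c x
      using M by (intro proj_onto_eqI) (auto simp: proj_onto_in cinner_scaleC_right proj_onto_cinner complex_vector.subspace_scale)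
    show "norm (proj_onto M x) \<le> 1 * norm x" for x
    proof -
      have "(norm (proj_onto M x))\<^sup>2 = cmod (cinner (proj_onto M x) x)"
        using proj_onto_cinner [OF proj_onto_in, of x x] by (metis cmod_cinner_self)
      also have "\<dots> \<le> norm (proj_onto M x) * norm x" by (rule norm_cinner_le)
      finally show ?thesis by (cases "proj_onto M x = 0") (auto simp: power2_eq_square)
    qed
  qed
qed

lemma orth_projection_proj_onto: "orth_projection (proj_onto M)"
  by (simp add: orth_projection_iff selfadjoint_proj_onto proj_onto_iff proj_onto_in)

end

lemma orth_projection_selfadjoint: "orth_projection P \<Longrightarrow> selfadjoint (P :: 'a::chilbert_space \<Rightarrow> 'a)"
  and orth_projection_idem: "orth_projection P \<Longrightarrow> P (P x) = P x"
  by (auto simp: orth_projection_iff)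

lemma orth_projection_cinner:
  assumes "orth_projection (P :: 'a::chilbert_space \<Rightarrow> 'a)"
  shows "cinner (P x) x = of_real ((norm (P x))\<^sup>2)"
  using assms by (metis orth_projection_iff selfadjoint_cinner cinner_self)

lemma orth_projection_pythagoras:
  assumes P: "orth_projection (P :: 'a::chilbert_space \<Rightarrow> 'a)"
  shows "(norm x)\<^sup>2 = (norm (P x))\<^sup>2 + (norm (x - P x))\<^sup>2"
proof -
  have "cinner (P x) (x - P x) = 0"
    using P by (simp add: orth_projection_iff selfadjoint_cinner [of P] bop_diff [of P] selfadjoint_bop)
  from norm_add_sq_orthogonal [OF this] show ?thesis by simp
qed

lemma orth_projection_norm_le:
  assumes P: "orth_projection (P :: 'a::chilbert_space \<Rightarrow> 'a)"
  shows "norm (P x) \<le> norm x"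
  using orth_projection_pythagoras [OF P, of x] by (simp add: power2_le_imp_le)

lemma orth_projection_compl:
  assumes P: "orth_projection (P :: 'a::chilbert_space \<Rightarrow> 'a)"
  shows "orth_projection (\<lambda>x. x - P x)"
  using P by (auto simp: orth_projection_iff bop_diff [of P] selfadjoint_bop intro: selfadjoint_sub selfadjoint_id)

lemma subspace_kernel: "bop A \<Longrightarrow> complex_vector.subspace {x. A x = 0}"
  by (simp add: complex_vector.subspace_def bop_add [of A] bop_zero [of A] bop_scaleC [of A])

lemma closed_kernel: "bop A \<Longrightarrow> closed {x. A x = 0}"
  by (intro closed_Collect_eq bop_continuous_on continuous_on_const)

lemma subspace_range:
  assumes A: "bop A"
  shows "complex_vector.subspace (range A)"
proof (rule complex_vector.subspaceI)
  show "0 \<in> range A" using bop_zero [OF A] by (metis rangeI)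
  show "x + y \<in> range A" if "x \<in> range A" "y \<in> range A" for x y
    using that by (auto simp flip: bop_add [OF A])
  show "c *\<^sub>C x \<in> range A" if "x \<in> range A" for c x
    using that by (auto simp flip: bop_scaleC [OF A])
qed

lemma subspace_closure:
  assumes V: "complex_vector.subspace (V::'a::complex_inner set)"
  shows "complex_vector.subspace (closure V)"
proof (rule complex_vector.subspaceI)
  show "0 \<in> closure V" using V closure_subset complex_vector.subspace_0 by blast
  show "x + y \<in> closure V" if "x \<in> closure V" "y \<in> closure V" for x y
  proof -
    from that obtain X Y where X: "\<forall>n. X n \<in> V" "X \<longlonglongrightarrow> x" and Y: "\<forall>n. Y n \<in> V" "Y \<longlonglongrightarrow> y"
      unfolding closure_sequential by blast
    have "\<forall>n. X n + Y n \<in> V" using X(1) Y(1) V by (simp add: complex_vector.subspace_add)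
    moreover have "(\<lambda>n. X n + Y n) \<longlonglongrightarrow> x + y" using X(2) Y(2) by (rule tendsto_add)
    ultimately show ?thesis unfolding closure_sequential by (intro exI conjI)
  qed
  show "c *\<^sub>C x \<in> closure V" if "x \<in> closure V" for c x
  proof -
    from that obtain X where X: "\<forall>n. X n \<in> V" "X \<longlonglongrightarrow> x" unfolding closure_sequential by blast
    have "\<forall>n. c *\<^sub>C X n \<in> V" using X(1) V by (simp add: complex_vector.subspace_scale)
    moreover have "(\<lambda>n. c *\<^sub>C X n) \<longlonglongrightarrow> c *\<^sub>C x"
      using bounded_linear.tendsto [OF bounded_linear_scaleC X(2)] .
    ultimately show ?thesis unfolding closure_sequential by (intro exI conjI)
  qed
qed

section \<open>Positive operators and square roots\<close>

lemma quadratic_nonneg_imp_discriminant: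
  fixes a b c :: real
  assumes "\<And>t. 0 \<le> a * t\<^sup>2 + 2 * t * b + c" and a: "a \<ge> 0"
  shows "b\<^sup>2 \<le> a * c"
proof (cases "a = 0")
  case True
  have "b = 0"
  proof (rule ccontr)
    assume "b \<noteq> 0"
    \<comment> \<open>For \<open>a = 0\<close> the polynomial is linear in \<open>t\<close>, and at
      this point its value is \<open>-1\<close>.\<close>
    then show False using assms(1)[of "- (c + 1) / (2 * b)"] True by (simp add: field_simps)
  qed
  then show ?thesis using True by simp
next
  case False
  then have "a > 0" using a by simp
  have "0 \<le> a * (a * (- b / a)\<^sup>2 + 2 * (- b / a) * b + c)"
    using assms(1) a by (rule mult_nonneg_nonneg [rotated])
  also have "\<dots> = a * c - b\<^sup>2" using \<open>a > 0\<close> by (simp add: field_simps power2_eq_square)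
  finally show ?thesis by simp
qed

lemma positive_op_nonneg: "positive_op A \<Longrightarrow> 0 \<le> Re (cinner (A x) x)"
  by (simp add: positive_op_iff)

lemma positive_op_bop: "positive_op A \<Longrightarrow> bop A"
  by (simp add: positive_op_def)

lemma positive_opI: "selfadjoint A \<Longrightarrow> (\<And>x. 0 \<le> Re (cinner (A x) x)) \<Longrightarrow> positive_op A"
  by (simp add: positive_op_iff)

lemma selfadjoint_form_add:
  assumes A: "selfadjoint A"
  shows "Re (cinner (A (x + y)) (x + y)) =
    Re (cinner (A x) x) + 2 * Re (cinner (A x) y) + Re (cinner (A y) y)"
proof -
  have "Re (cinner (A y) x) = Re (cinner (A x) y)"
    using selfadjoint_cinner [OF A, of y x] Re_cinner_commute [of y "A x"] by simp
  then show ?thesis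
    by (simp add: bop_add [OF selfadjoint_bop [OF A]] cinner_simps)
qed

lemma positive_op_Cauchy_Schwarz:
  assumes A: "positive_op A"
  shows "(Re (cinner (A x) y))\<^sup>2 \<le> Re (cinner (A x) x) * Re (cinner (A y) y)"
proof -
  have s: "selfadjoint A" using A by (rule positive_op_selfadjoint)
  have "0 \<le> Re (cinner (A y) y) * t\<^sup>2 + 2 * t * Re (cinner (A x) y) + Re (cinner (A x) x)" for t
    using positive_op_nonneg [OF A, of "x + t *\<^sub>R y"]
    by (simp add: selfadjoint_form_add [OF s] bop_scaleR [OF selfadjoint_bop [OF s]]
        scaleR_cinner_left scaleR_cinner_right power2_eq_square algebra_simps)
  from quadratic_nonneg_imp_discriminant [OF this positive_op_nonneg [OF A]]
  show ?thesis by (simp add: mult.commute)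
qed

lemma positive_op_zero:
  assumes A: "positive_op A" and "Re (cinner (A x) x) = 0"
  shows "A x = 0"
  using positive_op_Cauchy_Schwarz [OF A, of x "A x"] assms(2) by (simp add: cinner_self)

text \<open>Cauchy-Schwarz for the form of \<open>A\<close> with \<open>y = A x\<close> bounds
  \<open>|A x|^4\<close> by the product of two values of the form, each at most a squared
  norm.\<close>

lemma positive_contraction_norm_le:
  assumes A: "positive_op A" and le: "\<And>x. Re (cinner (A x) x) \<le> (norm x)\<^sup>2"
  shows "norm (A x) \<le> norm x"
proof -
  have "((norm (A x))\<^sup>2)\<^sup>2 \<le> Re (cinner (A x) x) * Re (cinner (A (A x)) (A x))"
    using positive_op_Cauchy_Schwarz [OF A, of x "A x"] by (simp add: cinner_self)
  also have "\<dots> \<le> (norm x)\<^sup>2 * (norm (A x))\<^sup>2"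
    by (intro mult_mono le positive_op_nonneg [OF A]) simp
  finally have "(norm (A x))\<^sup>2 \<le> (norm x)\<^sup>2"
    by (cases "A x = 0") (auto simp: power2_eq_square)
  then show ?thesis by (rule power2_le_imp_le) simp
qed

text \<open>
  Iterating \<open>Y \<mapsto> (B + Y\<^sup>2) / 2\<close> from \<open>0\<close> converges to a solution of \<open>(1 - Y)\<^sup>2 = 1 - B\<close>. Convergence
  holds in operator norm, even at the boundary \<open>\<parallel>B\<parallel> = 1\<close>, because the increments are dominated by
  those of the scalar iteration for \<open>B = 1\<close>.
\<close>

primrec sqrt_iter_real :: "nat \<Rightarrow> real" where
  "sqrt_iter_real 0 = 0"
| "sqrt_iter_real (Suc n) = (1 + (sqrt_iter_real n)\<^sup>2) / 2"

lemma sqrt_iter_real_bounds: "0 \<le> sqrt_iter_real n" "sqrt_iter_real n \<le> 1"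
  by (induction n) (auto simp: power_le_one)

lemma incseq_sqrt_iter_real: "incseq sqrt_iter_real"
proof (rule incseq_SucI)
  fix n
  have "0 \<le> (1 - sqrt_iter_real n)\<^sup>2" by simp
  then show "sqrt_iter_real n \<le> sqrt_iter_real (Suc n)" by (simp add: power2_diff)
qed

lemma Cauchy_sqrt_iter_real: "Cauchy sqrt_iter_real"
  by (metis incseq_convergent [OF incseq_sqrt_iter_real] sqrt_iter_real_bounds(2) LIMSEQ_imp_Cauchy)

primrec sqrt_iter :: "('a::real_normed_vector \<Rightarrow>\<^sub>L 'a) \<Rightarrow> nat \<Rightarrow> ('a \<Rightarrow>\<^sub>L 'a)" where
  "sqrt_iter b 0 = 0"
| "sqrt_iter b (Suc n) = (1/2) *\<^sub>R (b + (sqrt_iter b n o\<^sub>L sqrt_iter b n))"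

lemma sqrt_iter_Suc_apply:
  "sqrt_iter b (Suc n) x = (1/2) *\<^sub>R (b x + sqrt_iter b n (sqrt_iter b n x))"
  by (simp add: blinfun.add_left blinfun.scaleR_left)

declare sqrt_iter.simps(2) [simp del]

text \<open>The iterates are polynomials in \<open>b\<close>. In the limit the square root inherits
  commutation with every \<open>C\<close> that commutes with the operator; this is what uniqueness
  of the root will rest on.\<close>

lemma sqrt_iter_commute:
  fixes b :: "'a::real_normed_vector \<Rightarrow>\<^sub>L 'a"
  assumes C: "bounded_linear C" and "\<And>x. C (b x) = b (C x)"
  shows "C (sqrt_iter b n x) = sqrt_iter b n (C x)"
proof (induction n arbitrary: x)
  case 0
  show ?case using bounded_linear.linear [OF C] by (simp add: linear_0)
next
  case (Suc n)
  interpret bounded_linear C by (rule C)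
  show ?case by (simp add: sqrt_iter_Suc_apply add scale assms(2) Suc)
qed

lemma sqrt_iter_commute_self:
  "sqrt_iter b m (sqrt_iter b n x) = sqrt_iter b n (sqrt_iter b m x)"
proof -
  have "blinfun_apply b (sqrt_iter b m x) = sqrt_iter b m (blinfun_apply b x)" for x
    by (rule sqrt_iter_commute [OF blinfun.bounded_linear_right]) simp
  then show ?thesis
    by (intro sqrt_iter_commute [OF blinfun.bounded_linear_right]) simp
qed

lemma norm_sqrt_iter:
  fixes b :: "'a::real_normed_vector \<Rightarrow>\<^sub>L 'a"
  assumes b: "norm b \<le> 1"
  shows "norm (sqrt_iter b n) \<le> sqrt_iter_real n"
proof (induction n)
  case (Suc n)
  have "norm (sqrt_iter b (Suc n)) \<le> (norm b + norm (sqrt_iter b n) * norm (sqrt_iter b n)) / 2"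
    unfolding sqrt_iter.simps norm_scaleR
    using order_trans [OF norm_triangle_ineq add_left_mono [OF norm_blinfun_compose],
        of b "sqrt_iter b n" "sqrt_iter b n"]
    by simp
  also have "\<dots> \<le> (1 + sqrt_iter_real n * sqrt_iter_real n) / 2"
    using b Suc sqrt_iter_real_bounds by (intro divide_right_mono add_mono mult_mono) auto
  finally show ?case by (simp add: power2_eq_square)
qed simp

text \<open>Iterates commute, so the difference of their squares factors as in the scalar case; the
  scalar iteration satisfies the same recursion with equality and majorises it.\<close>

lemma norm_sqrt_iter_Suc_diff:
  fixes b :: "'a::real_normed_vector \<Rightarrow>\<^sub>L 'a"
  assumes b: "norm b \<le> 1"
  shows "norm (sqrt_iter b (Suc n) - sqrt_iter b n) \<le> sqrt_iter_real (Suc n) - sqrt_iter_real n"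
proof (induction n)
  case 0
  then show ?case using b by (simp add: sqrt_iter.simps(2))
next
  case (Suc n)
  let ?Y = "sqrt_iter b" and ?y = sqrt_iter_real
  have "?Y (Suc (Suc n)) - ?Y (Suc n) = (1/2) *\<^sub>R ((?Y (Suc n) + ?Y n) o\<^sub>L (?Y (Suc n) - ?Y n))"
  proof (rule blinfun_eqI)
    fix x
    show "(?Y (Suc (Suc n)) - ?Y (Suc n)) x = ((1/2) *\<^sub>R ((?Y (Suc n) + ?Y n) o\<^sub>L (?Y (Suc n) - ?Y n))) x"
    proof -
      have "?Y (Suc (Suc n)) x - ?Y (Suc n) x =
          (1/2) *\<^sub>R (b x + ?Y (Suc n) (?Y (Suc n) x)) - (1/2) *\<^sub>R (b x + ?Y n (?Y n x))"
        by (rule arg_cong2 [OF sqrt_iter_Suc_apply sqrt_iter_Suc_apply])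
      then show ?thesis
        using sqrt_iter_commute_self [of b n "Suc n" x]
        by (simp add: blinfun.bilinear_simps algebra_simps)
    qed
  qed
  then have "norm (?Y (Suc (Suc n)) - ?Y (Suc n)) = norm ((?Y (Suc n) + ?Y n) o\<^sub>L (?Y (Suc n) - ?Y n)) / 2"
    by simp
  also have "\<dots> \<le> norm (?Y (Suc n) + ?Y n) * norm (?Y (Suc n) - ?Y n) / 2"
    by (intro divide_right_mono norm_blinfun_compose) simp
  also have "\<dots> \<le> (?y (Suc n) + ?y n) * (?y (Suc n) - ?y n) / 2"
  proof (intro divide_right_mono mult_mono Suc)
    show "norm (?Y (Suc n) + ?Y n) \<le> ?y (Suc n) + ?y n"
      using norm_sqrt_iter [OF b, of "Suc n"] norm_sqrt_iter [OF b, of n] norm_triangle_ineq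
      by (meson add_mono order_trans)
    show "0 \<le> ?y (Suc n) + ?y n" using sqrt_iter_real_bounds by (meson add_nonneg_nonneg)
  qed simp_all
  also have "\<dots> = ?y (Suc (Suc n)) - ?y (Suc n)"
    by (simp add: sqrt_iter_real.simps(2)[of "Suc n"] power2_eq_square algebra_simps add_divide_distrib diff_divide_distrib del: sqrt_iter_real.simps)
       (simp add: field_simps power2_eq_square)
  finally show ?case .
qed

lemma convergent_sqrt_iter:
  assumes b: "norm (b :: 'a::banach \<Rightarrow>\<^sub>L 'a) \<le> 1"
  shows "convergent (sqrt_iter b)"
proof -
  have *: "norm (sqrt_iter b (n + k) - sqrt_iter b n) \<le> sqrt_iter_real (n + k) - sqrt_iter_real n" for n k
  proof (induction k)
    case (Suc k)
    have "norm (sqrt_iter b (n + Suc k) - sqrt_iter b n)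
        \<le> norm (sqrt_iter b (Suc (n + k)) - sqrt_iter b (n + k)) + norm (sqrt_iter b (n + k) - sqrt_iter b n)"
      using norm_triangle_ineq [of "sqrt_iter b (Suc (n + k)) - sqrt_iter b (n + k)" "sqrt_iter b (n + k) - sqrt_iter b n"]
      by simp
    also have "\<dots> \<le> (sqrt_iter_real (Suc (n + k)) - sqrt_iter_real (n + k)) + (sqrt_iter_real (n + k) - sqrt_iter_real n)"
      by (intro add_mono norm_sqrt_iter_Suc_diff [OF b] Suc)
    finally show ?case by simp
  qed simp
  have "Cauchy (sqrt_iter b)"
  proof (rule CauchyI')
    fix e :: real assume "e > 0"
    then obtain M where M: "\<And>m n. m \<ge> M \<Longrightarrow> n \<ge> M \<Longrightarrow> dist (sqrt_iter_real m) (sqrt_iter_real n) < e"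
      using metric_CauchyD [OF Cauchy_sqrt_iter_real] by metis
    show "\<exists>M. \<forall>m\<ge>M. \<forall>n>m. dist (sqrt_iter b m) (sqrt_iter b n) < e"
    proof (intro exI allI impI)
      fix m n assume "m \<ge> M" "n > m"
      then have "norm (sqrt_iter b n - sqrt_iter b m) \<le> sqrt_iter_real n - sqrt_iter_real m"
        using * [of m "n - m"] by simp
      also have "\<dots> < e" using M [of n m] \<open>m \<ge> M\<close> \<open>n > m\<close> by (simp add: dist_real_def)
      finally show "dist (sqrt_iter b m) (sqrt_iter b n) < e" by (simp add: dist_norm norm_minus_commute)
    qed
  qed
  then show ?thesis by (rule Cauchy_convergent)
qed

lemma selfadjoint_sqrt_iter:
  assumes "selfadjoint (blinfun_apply b)"
  shows "selfadjoint (blinfun_apply (sqrt_iter b n))"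
proof (induction n)
  case 0
  then show ?case by (simp add: selfadjoint_zero zero_blinfun.rep_eq)
next
  case (Suc n)
  have "selfadjoint (\<lambda>x. (1/2) *\<^sub>R (b x + sqrt_iter b n (sqrt_iter b n x)))"
    by (intro selfadjoint_scaleR selfadjoint_plus assms selfadjoint_compose [OF Suc Suc]) simp
  then show ?case by (simp add: sqrt_iter_Suc_apply [abs_def])
qed

lemma sqrt_exists_contraction:
  fixes B :: "'a::chilbert_space \<Rightarrow> 'a"
  assumes B: "positive_op B" and le: "\<And>x. Re (cinner (B x) x) \<le> (norm x)\<^sup>2"
  shows "\<exists>S. positive_op S \<and> (\<forall>x. S (S x) = x - B x) \<and>
    (\<forall>C. bop C \<and> (\<forall>x. C (B x) = B (C x)) \<longrightarrow> (\<forall>x. C (S x) = S (C x)))"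
proof -
  define b where "b = Blinfun B"
  have bl: "bounded_linear B" using B by (simp add: positive_op_bop bop_bounded_linear)
  have b [simp]: "blinfun_apply b = B" unfolding b_def by (rule bounded_linear_Blinfun_apply [OF bl])
  have "norm b \<le> 1"
    by (rule norm_blinfun_bound) (use positive_contraction_norm_le [OF B le] in simp_all)
  then obtain Z where Z: "sqrt_iter b \<longlonglongrightarrow> Z"
    using convergent_sqrt_iter convergent_def by blast
  have Zx: "(\<lambda>n. sqrt_iter b n x) \<longlonglongrightarrow> Z x" for x
    by (intro blinfun.tendsto Z tendsto_const)
  have ZZ: "(\<lambda>n. sqrt_iter b n (sqrt_iter b n x)) \<longlonglongrightarrow> Z (Z x)" for x
    by (intro blinfun.tendsto Z Zx)
  have fixp: "Z x = (1/2) *\<^sub>R (B x + Z (Z x))" for x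
  proof (rule LIMSEQ_unique)
    show "(\<lambda>n. sqrt_iter b (Suc n) x) \<longlonglongrightarrow> Z x" using Zx [of x] by (rule LIMSEQ_Suc)
    show "(\<lambda>n. sqrt_iter b (Suc n) x) \<longlonglongrightarrow> (1/2) *\<^sub>R (B x + Z (Z x))"
      unfolding sqrt_iter_Suc_apply b by (intro tendsto_intros ZZ)
  qed
  have "norm (sqrt_iter b n) \<le> 1" for n
    using norm_sqrt_iter [OF \<open>norm b \<le> 1\<close>, of n] sqrt_iter_real_bounds(2)[of n] by linarith
  then have nZ: "norm Z \<le> 1"
    using tendsto_norm [OF Z] by (intro Lim_bounded) auto
  have sa: "selfadjoint (blinfun_apply (sqrt_iter b n))" for n
    by (rule selfadjoint_sqrt_iter) (simp add: positive_op_selfadjoint B)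
  have Zadd: "Z (c *\<^sub>C x) = c *\<^sub>C Z x" for c x
  proof (rule LIMSEQ_unique)
    show "(\<lambda>n. sqrt_iter b n (c *\<^sub>C x)) \<longlonglongrightarrow> Z (c *\<^sub>C x)" by (rule Zx)
    show "(\<lambda>n. sqrt_iter b n (c *\<^sub>C x)) \<longlonglongrightarrow> c *\<^sub>C Z x"
      using bounded_linear.tendsto [OF bounded_linear_scaleC Zx [of x]]
      by (simp add: bop_scaleC [OF selfadjoint_bop [OF sa]])
  qed
  have Zsa: "selfadjoint (blinfun_apply Z)"
  proof (rule selfadjointI)
    show "bop (blinfun_apply Z)" by (simp add: bop_iff blinfun.bounded_linear_right Zadd)
    show "cinner (Z x) y = cinner x (Z y)" for x y
    proof (rule LIMSEQ_unique)
      show "(\<lambda>n. cinner (sqrt_iter b n x) y) \<longlonglongrightarrow> cinner (Z x) y"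
        by (intro cinner.tendsto Zx tendsto_const)
      show "(\<lambda>n. cinner (sqrt_iter b n x) y) \<longlonglongrightarrow> cinner x (Z y)"
        unfolding selfadjoint_cinner [OF sa] by (intro cinner.tendsto Zx tendsto_const)
    qed
  qed
  define S where "S x = x - Z x" for x
  have "positive_op S"
  proof (rule positive_opI)
    show "selfadjoint S" unfolding S_def [abs_def] by (intro selfadjoint_sub selfadjoint_id Zsa)
    show "0 \<le> Re (cinner (S x) x)" for x
    proof -
      have "Re (cinner (Z x) x) \<le> norm (Z x) * norm x" using Re_cinner_le [of "Z x" x] by linarith
      also have "\<dots> \<le> norm x * norm x"
        using norm_blinfun [of Z x] nZ mult_right_mono [OF nZ norm_ge_zero, of x] by (intro mult_right_mono) auto
      finally show ?thesis by (simp add: S_def cinner.diff_left cinner_self power2_eq_square)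
    qed
  qed
  moreover have "S (S x) = x - B x" for x
  proof -
    have "2 *\<^sub>R Z x = B x + Z (Z x)" using arg_cong [OF fixp [of x], of "\<lambda>v. 2 *\<^sub>R v"] by simp
    then show ?thesis
      by (simp add: S_def blinfun.diff_right scaleR_2 algebra_simps)
  qed
  moreover have "C (S x) = S (C x)" if C: "bop C" "\<forall>x. C (B x) = B (C x)" for C x
  proof -
    have "C (Z x) = Z (C x)"
    proof (rule LIMSEQ_unique)
      show "(\<lambda>n. C (sqrt_iter b n x)) \<longlonglongrightarrow> C (Z x)" by (rule bop_tendsto [OF C(1) Zx])
      show "(\<lambda>n. C (sqrt_iter b n x)) \<longlonglongrightarrow> Z (C x)"
        using sqrt_iter_commute [OF bop_bounded_linear [OF C(1)], of b] C(2) Zx by simp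
    qed
    then show ?thesis by (simp add: S_def bop_diff [OF C(1)])
  qed
  ultimately show ?thesis by blast
qed

lemma sqrt_exists:
  fixes A :: "'a::chilbert_space \<Rightarrow> 'a"
  assumes A: "positive_op A"
  shows "\<exists>S. positive_op S \<and> (\<forall>x. S (S x) = A x) \<and>
    (\<forall>C. bop C \<and> (\<forall>x. C (A x) = A (C x)) \<longrightarrow> (\<forall>x. C (S x) = S (C x)))"
proof -
  obtain K where K: "K \<ge> 0" "\<And>x. norm (A x) \<le> K * norm x" using bop_bound [OF positive_op_bop [OF A]] by blast
  \<comment> \<open>Dividing by a positive bound of \<open>A\<close> makes
    \<open>B = 1 - A / c\<close> positive with form at most \<open>|x|^2\<close>; \<open>K\<close>
    itself may be \<open>0\<close>.\<close>
  define c where "c = K + 1"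
  have c: "c > 0" using K by (simp add: c_def)
  define B where "B x = x - (1/c) *\<^sub>R A x" for x
  have Bf: "Re (cinner (B x) x) = (norm x)\<^sup>2 - Re (cinner (A x) x) / c" for x
    by (simp add: B_def cinner.diff_left scaleR_cinner_left cinner_self)
  have AK: "Re (cinner (A x) x) \<le> c * (norm x)\<^sup>2" for x
  proof -
    have "Re (cinner (A x) x) \<le> norm (A x) * norm x" using Re_cinner_le [of "A x" x] by linarith
    also have "\<dots> \<le> (c * norm x) * norm x"
      using K(2)[of x] by (intro mult_right_mono) (auto simp: c_def algebra_simps intro: order_trans)
    finally show ?thesis by (simp add: power2_eq_square)
  qed
  have "positive_op B"
  proof (rule positive_opI)
    show "selfadjoint B" unfolding B_def [abs_def]
      by (intro selfadjoint_sub selfadjoint_id selfadjoint_scaleR positive_op_selfadjoint A)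
    show "0 \<le> Re (cinner (B x) x)" for x using AK [of x] c by (simp add: Bf field_simps)
  qed
  moreover have "Re (cinner (B x) x) \<le> (norm x)\<^sup>2" for x
    using positive_op_nonneg [OF A, of x] c by (simp add: Bf)
  ultimately obtain S where S: "positive_op S" "\<And>x. S (S x) = x - B x"
    "\<And>C x. bop C \<Longrightarrow> \<forall>x. C (B x) = B (C x) \<Longrightarrow> C (S x) = S (C x)"
    using sqrt_exists_contraction [of B] by metis
  have Sl: "bop S" using S(1) by (rule positive_op_bop)
  define R where "R x = sqrt c *\<^sub>R S x" for x
  have "positive_op R"
    unfolding R_def [abs_def]
  proof (rule positive_opI)
    show "selfadjoint (\<lambda>x. sqrt c *\<^sub>R S x)" by (intro selfadjoint_scaleR positive_op_selfadjoint S)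
    show "0 \<le> Re (cinner (sqrt c *\<^sub>R S x) x)" for x
      using positive_op_nonneg [OF S(1), of x] c by (simp add: scaleR_cinner_left)
  qed
  moreover have "R (R x) = A x" for x
    using c by (simp add: R_def bop_scaleR [OF Sl] S(2) B_def)
  moreover have "C (R x) = R (C x)" if C: "bop C" "\<forall>x. C (A x) = A (C x)" for C x
  proof -
    have "\<forall>x. C (B x) = B (C x)" using C(2) by (simp add: B_def bop_diff [OF C(1)] bop_scaleR [OF C(1)])
    then show ?thesis using S(3)[OF C(1)] by (simp add: R_def bop_scaleR [OF C(1)])
  qed
  ultimately show ?thesis by blast
qed

text \<open>For \<open>y = S x - R x\<close> commutation gives \<open>S y + R y = 0\<close>. Both
  forms are nonnegative, so \<open>S y = R y = 0\<close>, and \<open>\<langle>y, y\<rangle>\<close>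
  is the difference of \<open>\<langle>S y, x\<rangle>\<close> and
  \<open>\<langle>R y, x\<rangle>\<close>.\<close>

lemma sqrt_unique:
  assumes S: "positive_op S" "\<And>x. S (S x) = A x" and R: "positive_op R" "\<And>x. R (R x) = A x"
    and comm: "\<And>x. R (S x) = S (R x)"
  shows "S = R"
proof
  fix x
  note [simp] = bop_diff [OF positive_op_bop [OF S(1)]] bop_diff [OF positive_op_bop [OF R(1)]]
  define y where "y = S x - R x"
  have "S y + R y = 0" by (simp add: y_def S(2) R(2) comm)
  then have "Re (cinner (S y) y) + Re (cinner (R y) y) = 0"
    by (simp flip: cinner_add_left plus_complex.simps(1))
  then have "Re (cinner (S y) y) = 0" "Re (cinner (R y) y) = 0"
    using positive_op_nonneg [OF S(1), of y] positive_op_nonneg [OF R(1), of y] by linarith+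
  then have 0: "S y = 0" "R y = 0" using positive_op_zero S(1) R(1) by blast+
  have "cinner y y = cinner (S y) x - cinner (R y) x"
    unfolding selfadjoint_cinner [OF positive_op_selfadjoint [OF S(1)]]
      selfadjoint_cinner [OF positive_op_selfadjoint [OF R(1)]]
    by (simp add: y_def cinner.diff_right)
  then have "y = 0" by (simp add: 0 cinner_self)
  then show "S x = R x" by (simp add: y_def)
qed

context
  fixes A :: "'a::chilbert_space \<Rightarrow> 'a"
  assumes A: "positive_op A"
begin

text \<open>A competing positive root \<open>R\<close> commutes with \<open>A = R R\<close>, hence
  with the root constructed above; this supplies the commutation that \<open>sqrt_unique\<close>
  asks for.\<close>

lemma sqrt_op_characterisation:
  "positive_op (sqrt_op A) \<and> (\<forall>x. sqrt_op A (sqrt_op A x) = A x) \<and>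
    (\<forall>C. bop C \<and> (\<forall>x. C (A x) = A (C x)) \<longrightarrow> (\<forall>x. C (sqrt_op A x) = sqrt_op A (C x)))"
proof -
  obtain S where S: "positive_op S" "\<And>x. S (S x) = A x"
    "\<And>C x. bop C \<Longrightarrow> (\<forall>x. C (A x) = A (C x)) \<Longrightarrow> C (S x) = S (C x)"
    using sqrt_exists [OF A] by metis
  have "sqrt_op A = S"
    unfolding sqrt_op_def
  proof (rule the_equality)
    fix R assume R: "positive_op R \<and> R \<circ> R = A"
    then have RR: "R (R x) = A x" for x by auto
    have "R (S x) = S (R x)" for x using S(3)[of R] R RR positive_op_bop by metis
    with S R RR show "R = S" using sqrt_unique [of S A R] by auto
  qed (use S in auto)
  then show ?thesis using S by blast
qed

lemma positive_sqrt_op: "positive_op (sqrt_op A)"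
  and sqrt_op_sqrt_op: "sqrt_op A (sqrt_op A x) = A x"
  and sqrt_op_commute: "bop C \<Longrightarrow> (\<And>x. C (A x) = A (C x)) \<Longrightarrow> C (sqrt_op A x) = sqrt_op A (C x)"
  using sqrt_op_characterisation by auto

lemma sqrt_op_eqI: "positive_op R \<Longrightarrow> (\<And>x. R (R x) = A x) \<Longrightarrow> sqrt_op A = R"
  using sqrt_unique [OF positive_sqrt_op sqrt_op_sqrt_op, of R] sqrt_op_commute [of R] positive_op_bop
  by metis

lemma norm_sqrt_op: "(norm (sqrt_op A x))\<^sup>2 = Re (cinner (A x) x)"
  using selfadjoint_cinner [OF positive_op_selfadjoint [OF positive_sqrt_op], of "sqrt_op A x" x]
  by (simp add: sqrt_op_sqrt_op cinner_self)

end

lemma positive_op_square: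
  assumes X: "selfadjoint X"
  shows "positive_op (X \<circ> X)"
proof (rule positive_opI)
  show "selfadjoint (X \<circ> X)" unfolding comp_def by (rule selfadjoint_compose [OF X X]) simp
  show "0 \<le> Re (cinner ((X \<circ> X) x) x)" for x by (simp add: selfadjoint_cinner [OF X] cinner_self)
qed

context
  fixes X :: "'a::chilbert_space \<Rightarrow> 'a"
  assumes X: "selfadjoint X"
begin

lemma positive_abs_op: "positive_op (abs_op X)"
  and abs_op_abs_op: "abs_op X (abs_op X x) = X (X x)"
  using positive_sqrt_op [OF positive_op_square [OF X]] sqrt_op_sqrt_op [OF positive_op_square [OF X]]
  by (simp_all add: abs_op_def)

lemma abs_op_commute:
  assumes "bop C" "\<And>x. C (X x) = X (C x)"
  shows "C (abs_op X x) = abs_op X (C x)"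
  using sqrt_op_commute [OF positive_op_square [OF X] assms(1)] assms(2) by (simp add: abs_op_def)

lemma abs_op_eqI: "positive_op R \<Longrightarrow> (\<And>x. R (R x) = X (X x)) \<Longrightarrow> abs_op X = R"
  using sqrt_op_eqI [OF positive_op_square [OF X]] by (simp add: abs_op_def)

end

section \<open>The spectral theorem\<close>

subsection \<open>The resolution of the identity\<close>

text \<open>An invariant subspace of a selfadjoint operator reduces it.\<close>

lemma proj_onto_commute:
  fixes M :: "'a::chilbert_space set"
  assumes M: "closed M" "complex_vector.subspace M" and C: "selfadjoint C" "\<And>x. x \<in> M \<Longrightarrow> C x \<in> M"
  shows "C (proj_onto M x) = proj_onto M (C x)"
proof -
  have "proj_onto M (C x) = C (proj_onto M x)"
    by (rule proj_onto_eqI [OF M])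
       (simp_all add: C(2) proj_onto_in [OF M] proj_onto_cinner [OF M] flip: selfadjoint_cinner [OF C(1)])
  then show ?thesis by simp
qed

text \<open>\<open>|X - t| + (X - t)\<close> is twice the positive part of \<open>X - t\<close>, and
  its kernel is the spectral subspace for \<open>(-\<infinity>, t]\<close>. Thus the resolution of
  the identity is obtained from square roots alone.\<close>

definition resolution :: "('a::complex_inner \<Rightarrow> 'a) \<Rightarrow> real \<Rightarrow> 'a \<Rightarrow> 'a"
  where "resolution X t = proj_onto {x. abs_op (\<lambda>x. X x - t *\<^sub>R x) x + (X x - t *\<^sub>R x) = 0}"

text \<open>The Stieltjes measure of \<open>t \<mapsto> |E_t x|^2\<close>. It is available before
  any projection-valued measure; the projections for general Borel sets are recovered from
  it.\<close>

definition smeasure :: "('a::complex_inner \<Rightarrow> 'a) \<Rightarrow> 'a \<Rightarrow> real measure"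
  where "smeasure X x = interval_measure (\<lambda>t. (norm (resolution X t x))\<^sup>2)"

context
  fixes X :: "'a::chilbert_space \<Rightarrow> 'a"
  assumes X: "selfadjoint X"
begin

lemma selfadjoint_shift: "selfadjoint (\<lambda>x. X x - t *\<^sub>R x)"
  by (intro selfadjoint_sub X selfadjoint_scaleR selfadjoint_id)

lemma selfadjoint_abs_shift: "selfadjoint (abs_op (\<lambda>x. X x - t *\<^sub>R x))"
  by (intro positive_op_selfadjoint positive_abs_op selfadjoint_shift)

lemma abs_shift_commute:
  assumes C: "bop C" "\<And>x. C (X x) = X (C x)"
  shows "C (abs_op (\<lambda>x. X x - t *\<^sub>R x) x) = abs_op (\<lambda>x. X x - t *\<^sub>R x) (C x)"
  using assms by (intro abs_op_commute [OF selfadjoint_shift]) (auto simp: bop_diff [OF C(1)] bop_scaleR [OF C(1)])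

lemma kernel_shift:
  "closed {x. abs_op (\<lambda>x. X x - t *\<^sub>R x) x + (X x - t *\<^sub>R x) = 0}"
  "complex_vector.subspace {x. abs_op (\<lambda>x. X x - t *\<^sub>R x) x + (X x - t *\<^sub>R x) = 0}"
  using selfadjoint_bop [OF selfadjoint_plus [OF selfadjoint_abs_shift selfadjoint_shift]]
  by (rule closed_kernel, rule subspace_kernel)

lemma orth_projection_resolution: "orth_projection (resolution X t)"
  unfolding resolution_def by (rule orth_projection_proj_onto [OF kernel_shift])

lemma bop_resolution: "bop (resolution X t)"
  using orth_projection_resolution by (simp add: orth_projection_def)

lemma resolution_resolution: "resolution X t (resolution X t x) = resolution X t x"
  using orth_projection_resolution by (rule orth_projection_idem)

lemma resolution_commute:
  assumes C: "selfadjoint C" "\<And>x. C (X x) = X (C x)"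
  shows "C (resolution X t x) = resolution X t (C x)"
proof -
  have b: "bop C" using C(1) by (rule selfadjoint_bop)
  show ?thesis
    unfolding resolution_def
  proof (rule proj_onto_commute [OF kernel_shift C(1)])
    fix x assume "x \<in> {x. abs_op (\<lambda>x. X x - t *\<^sub>R x) x + (X x - t *\<^sub>R x) = 0}"
    then have "C (abs_op (\<lambda>x. X x - t *\<^sub>R x) x + (X x - t *\<^sub>R x)) = C 0" by simp
    then show "C x \<in> {x. abs_op (\<lambda>x. X x - t *\<^sub>R x) x + (X x - t *\<^sub>R x) = 0}"
      using abs_shift_commute [OF b C(2)]
      by (simp add: bop_add [OF b] bop_diff [OF b] bop_scaleR [OF b] bop_zero [OF b] C(2))
  qed
qed

lemma resolution_X: "X (resolution X t x) = resolution X t (X x)"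
  by (rule resolution_commute [OF X]) simp

lemma resolution_commute_resolution:
  "resolution X s (resolution X t x) = resolution X t (resolution X s x)"
  by (rule resolution_commute)
     (simp_all add: orth_projection_selfadjoint orth_projection_resolution resolution_X)

lemma form_le_on_resolution:
  assumes "resolution X t x = x"
  shows "Re (cinner (X x) x) \<le> t * (norm x)\<^sup>2"
proof -
  let ?Y = "\<lambda>x. X x - t *\<^sub>R x"
  have "abs_op ?Y x + ?Y x = 0"
    using assms proj_onto_iff [OF kernel_shift] by (simp add: resolution_def)
  then have "?Y x = - abs_op ?Y x" by (simp add: eq_neg_iff_add_eq_0 add.commute)
  moreover have "0 \<le> Re (cinner (abs_op ?Y x) x)"
    by (intro positive_op_nonneg positive_abs_op selfadjoint_shift)
  ultimately have "Re (cinner (?Y x) x) \<le> 0" by (simp add: cinner.minus_left)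
  then show ?thesis by (simp add: cinner.diff_left scaleR_cinner_left cinner_self)
qed

text \<open>With \<open>Y = X - t\<close>, the product of \<open>|Y| + Y\<close> and
  \<open>|Y| - Y\<close> is zero, so \<open>|Y| - Y\<close> maps into the kernel that defines
  \<open>resolution X t\<close>. For \<open>x\<close> orthogonal to this kernel it follows that
  \<open>|Y| x = Y x\<close>. The second conclusion is the strictness by which vectors are shown to
  vanish below.\<close>

lemma form_ge_off_resolution:
  assumes 0: "resolution X t x = 0"
  shows "t * (norm x)\<^sup>2 \<le> Re (cinner (X x) x)"
    and "Re (cinner (X x) x) \<le> t * (norm x)\<^sup>2 \<Longrightarrow> x = 0"
proof -
  define Y where "Y = (\<lambda>x. X x - t *\<^sub>R x)"
  have Y: "selfadjoint Y" unfolding Y_def by (rule selfadjoint_shift)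
  have bY: "bop Y" "bop (abs_op Y)"
    using Y selfadjoint_bop positive_op_bop positive_abs_op by blast+
  have pos: "positive_op (abs_op Y)" by (rule positive_abs_op [OF Y])
  have comm: "Y (abs_op Y x) = abs_op Y (Y x)" for x by (rule abs_op_commute [OF Y bY(1)]) simp
  have D: "selfadjoint (\<lambda>x. abs_op Y x - Y x)"
    by (intro selfadjoint_sub Y positive_op_selfadjoint pos)
  have "cinner u (abs_op Y x - Y x) = 0" for u
  proof -
    let ?v = "abs_op Y u - Y u"
    have "abs_op Y ?v + Y ?v = 0"
      by (simp add: bop_diff [OF bY(1)] bop_diff [OF bY(2)] abs_op_abs_op [OF Y] comm)
    then have "cinner ?v (resolution X t x) = cinner ?v x"
      unfolding resolution_def by (intro proj_onto_cinner [OF kernel_shift]) (simp add: Y_def)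
    then show ?thesis using 0 selfadjoint_cinner [OF D, of u x] by simp
  qed
  then have "abs_op Y x - Y x = 0" by (rule cinner_eq_zeroI)
  then have eq: "abs_op Y x = Y x" by simp
  have f: "Re (cinner (Y x) x) = Re (cinner (X x) x) - t * (norm x)\<^sup>2"
    by (simp add: Y_def cinner.diff_left scaleR_cinner_left cinner_self)
  show "t * (norm x)\<^sup>2 \<le> Re (cinner (X x) x)"
    using positive_op_nonneg [OF pos, of x] f by (simp add: eq)
  assume "Re (cinner (X x) x) \<le> t * (norm x)\<^sup>2"
  then have "Re (cinner (abs_op Y x) x) = 0"
    using positive_op_nonneg [OF pos, of x] f by (simp add: eq)
  then have "abs_op Y x = 0" by (rule positive_op_zero [OF pos])
  then have "abs_op Y x + Y x = 0" using eq by simp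
  then have "resolution X t x = x"
    unfolding resolution_def by (simp add: proj_onto_iff [OF kernel_shift] Y_def)
  then show "x = 0" using 0 by simp
qed

lemma resolution_remainder: "resolution X t (x - resolution X t x) = 0"
  by (simp add: bop_diff [OF bop_resolution] resolution_resolution)

text \<open>The difference \<open>y\<close> lies in the range for \<open>s\<close> and is orthogonal
  to that for \<open>t\<close>; its form is at most \<open>s |y|^2 \<le> t |y|^2\<close>, which
  strictness excludes unless \<open>y = 0\<close>.\<close>

lemma resolution_mono:
  assumes "s \<le> t"
  shows "resolution X t (resolution X s x) = resolution X s x"
proof -
  define y where "y = resolution X s x - resolution X t (resolution X s x)"
  have t0: "resolution X t y = 0" unfolding y_def by (rule resolution_remainder)
  have "resolution X s y = y"
    unfolding y_def by (simp add: bop_diff [OF bop_resolution] resolution_resolution resolution_commute_resolution [of s t])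
  from form_le_on_resolution [OF this] have "Re (cinner (X y) y) \<le> s * (norm y)\<^sup>2" .
  also have "\<dots> \<le> t * (norm y)\<^sup>2" using assms by (rule mult_right_mono) simp
  finally have "y = 0" by (rule form_ge_off_resolution(2) [OF t0])
  then show ?thesis by (simp add: y_def)
qed

lemma resolution_mono': "s \<le> t \<Longrightarrow> resolution X s (resolution X t x) = resolution X s x"
  using resolution_mono resolution_commute_resolution by simp

lemma resolution_bounds:
  "\<exists>c>0. (\<forall>t. t < - c \<longrightarrow> (\<forall>x. resolution X t x = 0)) \<and> (\<forall>t\<ge>c. \<forall>x. resolution X t x = x)"
proof -
  obtain K where K: "K \<ge> 0" "\<And>x. norm (X x) \<le> K * norm x" using bop_bound [OF selfadjoint_bop [OF X]] by blast
  have b: "\<bar>Re (cinner (X x) x)\<bar> \<le> K * (norm x)\<^sup>2" for x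
    using order_trans [OF Re_cinner_le mult_right_mono [OF K(2) norm_ge_zero], of x x]
    by (simp add: power2_eq_square)
  have "resolution X t x = 0" if "t < - (K + 1)" for t x
  proof -
    let ?y = "resolution X t x"
    have "Re (cinner (X ?y) ?y) \<le> t * (norm ?y)\<^sup>2"
      by (rule form_le_on_resolution) (rule resolution_resolution)
    with b [of ?y] have "0 \<le> (K + t) * (norm ?y)\<^sup>2" by (simp add: algebra_simps)
    then show ?thesis using that by (simp add: zero_le_mult_iff)
  qed
  moreover have "resolution X t x = x" if "t \<ge> K + 1" for t x
  proof -
    let ?y = "x - resolution X t x"
    have "Re (cinner (X ?y) ?y) \<le> K * (norm ?y)\<^sup>2" using b [of ?y] by linarith
    also have "\<dots> \<le> t * (norm ?y)\<^sup>2" using that by (intro mult_right_mono) auto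
    finally have "?y = 0" by (rule form_ge_off_resolution(2) [OF resolution_remainder])
    then show ?thesis by simp
  qed
  ultimately show ?thesis using K(1) by (intro exI [of _ "K + 1"]) auto
qed

lemma norm_resolution_diff:
  assumes "s \<le> t"
  shows "(norm (resolution X t x - resolution X s x))\<^sup>2 = (norm (resolution X t x))\<^sup>2 - (norm (resolution X s x))\<^sup>2"
  using orth_projection_pythagoras [OF orth_projection_resolution, of "resolution X t x" s]
  by (simp add: resolution_mono' [OF assms])

text \<open>Along a sequence decreasing to \<open>a\<close> the vectors
  \<open>resolution X (S n) x\<close> converge by Pythagoras. The defect \<open>u\<close> of the
  limit lies in all these ranges, so its form is at most \<open>a |u|^2\<close>, but it is
  orthogonal to the range for \<open>a\<close>; hence \<open>u = 0\<close>.\<close>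

lemma resolution_right_continuous:
  "continuous (at_right a) (\<lambda>t. (norm (resolution X t x))\<^sup>2)"
  unfolding continuous_within
proof (rule tendsto_at_right_sequentially [of a "a + 1"])
  fix S assume S: "\<And>n. a < S n" "decseq S" "S \<longlonglongrightarrow> a"
  let ?F = "\<lambda>t. (norm (resolution X t x))\<^sup>2"
  have mono: "?F s \<le> ?F t" if "s \<le> t" for s t
    using norm_resolution_diff [OF that, of x] by (metis diff_ge_0_iff_ge zero_le_power2)
  have "decseq (\<lambda>n. ?F (S n))"
    using S(2) by (intro decseq_SucI mono) (simp add: decseq_SucD)
  then obtain L where "(\<lambda>n. ?F (S n)) \<longlonglongrightarrow> L"
    using decseq_convergent [of "\<lambda>n. ?F (S n)" 0] by auto
  then have C: "Cauchy (\<lambda>n. ?F (S n))" by (rule LIMSEQ_imp_Cauchy)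
  have "Cauchy (\<lambda>n. resolution X (S n) x)"
  proof (rule CauchyI')
    fix e :: real assume "e > 0"
    then obtain M where M: "\<And>m n. m \<ge> M \<Longrightarrow> n \<ge> M \<Longrightarrow> dist (?F (S m)) (?F (S n)) < e\<^sup>2"
      using metric_CauchyD [OF C, of "e\<^sup>2"] by auto
    have "dist (resolution X (S m) x) (resolution X (S n) x) < e" if "m \<ge> M" "n > m" for m n
    proof -
      have "S n \<le> S m" using decseqD [OF S(2), of m n] that by simp
      from norm_resolution_diff [OF this, of x] M [of m n] that
      have "(norm (resolution X (S m) x - resolution X (S n) x))\<^sup>2 < e\<^sup>2"
        by (simp add: dist_real_def)
      then show ?thesis using \<open>e > 0\<close> by (simp add: dist_norm power_less_imp_less_base)
    qed
    then show "\<exists>M. \<forall>m\<ge>M. \<forall>n>m. dist (resolution X (S m) x) (resolution X (S n) x) < e" by blast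
  qed
  then obtain z where z: "(\<lambda>n. resolution X (S n) x) \<longlonglongrightarrow> z"
    using Cauchy_convergent convergent_def by blast
  define u where "u = z - resolution X a x"
  have lim: "(\<lambda>m. resolution X (S m) x - resolution X a x) \<longlonglongrightarrow> u"
    unfolding u_def by (intro tendsto_diff z tendsto_const)
  have un: "resolution X (S n) u = u" for n
  proof (rule LIMSEQ_unique)
    show "(\<lambda>m. resolution X (S n) (resolution X (S m) x - resolution X a x)) \<longlonglongrightarrow> resolution X (S n) u"
      by (rule bop_tendsto [OF bop_resolution lim])
    have "\<forall>\<^sub>F m in sequentially. resolution X (S n) (resolution X (S m) x - resolution X a x)
        = resolution X (S m) x - resolution X a x"
    proof (rule eventually_sequentiallyI [of n])
      fix m assume "n \<le> m"
      then have "S m \<le> S n" by (rule decseqD [OF S(2)])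
      then show "resolution X (S n) (resolution X (S m) x - resolution X a x)
        = resolution X (S m) x - resolution X a x"
        using S(1)[of n] by (simp add: bop_diff [OF bop_resolution] resolution_mono)
    qed
    with lim show "(\<lambda>m. resolution X (S n) (resolution X (S m) x - resolution X a x)) \<longlonglongrightarrow> u"
      by (simp add: tendsto_cong)
  qed
  have ua: "resolution X a u = 0"
  proof (rule LIMSEQ_unique)
    show "(\<lambda>m. resolution X a (resolution X (S m) x - resolution X a x)) \<longlonglongrightarrow> resolution X a u"
      by (rule bop_tendsto [OF bop_resolution lim])
    have "resolution X a (resolution X (S m) x - resolution X a x) = 0" for m
      using S(1)[of m] by (simp add: bop_diff [OF bop_resolution] resolution_mono' resolution_resolution)
    then show "(\<lambda>m. resolution X a (resolution X (S m) x - resolution X a x)) \<longlonglongrightarrow> 0" by simp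
  qed
  have "Re (cinner (X u) u) \<le> a * (norm u)\<^sup>2"
  proof (rule LIMSEQ_le_const)
    show "(\<lambda>n. S n * (norm u)\<^sup>2) \<longlonglongrightarrow> a * (norm u)\<^sup>2" by (intro tendsto_intros S)
    show "\<exists>N. \<forall>n\<ge>N. Re (cinner (X u) u) \<le> S n * (norm u)\<^sup>2"
      using form_le_on_resolution [OF un] by blast
  qed
  then have "u = 0" by (rule form_ge_off_resolution(2) [OF ua])
  then show "(\<lambda>n. ?F (S n)) \<longlonglongrightarrow> ?F a"
    using tendsto_power [OF tendsto_norm [OF z], of 2] by (simp add: u_def)
qed simp

subsection \<open>The scalar spectral measures\<close>

lemma norm_resolution_mono: "s \<le> t \<Longrightarrow> (norm (resolution X s x))\<^sup>2 \<le> (norm (resolution X t x))\<^sup>2"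
  using norm_resolution_diff [of s t x] by (metis diff_ge_0_iff_ge zero_le_power2)

lemma sets_smeasure [simp, measurable_cong]: "sets (smeasure X x) = sets borel"
  and space_smeasure [simp]: "space (smeasure X x) = UNIV"
  by (simp_all add: smeasure_def)

lemma emeasure_smeasure_Ioc:
  "s \<le> t \<Longrightarrow> emeasure (smeasure X x) {s<..t} = ennreal ((norm (resolution X t x))\<^sup>2 - (norm (resolution X s x))\<^sup>2)"
  unfolding smeasure_def
  by (intro emeasure_interval_measure_Ioc norm_resolution_mono resolution_right_continuous)

lemma emeasure_smeasure_Iic: "emeasure (smeasure X x) {..t} = ennreal ((norm (resolution X t x))\<^sup>2)"
proof -
  obtain c where c: "c > 0" "\<And>t x. t < - c \<Longrightarrow> resolution X t x = 0" using resolution_bounds by blast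
  have "(\<lambda>n. emeasure (smeasure X x) {t - real n<..t}) \<longlonglongrightarrow> emeasure (smeasure X x) (\<Union>n. {t - real n<..t})"
    by (intro Lim_emeasure_incseq) (auto simp: incseq_def)
  moreover have "(\<Union>n. {t - real n<..t}) = {..t}"
  proof -
    have "\<exists>n. t - real n < y" for y using reals_Archimedean2 [of "t - y"] by (auto simp: algebra_simps)
    then show ?thesis by auto
  qed
  ultimately have "(\<lambda>n. emeasure (smeasure X x) {t - real n<..t}) \<longlonglongrightarrow> emeasure (smeasure X x) {..t}" by simp
  moreover have "(\<lambda>n. emeasure (smeasure X x) {t - real n<..t}) \<longlonglongrightarrow> ennreal ((norm (resolution X t x))\<^sup>2)"
  proof (rule tendsto_eventually)
    obtain N where N: "t + c < real N" using reals_Archimedean2 by blast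
    show "\<forall>\<^sub>F n in sequentially. emeasure (smeasure X x) {t - real n<..t} = ennreal ((norm (resolution X t x))\<^sup>2)"
    proof (rule eventually_sequentiallyI [of N])
      fix n assume "N \<le> n"
      then have "t - real n < - c" using N by linarith
      then show "emeasure (smeasure X x) {t - real n<..t} = ennreal ((norm (resolution X t x))\<^sup>2)"
        by (simp add: emeasure_smeasure_Ioc c(2))
    qed
  qed
  ultimately show ?thesis by (rule LIMSEQ_unique)
qed

lemma emeasure_smeasure_UNIV: "emeasure (smeasure X x) UNIV = ennreal ((norm x)\<^sup>2)"
proof -
  obtain c where c: "c > 0" "\<And>t x. t \<ge> c \<Longrightarrow> resolution X t x = x" using resolution_bounds by blast
  have "(\<lambda>n. emeasure (smeasure X x) {..real n}) \<longlonglongrightarrow> emeasure (smeasure X x) (\<Union>n. {..real n})"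
    by (intro Lim_emeasure_incseq) (auto simp: incseq_def)
  moreover have "(\<Union>n. {..real n}) = UNIV" using real_arch_simple by auto
  ultimately have "(\<lambda>n. emeasure (smeasure X x) {..real n}) \<longlonglongrightarrow> emeasure (smeasure X x) UNIV" by simp
  moreover have "(\<lambda>n. emeasure (smeasure X x) {..real n}) \<longlonglongrightarrow> ennreal ((norm x)\<^sup>2)"
  proof (rule tendsto_eventually)
    obtain N where N: "c < real N" using reals_Archimedean2 by blast
    show "\<forall>\<^sub>F n in sequentially. emeasure (smeasure X x) {..real n} = ennreal ((norm x)\<^sup>2)"
      using N by (intro eventually_sequentiallyI [of N]) (simp add: emeasure_smeasure_Iic c(2))
  qed
  ultimately show ?thesis by (rule LIMSEQ_unique)
qed

lemma finite_measure_smeasure: "finite_measure (smeasure X x)"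
  by standard (simp add: emeasure_smeasure_UNIV)

lemma measure_smeasure_Ioc:
  "s \<le> t \<Longrightarrow> measure (smeasure X x) {s<..t} = (norm (resolution X t x))\<^sup>2 - (norm (resolution X s x))\<^sup>2"
  using norm_resolution_mono [of s t x] by (simp add: measure_def emeasure_smeasure_Ioc)

lemma measure_smeasure_Iic: "measure (smeasure X x) {..t} = (norm (resolution X t x))\<^sup>2"
  by (simp add: measure_def emeasure_smeasure_Iic)

lemma measure_smeasure_UNIV: "measure (smeasure X x) UNIV = (norm x)\<^sup>2"
  by (simp add: measure_def emeasure_smeasure_UNIV)

text \<open>The vector \<open>d\<close> is the component of \<open>x\<close> in the spectral
  subspace for \<open>(s, t]\<close>; it is orthogonal to the component below \<open>s\<close>, and
  \<open>X\<close> keeps the two apart.\<close>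

lemma form_resolution_diff:
  fixes x :: 'a
  assumes "s \<le> t"
  defines "d \<equiv> resolution X t x - resolution X s x"
  shows "Re (cinner (X (resolution X t x)) (resolution X t x)) - Re (cinner (X (resolution X s x)) (resolution X s x)) = Re (cinner (X d) d)"
    and "s * (norm d)\<^sup>2 \<le> Re (cinner (X d) d)" and "Re (cinner (X d) d) \<le> t * (norm d)\<^sup>2"
proof -
  have d: "resolution X t d = d" "resolution X s d = 0"
    by (simp_all add: d_def bop_diff [OF bop_resolution] resolution_resolution resolution_mono [OF assms(1)]
        resolution_mono' [OF assms(1)])
  have "cinner (X (resolution X s x)) d = cinner (X x) (resolution X s d)"
    using selfadjoint_cinner [OF orth_projection_selfadjoint [OF orth_projection_resolution]]
    by (simp add: resolution_X)
  then have "cinner (X (resolution X s x)) d = 0" by (simp add: d)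
  then show "Re (cinner (X (resolution X t x)) (resolution X t x)) - Re (cinner (X (resolution X s x)) (resolution X s x)) = Re (cinner (X d) d)"
    using selfadjoint_form_add [OF X, of "resolution X s x" d] by (simp add: d_def)
  show "s * (norm d)\<^sup>2 \<le> Re (cinner (X d) d)" by (rule form_ge_off_resolution(1) [OF d(2)])
  show "Re (cinner (X d) d) \<le> t * (norm d)\<^sup>2" by (rule form_le_on_resolution [OF d(1)])
qed

end

text \<open>Over \<open>n + 1\<close> equal pieces the increments of \<open>h\<close> sum to at most
  \<open>(b - a) (F b - F a) / (n + 1)\<close>, by telescoping. This stands in for Riemann-Stieltjes
  sums when forms are compared with integrals.\<close>

lemma eq_of_small_increments:
  fixes h F :: "real \<Rightarrow> real"
  assumes h: "\<And>s t. a \<le> s \<Longrightarrow> s \<le> t \<Longrightarrow> t \<le> b \<Longrightarrow> \<bar>h t - h s\<bar> \<le> (t - s) * (F t - F s)" and "a \<le> b"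
  shows "h a = h b"
proof -
  have *: "\<bar>h b - h a\<bar> \<le> (b - a) * (F b - F a) / Suc n" for n
  proof -
    define p where "p k = a + (b - a) * (real k / Suc n)" for k
    have "real (Suc n) / Suc n = 1" by (rule divide_self) simp
    then have p: "p 0 = a" "p (Suc n) = b" unfolding p_def by simp_all
    have step: "p (Suc k) - p k = (b - a) / Suc n" for k
      unfolding p_def by (simp add: algebra_simps add_divide_distrib diff_divide_distrib)
    have "\<bar>h b - h a\<bar> = \<bar>\<Sum>k<Suc n. h (p (Suc k)) - h (p k)\<bar>"
      using sum_lessThan_telescope [of "\<lambda>k. h (p k)" "Suc n"] by (simp only: p)
    also have "\<dots> \<le> (\<Sum>k<Suc n. \<bar>h (p (Suc k)) - h (p k)\<bar>)" by (rule sum_abs)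
    also have "\<dots> \<le> (\<Sum>k<Suc n. (b - a) / Suc n * (F (p (Suc k)) - F (p k)))"
    proof (rule sum_mono)
      fix k assume k: "k \<in> {..<Suc n}"
      have "a \<le> p k" using \<open>a \<le> b\<close> by (simp add: p_def)
      moreover have "p k \<le> p (Suc k)" using step [of k] \<open>a \<le> b\<close> by (smt (verit) divide_nonneg_nonneg of_nat_0_le_iff)
      moreover have "p (Suc k) \<le> b"
      proof -
        have "(b - a) * (real (Suc k) / Suc n) \<le> (b - a) * 1"
          using k \<open>a \<le> b\<close> by (intro mult_left_mono) (auto simp: divide_simps)
        then show ?thesis by (simp add: p_def)
      qed
      ultimately show "\<bar>h (p (Suc k)) - h (p k)\<bar> \<le> (b - a) / Suc n * (F (p (Suc k)) - F (p k))"
        using h [of "p k" "p (Suc k)"] unfolding step by blast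
    qed
    also have "\<dots> = (b - a) / Suc n * (F b - F a)"
      using sum_lessThan_telescope [of "\<lambda>k. F (p k)" "Suc n"]
      by (simp only: sum_distrib_left [symmetric] p)
    finally show ?thesis by simp
  qed
  have "\<bar>h b - h a\<bar> \<le> 0"
  proof (rule LIMSEQ_le_const)
    show "(\<lambda>n. (b - a) * (F b - F a) / Suc n) \<longlonglongrightarrow> 0"
      using tendsto_mult_right_zero [OF LIMSEQ_inverse_real_of_nat, of "(b - a) * (F b - F a)"]
      by (simp add: divide_inverse)
    show "\<exists>N. \<forall>n\<ge>N. \<bar>h b - h a\<bar> \<le> (b - a) * (F b - F a) / Suc n" using * by blast
  qed
  then show ?thesis by simp
qed

lemma integrable_bounded_support:
  assumes "finite_measure M" "sets M = sets (borel :: real measure)"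
  shows "integrable M (\<lambda>u. indicat_real {s<..t} u * u)"
proof (rule finite_measure.integrable_const_bound [OF assms(1), of _ "\<bar>s\<bar> + \<bar>t\<bar>"])
  show "AE u in M. norm (indicat_real {s<..t} u * u) \<le> \<bar>s\<bar> + \<bar>t\<bar>"
    by (auto split: split_indicator)
  show "(\<lambda>u. indicat_real {s<..t} u * u) \<in> borel_measurable M"
    unfolding measurable_cong_sets [OF assms(2) refl] by measurable
qed

text \<open>The form at \<open>resolution X t x\<close> and the integral over \<open>(a, t]\<close>
  both have increments between \<open>s\<close> and \<open>t\<close> times the mass of
  \<open>(s, t]\<close>, so their difference is constant.\<close>

lemma integral_smeasure:
  assumes X: "selfadjoint (X :: 'a::chilbert_space \<Rightarrow> 'a)"
  shows "(LINT u|smeasure X x. u) = Re (cinner (X x) x)"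
proof -
  let ?M = "smeasure X x"
  let ?F = "\<lambda>t. (norm (resolution X t x))\<^sup>2"
  interpret finite_measure ?M by (rule finite_measure_smeasure [OF X])
  note meas = sets_smeasure [OF X, of x]
  obtain c where c: "c > 0" "\<And>t x. t < - c \<Longrightarrow> resolution X t x = 0" "\<And>t x. t \<ge> c \<Longrightarrow> resolution X t x = x"
    using resolution_bounds [OF X] by blast
  \<comment> \<open>The resolution is known to vanish strictly below \<open>- c\<close>; with this
    \<open>a\<close> the half-open interval \<open>(a, c]\<close> carries the whole mass.\<close>
  define a where "a = - c - 1"
  have ac: "a \<le> c" "a < - c" using c(1) by (auto simp: a_def)
  define I where "I s t = (LINT u|?M. indicat_real {s<..t} u * u)" for s t
  note int = integrable_bounded_support [OF finite_measure_smeasure [OF X] meas]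
  have I_le: "s * measure ?M {s<..t} \<le> I s t" "I s t \<le> t * measure ?M {s<..t}" for s t
  proof -
    have e: "r * measure ?M {s<..t} = (LINT u|?M. indicat_real {s<..t} u * r)" for r
      using meas by (simp add: mult.commute)
    have i: "integrable ?M (\<lambda>u. indicat_real {s<..t} u * r)" for r
    proof (rule integrable_mult_left)
      show "integrable ?M (indicat_real {s<..t})"
        by (rule integrable_real_indicator) (simp_all add: meas top.not_eq_extremum [symmetric] emeasure_finite)
    qed
    show "s * measure ?M {s<..t} \<le> I s t" "I s t \<le> t * measure ?M {s<..t}"
      unfolding e I_def by (intro integral_mono i int; simp split: split_indicator)+
  qed
  have I_add: "I a t - I a s = I s t" if "a \<le> s" "s \<le> t" for s t
  proof -
    have "I a t = (LINT u|?M. indicat_real {a<..s} u * u + indicat_real {s<..t} u * u)"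
      unfolding I_def by (rule Bochner_Integration.integral_cong) (use that in \<open>auto split: split_indicator\<close>)
    also have "\<dots> = I a s + I s t" unfolding I_def by (rule Bochner_Integration.integral_add [OF int int])
    finally show ?thesis by simp
  qed
  define g where "g t = Re (cinner (X (resolution X t x)) (resolution X t x))" for t
  have "g a - I a a = g c - I a c"
  proof (rule eq_of_small_increments [where F = ?F and h = "\<lambda>t. g t - I a t", OF _ ac(1)])
    fix s t assume st: "a \<le> s" "s \<le> t"
    have m: "measure ?M {s<..t} = ?F t - ?F s" by (rule measure_smeasure_Ioc [OF X st(2)])
    have "s * (?F t - ?F s) \<le> g t - g s" "g t - g s \<le> t * (?F t - ?F s)"
      using form_resolution_diff [OF X st(2), of x] norm_resolution_diff [OF X st(2), of x]
      unfolding g_def by simp_all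
    then show "\<bar>(g t - I a t) - (g s - I a s)\<bar> \<le> (t - s) * (?F t - ?F s)"
      using I_le [of s t] I_add [OF st] unfolding m by (simp add: abs_le_iff left_diff_distrib)
  qed
  moreover have "g a = 0" using ac c(2) by (simp add: g_def)
  moreover have "I a a = 0" by (simp add: I_def)
  moreover have "g c = Re (cinner (X x) x)" using c(3) by (simp add: g_def)
  ultimately have "Re (cinner (X x) x) = I a c" by simp
  also have "\<dots> = (LINT u|?M. u)"
    unfolding I_def
  proof (rule integral_cong_AE)
    have "measure ?M (UNIV - {a<..c}) = 0"
      using meas ac c(2,3) measure_smeasure_Ioc [OF X ac(1), of x] measure_smeasure_UNIV [OF X, of x]
        finite_measure_compl [of "{a<..c}"] by (simp add: space_smeasure [OF X])
    then have "UNIV - {a<..c} \<in> null_sets ?M"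
      using meas by (intro null_setsI) (auto simp: emeasure_eq_measure)
    from AE_not_in [OF this] show "AE u in ?M. indicat_real {a<..c} u * u = u"
      by eventually_elim auto
  qed (simp_all add: measurable_cong_sets [OF meas refl])
  finally show ?thesis by simp
qed

subsection \<open>The projection-valued measure\<close>

lemma orth_projection_form:
  "orth_projection (P :: 'a::chilbert_space \<Rightarrow> 'a) \<Longrightarrow> Re (cinner (P x) x) = (norm (P x))\<^sup>2"
  by (simp add: orth_projection_cinner del: of_real_power)

lemma orth_projection_eqI:
  assumes "orth_projection (P :: 'a::chilbert_space \<Rightarrow> 'a)" "orth_projection Q"
    and "\<And>x. Re (cinner (P x) x) = Re (cinner (Q x) x)"
  shows "P = Q"
proof (rule form_eq_imp_eq)
  show "bop P" "bop Q" using assms by (simp_all add: orth_projection_def)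
  show "cinner (P x) x = cinner (Q x) x" for x
    using assms(3)[of x] by (metis assms(1,2) orth_projection_selfadjoint selfadjoint_Re)
qed

text \<open>At \<open>Q x\<close> the second term already exhausts the right-hand side.\<close>

lemma orth_projections_orthogonal:
  assumes P: "orth_projection (P :: 'a::chilbert_space \<Rightarrow> 'a)" and Q: "orth_projection Q"
    and le: "\<And>x. Re (cinner (P x) x) + Re (cinner (Q x) x) \<le> (norm x)\<^sup>2"
  shows "P (Q x) = 0"
  using le [of "Q x"] by (simp add: orth_projection_form [OF P] orth_projection_form [OF Q] orth_projection_idem [OF Q] cinner_self)

lemma norm_sum_sq_orthogonal:
  fixes v :: "'i \<Rightarrow> 'a::complex_inner"
  assumes "finite I" "\<And>i j. i \<in> I \<Longrightarrow> j \<in> I \<Longrightarrow> i \<noteq> j \<Longrightarrow> cinner (v i) (v j) = 0"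
  shows "(norm (\<Sum>i\<in>I. v i))\<^sup>2 = (\<Sum>i\<in>I. (norm (v i))\<^sup>2)"
  using assms
proof (induction I)
  case (insert k I)
  have "cinner (v k) (\<Sum>i\<in>I. v i) = 0"
    unfolding cinner.sum_right using insert by (intro sum.neutral) auto
  then show ?case using insert by (simp add: norm_add_sq_orthogonal)
qed simp

lemma sum_le_of_sums:
  fixes f :: "nat \<Rightarrow> real"
  assumes "f sums s" "\<And>n. 0 \<le> f n"
  shows "sum f {..<N} \<le> s"
  using sum_le_suminf [OF sums_summable [OF assms(1)], of "{..<N}"] assms(2) sums_unique [OF assms(1)] by simp

text \<open>Tested on pairs, the bound forces the projections to be mutually orthogonal; Bessel's
  inequality then makes the series converge.\<close>

lemma orth_projection_sums:
  fixes P :: "nat \<Rightarrow> 'a::chilbert_space \<Rightarrow> 'a"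
  assumes P: "\<And>n. orth_projection (P n)"
    and le: "\<And>x N. (\<Sum>n<N. Re (cinner (P n x) x)) \<le> (norm x)\<^sup>2"
  shows "\<exists>Q. orth_projection Q \<and> (\<forall>x. (\<lambda>n. P n x) sums Q x)"
proof -
  have bP: "bop (P n)" for n using P by (simp add: orth_projection_def)
  have orth: "P m (P n x) = 0" if "m \<noteq> n" for m n x
  proof (rule orth_projections_orthogonal [OF P P])
    fix x
    have "Re (cinner (P m x) x) + Re (cinner (P n x) x) = (\<Sum>k\<in>{m, n}. Re (cinner (P k x) x))"
      using that by simp
    also have "\<dots> \<le> (\<Sum>k<Suc (max m n). Re (cinner (P k x) x))"
      by (rule sum_mono2) (auto simp: orth_projection_form [OF P])
    also have "\<dots> \<le> (norm x)\<^sup>2" by (rule le)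
    finally show "Re (cinner (P m x) x) + Re (cinner (P n x) x) \<le> (norm x)\<^sup>2" .
  qed
  have cinner0: "cinner (P m x) (P n x) = 0" if "m \<noteq> n" for m n x
    using orth [OF that] selfadjoint_cinner [OF orth_projection_selfadjoint [OF P], of m x "P n x"] by simp
  have nsum: "(norm (\<Sum>n\<in>I. P n x))\<^sup>2 = (\<Sum>n\<in>I. (norm (P n x))\<^sup>2)" if "finite I" for I x
    using that by (rule norm_sum_sq_orthogonal) (rule cinner0)
  have le': "(\<Sum>n<N. (norm (P n x))\<^sup>2) \<le> (norm x)\<^sup>2" for x N
    using le [where x = x and N = N] by (simp add: orth_projection_form [OF P])
  have "summable (\<lambda>n. P n x)" for x
    unfolding summable_Cauchy
  proof (intro allI impI)
    fix e :: real assume "e > 0"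
    have "summable (\<lambda>n. (norm (P n x))\<^sup>2)"
      by (rule summableI_nonneg_bounded [OF _ le']) simp
    then obtain N where N: "\<And>m n. m \<ge> N \<Longrightarrow> norm (\<Sum>k\<in>{m..<n}. (norm (P k x))\<^sup>2) < e\<^sup>2"
      unfolding summable_Cauchy using \<open>e > 0\<close> by (metis zero_less_power)
    have "norm (\<Sum>k\<in>{m..<n}. P k x) < e" if "m \<ge> N" for m n
    proof -
      have "(norm (\<Sum>k\<in>{m..<n}. P k x))\<^sup>2 < e\<^sup>2"
        using N [OF that, of n] by (simp add: nsum sum_nonneg)
      then show ?thesis by (rule power_less_imp_less_base) (use \<open>e > 0\<close> in simp)
    qed
    then show "\<exists>N. \<forall>m\<ge>N. \<forall>n. norm (\<Sum>k\<in>{m..<n}. P k x) < e" by blast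
  qed
  then have sums: "(\<lambda>n. P n x) sums (\<Sum>n. P n x)" for x by (rule summable_sums)
  define Q where "Q x = (\<Sum>n. P n x)" for x
  have Q: "(\<lambda>n. P n x) sums Q x" for x unfolding Q_def by (rule sums)
  have bQ: "bop Q"
  proof (rule bopI [of _ 1])
    show "Q (x + y) = Q x + Q y" for x y
      using sums_unique2 [OF Q [of "x + y"]] sums_add [OF Q Q, of x y] by (simp add: bop_add [OF bP])
    show "Q (c *\<^sub>C x) = c *\<^sub>C Q x" for c x
      using sums_unique2 [OF Q [of "c *\<^sub>C x"]] bounded_linear.sums [OF bounded_linear_scaleC Q, of c x]
      by (simp add: bop_scaleC [OF bP])
    show "norm (Q x) \<le> 1 * norm x" for x
    proof -
      have "norm (\<Sum>n<N. P n x) \<le> norm x" for N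
        by (rule power2_le_imp_le) (simp_all only: nsum finite_lessThan le' norm_ge_zero)
      moreover have "(\<lambda>N. norm (\<Sum>n<N. P n x)) \<longlonglongrightarrow> norm (Q x)"
        using Q [of x] unfolding sums_def by (rule tendsto_norm)
      ultimately have "norm (Q x) \<le> norm x" using LIMSEQ_le_const2 by blast
      then show ?thesis by simp
    qed
  qed
  have PQ: "P m (Q x) = P m x" for m x
  proof -
    have "(\<lambda>n. P m (P n x)) sums P m (Q x)"
      by (rule bounded_linear.sums [OF bop_bounded_linear [OF bP] Q])
    moreover have "(\<lambda>n. P m (P n x)) = (\<lambda>n. if n = m then P m x else 0)"
      using orth by (auto simp: orth_projection_idem [OF P])
    ultimately show ?thesis using sums_unique2 sums_single [of m "\<lambda>_. P m x"] by metis
  qed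
  have "selfadjoint Q"
  proof (rule selfadjointI [OF bQ])
    fix x y
    have "(\<lambda>n. cinner (P n x) y) sums cinner (Q x) y"
      by (rule bounded_linear.sums [OF cinner.bounded_linear_left Q])
    moreover have "(\<lambda>n. cinner x (P n y)) sums cinner x (Q y)"
      by (rule bounded_linear.sums [OF cinner.bounded_linear_right Q])
    moreover have "(\<lambda>n. cinner (P n x) y) = (\<lambda>n. cinner x (P n y))"
      using selfadjoint_cinner [OF orth_projection_selfadjoint [OF P]] by auto
    ultimately show "cinner (Q x) y = cinner x (Q y)" using sums_unique2 by metis
  qed
  moreover have "Q (Q x) = Q x" for x
    using Q [of "Q x"] Q [of x] unfolding PQ by (rule sums_unique2)
  ultimately have "orth_projection Q" by (simp add: orth_projection_iff)
  with Q show ?thesis by blast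
qed

context
  fixes X :: "'a::chilbert_space \<Rightarrow> 'a"
  assumes X: "selfadjoint X"
begin

lemma smeasure_disjoint_union:
  assumes A: "range A \<subseteq> sets borel" "disjoint_family A"
    and P: "\<And>n. orth_projection (P n)" "\<And>n x. measure (smeasure X x) (A n) = Re (cinner (P n x) x)"
  shows "\<exists>Q. orth_projection Q \<and> (\<forall>x. (\<lambda>n. P n x) sums Q x) \<and>
    (\<forall>x. measure (smeasure X x) (\<Union>n. A n) = Re (cinner (Q x) x))"
proof -
  interpret finite_measure "smeasure X x" for x by (rule finite_measure_smeasure [OF X])
  have sm: "(\<lambda>n. measure (smeasure X x) (A n)) sums measure (smeasure X x) (\<Union>n. A n)" for x
    using A by (intro finite_measure_UNION) (simp_all add: sets_smeasure [OF X])
  have "(\<Sum>n<N. Re (cinner (P n x) x)) \<le> (norm x)\<^sup>2" for x N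
  proof -
    have "(\<Sum>n<N. measure (smeasure X x) (A n)) \<le> measure (smeasure X x) (\<Union>n. A n)"
      using sm [of x] by (intro sum_le_of_sums) auto
    also have "\<dots> \<le> measure (smeasure X x) UNIV"
      using bounded_measure [of x] by (simp add: space_smeasure [OF X])
    finally show ?thesis by (simp add: P(2) measure_smeasure_UNIV [OF X])
  qed
  from orth_projection_sums [OF P(1) this] obtain Q
    where Q: "orth_projection Q" "\<And>x. (\<lambda>n. P n x) sums Q x" by blast
  have "measure (smeasure X x) (\<Union>n. A n) = Re (cinner (Q x) x)" for x
  proof -
    have "(\<lambda>n. Re (cinner (P n x) x)) sums Re (cinner (Q x) x)"
      by (intro bounded_linear.sums [OF bounded_linear_Re] bounded_linear.sums [OF cinner.bounded_linear_left Q(2)])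
    with sm [of x] show ?thesis unfolding P(2) by (rule sums_unique2)
  qed
  with Q show ?thesis by blast
qed

text \<open>The sets with such a projection are closed under complements and disjoint unions, though
  not visibly under intersections. The half-lines are stable under intersection, so Dynkin's theorem
  reaches all Borel sets.\<close>

lemma smeasure_represented:
  assumes A: "A \<in> sets borel"
  shows "\<exists>Q. orth_projection Q \<and> (\<forall>x. measure (smeasure X x) A = Re (cinner (Q x) x))"
proof -
  have b: "sets (borel :: real measure) = sigma_sets UNIV (range (\<lambda>a. {..a}))"
    by (subst borel_eq_atMost) (simp add: sets_measure_of)
  interpret finite_measure "smeasure X x" for x by (rule finite_measure_smeasure [OF X])
  from A show ?thesis
    unfolding b
  proof (induction rule: sigma_sets_induct_disjoint [rotated 2, consumes 1, case_names basic empty compl union int sub])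
    case (basic A)
    then obtain t where "A = {..t}" by auto
    then show ?case
      using orth_projection_resolution [OF X] measure_smeasure_Iic [OF X]
      by (intro exI [of _ "resolution X t"]) (simp add: orth_projection_form)
  next
    case empty
    show ?case by (intro exI [of _ "\<lambda>x. 0"]) (simp add: orth_projection_iff selfadjoint_zero)
  next
    case (compl A)
    then obtain Q where Q: "orth_projection Q" "\<forall>x. measure (smeasure X x) A = Re (cinner (Q x) x)" by blast
    have "A \<in> sets (smeasure X x)" for x using compl(1) by (simp add: sets_smeasure [OF X] b)
    then have "measure (smeasure X x) (UNIV - A) = (norm x)\<^sup>2 - Re (cinner (Q x) x)" for x
      using finite_measure_compl [of A x] Q(2) by (simp add: space_smeasure [OF X] measure_smeasure_UNIV [OF X])
    then show ?case
      using orth_projection_compl [OF Q(1)]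
      by (intro exI [of _ "\<lambda>x. x - Q x"]) (simp add: cinner.diff_left cinner_self del: of_real_power)
  next
    case (union A)
    then obtain P where P: "\<And>n. orth_projection (P n)" "\<And>n x. measure (smeasure X x) (A n) = Re (cinner (P n x) x)"
      by metis
    have "range A \<subseteq> sets borel" using union(2) by (simp add: b)
    from smeasure_disjoint_union [OF this union(1) P] show ?case by blast
  next
    case int
    show ?case by (auto simp: Int_stable_def)
  next
    case sub
    show ?case by simp
  qed
qed

lemma scalar_measure_eq_smeasure:
  assumes "\<And>A. A \<in> sets borel \<Longrightarrow> Re (cinner (E A x) x) = measure (smeasure X x) A"
  shows "scalar_measure E x = smeasure X x"
proof -
  interpret finite_measure "smeasure X x" by (rule finite_measure_smeasure [OF X])
  have "scalar_measure E x = measure_of UNIV (sets borel) (emeasure (smeasure X x))"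
    unfolding scalar_measure_def
  proof (rule measure_of_eq)
    fix A :: "real set" assume "A \<in> sigma_sets UNIV (sets borel)"
    then have "A \<in> sets borel" using sets.sigma_sets_eq [of "borel :: real measure"] by simp
    then show "ennreal (Re (cinner (E A x) x)) = emeasure (smeasure X x) A"
      by (simp add: assms emeasure_eq_measure)
  qed simp
  also have "\<dots> = smeasure X x"
    using measure_of_of_measure [of "smeasure X x"] by (simp add: space_smeasure [OF X] sets_smeasure [OF X])
  finally show ?thesis .
qed

theorem spectral_theorem:
  "\<exists>E. projection_valued_measure E \<and> (\<exists>c. E {-c..c} = id) \<and> is_spectral_integral E (\<lambda>t. t) X"
proof -
  \<comment> \<open>The choice is harmless, since a projection is determined by its quadratic
    form.\<close>
  define E where "E A = (SOME Q. orth_projection Q \<and> (\<forall>x. measure (smeasure X x) A = Re (cinner (Q x) x)))" for A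
  have E: "orth_projection (E A)" "measure (smeasure X x) A = Re (cinner (E A x) x)" if "A \<in> sets borel" for A x
    unfolding E_def using someI_ex [OF smeasure_represented [OF that]] by blast+
  interpret finite_measure "smeasure X x" for x by (rule finite_measure_smeasure [OF X])
  have idI: "E A = id" if "A \<in> sets borel" "\<And>x. measure (smeasure X x) A = (norm x)\<^sup>2" for A
  proof (rule orth_projection_eqI)
    show "orth_projection (E A)" by (rule E(1) [OF that(1)])
    show "orth_projection (id :: 'a \<Rightarrow> 'a)" by (simp add: orth_projection_iff id_def selfadjoint_id)
    show "Re (cinner (E A x) x) = Re (cinner (id x) x)" for x
      using that by (simp flip: E(2) add: cinner_self)
  qed
  have "projection_valued_measure E"
    unfolding projection_valued_measure_def
  proof (intro conjI ballI allI impI)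
    show "orth_projection (E A)" if "A \<in> sets borel" for A by (rule E(1) [OF that])
    show "E UNIV = id" by (rule idI) (simp_all add: measure_smeasure_UNIV [OF X])
    fix A :: "nat \<Rightarrow> real set" and x
    assume A: "range A \<subseteq> sets borel \<and> disjoint_family A"
    then have An: "A n \<in> sets borel" for n by auto
    obtain Q where Q: "orth_projection Q" "\<And>x. (\<lambda>n. E (A n) x) sums Q x"
      "\<And>x. measure (smeasure X x) (\<Union>n. A n) = Re (cinner (Q x) x)"
      using smeasure_disjoint_union [OF conjunct1 [OF A] conjunct2 [OF A] E(1) [OF An] E(2) [OF An]] by blast
    have U: "(\<Union>n. A n) \<in> sets borel" using An by auto
    have "Q = E (\<Union>n. A n)"
      by (rule orth_projection_eqI [OF Q(1) E(1) [OF U]]) (simp flip: Q(3) E(2) [OF U])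
    with Q(2) show "(\<lambda>n. E (A n) x) sums E (\<Union>n. A n) x" by simp
  qed
  moreover have "\<exists>c. E {-c..c} = id"
  proof -
    obtain c where c: "c > 0" "\<And>t x. t < - c \<Longrightarrow> resolution X t x = 0" "\<And>t x. t \<ge> c \<Longrightarrow> resolution X t x = x"
      using resolution_bounds [OF X] by blast
    \<comment> \<open>Enlarging by \<open>1\<close> makes room for the half-open interval from
      \<open>-(c+1)\<close>, at whose left end the resolution vanishes.\<close>
    have "measure (smeasure X x) {-(c+1)..c+1} = (norm x)\<^sup>2" for x
    proof (rule antisym)
      show "measure (smeasure X x) {-(c+1)..c+1} \<le> (norm x)\<^sup>2"
        using bounded_measure [of x] by (simp add: space_smeasure [OF X] measure_smeasure_UNIV [OF X])
      have "(norm x)\<^sup>2 = measure (smeasure X x) {-(c+1)<..c+1}"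
        using c by (subst measure_smeasure_Ioc [OF X]) auto
      also have "\<dots> \<le> measure (smeasure X x) {-(c+1)..c+1}"
        by (rule finite_measure_mono) (auto simp: sets_smeasure [OF X])
      finally show "(norm x)\<^sup>2 \<le> measure (smeasure X x) {-(c+1)..c+1}" .
    qed
    then show ?thesis by (intro exI [of _ "c + 1"] idI) simp_all
  qed
  moreover have "is_spectral_integral E (\<lambda>t. t) X"
    unfolding is_spectral_integral_def
  proof (intro conjI allI)
    show "bop X" using X by (rule selfadjoint_bop)
    have "scalar_measure E x = smeasure X x" for x
      by (rule scalar_measure_eq_smeasure) (simp add: E(2))
    then show "cinner (X x) x = complex_of_real (LINT t|scalar_measure E x. t)" for x
      using integral_smeasure [OF X, of x] selfadjoint_Re [OF X, of x] by simp
  qed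
  ultimately show ?thesis by blast
qed

end

subsection \<open>The negative spectral projection\<close>

lemma halflines: "{..<0} \<inter> {0..} = ({} :: real set)" "{..<0} \<union> {0..} = (UNIV :: real set)"
  by auto

lemma cinner_orth_projection:
  "orth_projection (P :: 'a::chilbert_space \<Rightarrow> 'a) \<Longrightarrow> cinner (P x) y = cinner x (P y)"
  by (rule selfadjoint_cinner [OF orth_projection_selfadjoint])

section \<open>Arbitrary spectral measures, as \<open>spectral_measure\<close> is given by its three
  defining properties alone\<close>

context
  fixes X :: "'a::chilbert_space \<Rightarrow> 'a" and E
  assumes X: "selfadjoint X"
    and pvm: "projection_valued_measure E" and bd: "\<exists>c. E {-c..c} = id" and int: "is_spectral_integral E (\<lambda>t. t) X"
begin

lemma pvm_proj: "A \<in> sets borel \<Longrightarrow> orth_projection (E A)"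
  and pvm_UNIV: "E UNIV = id"
  using pvm by (auto simp: projection_valued_measure_def)

lemma pvm_sums: "range A \<subseteq> sets borel \<Longrightarrow> disjoint_family A \<Longrightarrow> (\<lambda>n. E (A n) x) sums E (\<Union>n. A n) x"
  using pvm by (auto simp: projection_valued_measure_def)

text \<open>Countable additivity for a sequence of empty sets is a convergent series with constant
  terms.\<close>

lemma pvm_empty: "E {} x = 0"
proof -
  have "(\<lambda>n::nat. E {} x) sums E (\<Union>n::nat. {}) x"
    by (rule pvm_sums) (auto simp: disjoint_family_on_def)
  then have "summable (\<lambda>n::nat. E {} x)" by (rule sums_summable)
  from summable_LIMSEQ_zero [OF this] show ?thesis by (simp add: LIMSEQ_const_iff)
qed

lemma pvm_union:
  assumes "A \<in> sets borel" "B \<in> sets borel" "A \<inter> B = {}"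
  shows "E (A \<union> B) x = E A x + E B x"
proof -
  have "(\<lambda>n. E (binaryset A B n) x) sums E (\<Union>n. binaryset A B n) x"
    using assms by (intro pvm_sums) (auto simp: range_binaryset_eq disjoint_family_on_def binaryset_def)
  moreover have "(\<lambda>n. E (binaryset A B n) x) sums (\<Sum>n<2. E (binaryset A B n) x)"
    by (rule sums_finite) (auto simp: binaryset_def pvm_empty)
  ultimately show ?thesis
    using sums_unique2 by (fastforce simp: UN_binaryset_eq binaryset_def numeral_2_eq_2)
qed

text \<open>\<open>E A + E B = E (A \<union> B)\<close> is a projection, so the two forms add up to
  at most \<open>|x|^2\<close>.\<close>

lemma pvm_disjoint:
  assumes "A \<in> sets borel" "B \<in> sets borel" "A \<inter> B = {}"
  shows "E A (E B x) = 0"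
proof (rule orth_projections_orthogonal [of "E A" "E B"])
  show "orth_projection (E A)" "orth_projection (E B)" using assms pvm_proj by auto
  fix x
  have "Re (cinner (E A x) x) + Re (cinner (E B x) x) = Re (cinner (E (A \<union> B) x) x)"
    by (simp add: pvm_union [OF assms] cinner_add_left)
  also have "\<dots> = (norm (E (A \<union> B) x))\<^sup>2" using assms by (simp add: orth_projection_form pvm_proj)
  also have "\<dots> \<le> (norm x)\<^sup>2"
    using assms by (intro power_mono orth_projection_norm_le pvm_proj) auto
  finally show "Re (cinner (E A x) x) + Re (cinner (E B x) x) \<le> (norm x)\<^sup>2" .
qed

lemma sets_scalar_measure [simp]: "sets (scalar_measure E x) = sets borel"
  and space_scalar_measure [simp]: "space (scalar_measure E x) = UNIV"
  by (simp_all add: scalar_measure_def sets.sigma_sets_eq [of borel, simplified] sets_measure_of_conv space_measure_of_conv)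

lemma emeasure_scalar_measure:
  assumes "A \<in> sets borel"
  shows "emeasure (scalar_measure E x) A = ennreal (Re (cinner (E A x) x))"
  unfolding scalar_measure_def
proof (rule emeasure_measure_of_sigma)
  show "sigma_algebra UNIV (sets (borel :: real measure))"
    using sets.sigma_algebra_axioms [of borel] by simp
  show "positive (sets borel) (\<lambda>A. ennreal (Re (cinner (E A x) x)))"
    by (simp add: positive_def pvm_empty)
  show "countably_additive (sets borel) (\<lambda>A. ennreal (Re (cinner (E A x) x)))"
  proof (rule countably_additiveI)
    fix A :: "nat \<Rightarrow> real set"
    assume A: "range A \<subseteq> sets borel" "disjoint_family A" "(\<Union>n. A n) \<in> sets borel"
    have "(\<lambda>n. Re (cinner (E (A n) x) x)) sums Re (cinner (E (\<Union>n. A n) x) x)"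
      by (intro bounded_linear.sums [OF bounded_linear_Re] bounded_linear.sums [OF cinner.bounded_linear_left] pvm_sums A)
    moreover have "0 \<le> Re (cinner (E (A n) x) x)" for n
      using A(1) by (simp add: orth_projection_form pvm_proj image_subset_iff)
    ultimately show "(\<Sum>n. ennreal (Re (cinner (E (A n) x) x))) = ennreal (Re (cinner (E (\<Union>n. A n) x) x))"
      by (subst suminf_ennreal2) (simp_all add: sums_iff)
  qed
qed (use assms in simp)

lemma finite_measure_scalar_measure: "finite_measure (scalar_measure E x)"
  by standard (simp add: emeasure_scalar_measure)

lemma null_scalar_measure:
  assumes "A \<in> sets borel" "E A x = 0"
  shows "AE t in scalar_measure E x. t \<notin> A"
  using assms by (intro AE_not_in) (auto simp: null_sets_def emeasure_scalar_measure)

lemma integrable_scalar_measure: "integrable (scalar_measure E x) (\<lambda>t. t)"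
proof -
  obtain c where c: "E {-c..c} = id" using bd by blast
  have "x = x + E (- {-c..c}) x"
    using pvm_union [of "{-c..c}" "- {-c..c}" x] by (simp add: c pvm_UNIV)
  then have "E (- {-c..c}) x = 0" by simp
  then have "AE t in scalar_measure E x. t \<notin> - {-c..c}" by (intro null_scalar_measure) auto
  then have "AE t in scalar_measure E x. norm t \<le> c" by eventually_elim auto
  then show ?thesis
    by (rule finite_measure.integrable_const_bound [OF finite_measure_scalar_measure])
       (simp add: measurable_cong_sets [OF sets_scalar_measure refl])
qed

lemma form_eq_integral: "Re (cinner (X x) x) = (LINT t|scalar_measure E x. t)"
  using int by (simp add: is_spectral_integral_def)

text \<open>The scalar measure of such an \<open>x\<close> lives on \<open>t < 0\<close>, so a
  vanishing integral of \<open>- t\<close> makes it the zero measure, while its total mass is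
  \<open>|x|^2\<close>.\<close>

lemma negative_form:
  assumes x: "E {..<0} x = x"
  shows "Re (cinner (X x) x) \<le> 0" and "Re (cinner (X x) x) = 0 \<Longrightarrow> x = 0"
proof -
  have "x = x + E {0..} x"
    using pvm_union [of "{..<0}" "{0..}" x] x by (simp add: pvm_UNIV halflines)
  then have AE: "AE t in scalar_measure E x. t < 0"
    using null_scalar_measure [of "{0..}" x] by (auto simp: not_le)
  have "0 \<le> (LINT t|scalar_measure E x. - t)"
    using AE by (intro integral_nonneg_AE) (auto elim: eventually_mono)
  then show "Re (cinner (X x) x) \<le> 0" by (simp add: form_eq_integral integrable_scalar_measure)
  assume "Re (cinner (X x) x) = 0"
  then have "(LINT t|scalar_measure E x. - t) = 0" by (simp add: form_eq_integral integrable_scalar_measure)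
  then have "AE t in scalar_measure E x. - t = 0"
    using AE by (subst (asm) integral_nonneg_eq_0_iff_AE)
      (auto simp: integrable_scalar_measure elim: eventually_mono)
  with AE have "AE t in scalar_measure E x. False" by eventually_elim simp
  then have "emeasure (scalar_measure E x) UNIV = 0"
    by (auto elim!: AE_E simp: top.extremum_unique)
  then show "x = 0" by (simp add: emeasure_scalar_measure pvm_UNIV cinner_self)
qed

lemma nonnegative_form:
  assumes x: "E {..<0} x = 0"
  shows "0 \<le> Re (cinner (X x) x)"
  unfolding form_eq_integral
  using null_scalar_measure [of "{..<0}" x] x by (intro integral_nonneg_AE) (auto simp: not_less)

text \<open>Multiplicativity, \<open>E A (E N x) = E (A \<inter> N) x\<close>, derived from
  additivity and orthogonality, makes restriction of measures match projection of vectors.\<close>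

lemma scalar_measure_restrict:
  assumes N: "N \<in> sets borel"
  shows "density (scalar_measure E x) (indicator N) = scalar_measure E (E N x)"
proof (rule measure_eqI)
  fix A assume "A \<in> sets (density (scalar_measure E x) (indicator N))"
  then have A: "A \<in> sets borel" by simp
  have 0: "E (A - N) (E N x) = 0" using A N by (intro pvm_disjoint) auto
  have 1: "E (A \<inter> N) (E N x) = E (A \<inter> N) x"
  proof -
    have "E (A \<inter> N) (E (UNIV - N) x) = 0" using A N by (intro pvm_disjoint) auto
    moreover have "x = E N x + E (UNIV - N) x"
      using pvm_union [of N "UNIV - N" x] N by (simp add: pvm_UNIV)
    ultimately show ?thesis
      using bop_add [OF selfadjoint_bop [OF orth_projection_selfadjoint [OF pvm_proj]], of "A \<inter> N" "E N x" "E (UNIV - N) x"] A N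
      by simp
  qed
  have 2: "E A (E N x) = E (A \<inter> N) x"
  proof -
    have "E ((A \<inter> N) \<union> (A - N)) (E N x) = E (A \<inter> N) (E N x) + E (A - N) (E N x)"
      by (rule pvm_union) (use A N in auto)
    then show ?thesis unfolding Int_Diff_Un 0 1 by simp
  qed
  have 3: "E N (E (A \<inter> N) x) = E (A \<inter> N) x"
  proof -
    have "E (UNIV - N) (E (A \<inter> N) x) = 0" using A N by (intro pvm_disjoint) auto
    moreover have "E (A \<inter> N) x = E N (E (A \<inter> N) x) + E (UNIV - N) (E (A \<inter> N) x)"
      using pvm_union [of N "UNIV - N" "E (A \<inter> N) x"] N by (simp add: pvm_UNIV)
    ultimately show ?thesis by simp
  qed
  have "emeasure (density (scalar_measure E x) (indicator N)) A = emeasure (scalar_measure E x) (N \<inter> A)"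
    using N A by (simp add: emeasure_restricted)
  also have "\<dots> = ennreal (Re (cinner (E (A \<inter> N) x) x))"
    using N A by (simp add: emeasure_scalar_measure Int_commute)
  also have "cinner (E (A \<inter> N) x) x = cinner (E A (E N x)) (E N x)"
    unfolding 2 using cinner_orth_projection [OF pvm_proj [OF N], of "E (A \<inter> N) x" x] by (simp add: 3)
  finally show "emeasure (density (scalar_measure E x) (indicator N)) A = emeasure (scalar_measure E (E N x)) A"
    using A by (simp add: emeasure_scalar_measure)
qed simp

text \<open>By restriction, the form at \<open>E N x\<close> is the integral of \<open>t\<close>
  over \<open>N\<close>, and the integral splits over the two half-lines.\<close>

lemma form_split:
  "Re (cinner (X x) x) = Re (cinner (X (E {..<0} x)) (E {..<0} x)) + Re (cinner (X (x - E {..<0} x)) (x - E {..<0} x))"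
proof -
  let ?M = "scalar_measure E x"
  have *: "Re (cinner (X (E N x)) (E N x)) = (LINT t|?M. indicat_real N t * t)"
    and **: "integrable ?M (\<lambda>t. indicat_real N t * t)" if N: "N \<in> sets borel" for N
  proof -
    have "Re (cinner (X (E N x)) (E N x)) = (LINT t|density ?M (indicator N). t)"
      by (simp add: form_eq_integral scalar_measure_restrict [OF N])
    also have "(\<lambda>t. ennreal (indicat_real N t)) = indicator N" by (auto split: split_indicator)
    then have "(LINT t|density ?M (indicator N). t) = (LINT t|density ?M (\<lambda>t. ennreal (indicat_real N t)). t)" by simp
    also have "\<dots> = (LINT t|?M. indicat_real N t *\<^sub>R t)"
      using N by (intro integral_density) (auto simp: measurable_cong_sets [OF sets_scalar_measure refl])
    finally show "Re (cinner (X (E N x)) (E N x)) = (LINT t|?M. indicat_real N t * t)" by simp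
    show "integrable ?M (\<lambda>t. indicat_real N t * t)"
      using integrable_mult_indicator [OF _ integrable_scalar_measure, of N x] N by simp
  qed
  have "x - E {..<0} x = E {0..} x"
    using pvm_union [of "{..<0}" "{0..}" x] by (simp add: pvm_UNIV halflines algebra_simps)
  moreover have "(LINT t|?M. t) = (LINT t|?M. indicat_real {..<0} t * t + indicat_real {0..} t * t)"
    by (rule Bochner_Integration.integral_cong) (auto split: split_indicator)
  ultimately show ?thesis
    using * [of "{..<0}"] * [of "{0..}"] ** [of "{..<0}"] ** [of "{0..}"]
    by (simp add: form_eq_integral [of x])
qed

text \<open>A weak integral controls quadratic forms only, so commutation is not immediate. The
  block-diagonal compression \<open>Y = P X P + (1 - P) X (1 - P)\<close> has the same form as
  \<open>X\<close> by \<open>form_split\<close>; hence it equals \<open>X\<close>, and it commutes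
  with \<open>P\<close>.\<close>

lemma spectral_projection_commute: "X (E {..<0} x) = E {..<0} (X x)"
proof -
  let ?P = "E {..<0}"
  have P: "orth_projection ?P" by (rule pvm_proj) simp
  have sP: "selfadjoint ?P" by (rule orth_projection_selfadjoint [OF P])
  note bP = selfadjoint_bop [OF sP] and bX = selfadjoint_bop [OF X]
  define Y where "Y x = ?P (X (?P x)) + (X (x - ?P x) - ?P (X (x - ?P x)))" for x
  have bY: "bop Y"
    unfolding Y_def [abs_def]
    by (intro bop_plus bop_sub bop_compose [OF bP bop_compose [OF bX bP]] bop_compose [OF bX]
        bop_compose [OF bP bop_compose [OF bX]] bop_id bP)
  have sYX: "cinner (Y x) x = cinner (X (?P x)) (?P x) + cinner (X (x - ?P x)) (x - ?P x)" for x
    by (simp add: Y_def cinner_add_left cinner.diff_left cinner.diff_right cinner_orth_projection [OF P])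
  have "Y = X"
  proof (rule form_eq_imp_eq [OF bY bX])
    show "cinner (Y x) x = cinner (X x) x" for x
    proof -
      have "cinner (Y x) x = of_real (Re (cinner (X (?P x)) (?P x))) +
          of_real (Re (cinner (X (x - ?P x)) (x - ?P x)))"
        unfolding sYX by (rule arg_cong2 [where f = "(+)"]; rule selfadjoint_Re [OF X])
      also have "\<dots> = of_real (Re (cinner (X x) x))" by (simp add: form_split [of x])
      also have "\<dots> = cinner (X x) x" by (rule selfadjoint_Re [OF X, symmetric])
      finally show ?thesis .
    qed
  qed
  then have XY: "X z = ?P (X (?P z)) + (X (z - ?P z) - ?P (X (z - ?P z)))" for z
    by (metis Y_def)
  note idem = orth_projection_idem [OF P]
  have "X (?P x) = ?P (X (?P x))" using XY [of "?P x"]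
    by (simp add: idem bop_zero [OF bX] bop_zero [OF bP])
  moreover have "?P (X x) = ?P (X (?P x))" using arg_cong [OF XY [of x], of ?P]
    by (simp add: idem bop_add [OF bP] bop_diff [OF bP])
  ultimately show ?thesis by simp
qed

text \<open>The function is \<open>1\<close> minus twice the indicator of the open negative
  half-line, including its value \<open>1\<close> at \<open>0\<close>.\<close>

lemma spectral_integral_sign:
  "is_spectral_integral E (\<lambda>t. if t \<ge> 0 then 1 else -1) (\<lambda>x. x - 2 *\<^sub>R E {..<0} x)"
  unfolding is_spectral_integral_def
proof (intro conjI allI)
  have P: "orth_projection (E {..<0})" by (rule pvm_proj) simp
  show "bop (\<lambda>x. x - 2 *\<^sub>R E {..<0} x)"
    by (intro bop_sub bop_id bop_scaleR_op) (use P in \<open>simp add: orth_projection_def\<close>)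
  fix x
  let ?M = "scalar_measure E x"
  interpret finite_measure ?M by (rule finite_measure_scalar_measure)
  have i: "integrable ?M (indicat_real {..<0})"
    by (rule integrable_real_indicator) (simp_all add: top.not_eq_extremum [symmetric] emeasure_finite)
  have m: "measure ?M A = Re (cinner (E A x) x)" if "A \<in> sets borel" for A
    using that by (simp add: measure_def emeasure_scalar_measure orth_projection_form pvm_proj)
  have "(LINT t|?M. (if t \<ge> 0 then 1 else -1)) = (LINT t|?M. 1 - 2 * indicat_real {..<0} t)"
    by (rule Bochner_Integration.integral_cong) (auto split: split_indicator)
  also have "\<dots> = measure ?M UNIV - 2 * measure ?M {..<0}"
    using i by simp
  finally have "(LINT t|?M. (if t \<ge> 0 then 1 else -1::real)) = (norm x)\<^sup>2 - 2 * Re (cinner (E {..<0} x) x)"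
    by (simp add: m pvm_UNIV cinner_self)
  then show "cinner (x - 2 *\<^sub>R E {..<0} x) x = complex_of_real (LINT t|?M. (if t \<ge> 0 then 1 else -1))"
    by (simp add: cinner.diff_left scaleR_cinner_left orth_projection_cinner [OF P] cinner_self scaleR_conv_of_real)
qed

end

definition neg_proj :: "('a::complex_inner \<Rightarrow> 'a) \<Rightarrow> 'a \<Rightarrow> 'a"
  where "neg_proj X = spectral_measure X {..<0}"

context
  fixes X :: "'a::chilbert_space \<Rightarrow> 'a"
  assumes X: "selfadjoint X"
begin

lemma spectral_measure:
  "projection_valued_measure (spectral_measure X)" "\<exists>c. spectral_measure X { - c..c} = id"
  "is_spectral_integral (spectral_measure X) (\<lambda>t. t) X"
  unfolding spectral_measure_def using someI_ex [OF spectral_theorem [OF X]] by blast+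

lemma orth_projection_neg_proj: "orth_projection (neg_proj X)"
  unfolding neg_proj_def by (rule pvm_proj [OF X spectral_measure]) simp

lemma neg_proj_form_neg: "neg_proj X x = x \<Longrightarrow> x \<noteq> 0 \<Longrightarrow> Re (cinner (X x) x) < 0"
  using negative_form [OF X spectral_measure, of x] unfolding neg_proj_def by fastforce

lemma neg_proj_form_nonneg: "neg_proj X x = 0 \<Longrightarrow> 0 \<le> Re (cinner (X x) x)"
  using nonnegative_form [OF X spectral_measure] unfolding neg_proj_def by blast

lemma neg_proj_commute: "X (neg_proj X x) = neg_proj X (X x)"
  unfolding neg_proj_def by (rule spectral_projection_commute [OF X spectral_measure])

text \<open>A spectral integral is determined by its quadratic form, which makes the description in
  \<open>functional_calculus\<close> proper. The value \<open>1\<close> at \<open>0\<close> makes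
  the sign an involution on the whole space, kernel of \<open>X\<close> included.\<close>

lemma sign_op_eq: "sign_op X = (\<lambda>x. x - 2 *\<^sub>R neg_proj X x)"
  unfolding sign_op_def functional_calculus_def
proof (rule the_equality)
  show s: "is_spectral_integral (spectral_measure X) (\<lambda>t. if 0 \<le> t then 1 else - 1) (\<lambda>x. x - 2 *\<^sub>R neg_proj X x)"
    unfolding neg_proj_def by (rule spectral_integral_sign [OF X spectral_measure])
  fix B assume "is_spectral_integral (spectral_measure X) (\<lambda>t. if 0 \<le> t then 1 else - 1) B"
  with s show "B = (\<lambda>x. x - 2 *\<^sub>R neg_proj X x)"
    unfolding is_spectral_integral_def by (intro form_eq_imp_eq) auto
qed

lemma nu_minus_eq: "nu_minus X = ecdim (range (neg_proj X))"
  by (simp add: nu_minus_def neg_proj_def)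

end

section \<open>Dimensions and negative subspaces\<close>

lemma independent_bop_image:
  assumes A: "bop A" and V: "complex_vector.subspace V" and inj: "\<And>x. x \<in> V \<Longrightarrow> A x = 0 \<Longrightarrow> x = 0"
    and C: "C \<subseteq> V" "complex_vector.independent C"
  shows "complex_vector.independent (A ` C)" and "inj_on A C"
proof -
  interpret A: Vector_Spaces.linear scaleC scaleC A by (rule complex_linear_bop [OF A])
  have sp: "cspan C \<subseteq> V" using C(1) V by (rule complex_vector.span_minimal)
  have "inj_on A V" using inj by (simp add: A.inj_on_iff_eq_0 [OF V])
  then have "inj_on A (cspan C)" using sp by (rule inj_on_subset)
  then show "complex_vector.independent (A ` C)"
    using A.independent_injective_image [OF C(2)] by (simp add: cspan_def)
  show "inj_on A C" using \<open>inj_on A V\<close> C(1) by (rule inj_on_subset)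
qed

lemma bop_image_cspan: "bop A \<Longrightarrow> A ` cspan S = cspan (A ` S)"
proof -
  assume "bop A"
  then interpret A: Vector_Spaces.linear scaleC scaleC A by (rule complex_linear_bop)
  show ?thesis using A.span_image [of S] by (simp add: cspan_def)
qed

text \<open>The finite spanning set in \<open>ecdim\<close> may leave \<open>V\<close>; a basis
  inside \<open>V\<close> is extracted here once and for all.\<close>

lemma ecdim_cases:
  obtains (finite) B where "finite B" "B \<subseteq> V" "complex_vector.independent B" "V \<subseteq> cspan B" "ecdim V = enat (card B)"
  | (infinite) "ecdim V = \<infinity>" "\<And>B. finite B \<Longrightarrow> \<not> V \<subseteq> cspan B"
proof (cases "\<exists>B. finite B \<and> V \<subseteq> cspan B")
  case True
  then obtain B where B: "finite B" "V \<subseteq> cspan B" by blast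
  obtain C where C: "C \<subseteq> V" "complex_vector.independent C" "V \<subseteq> cspan C" "card C = cdim V"
    using complex_vector.basis_exists by blast
  have "finite C" using complex_vector.independent_span_bound [OF B(1) C(2)] C(1) B(2) by blast
  with C True show ?thesis by (intro finite [of C]) (simp_all add: ecdim_def)
next
  case False
  then show ?thesis by (intro infinite) (auto simp: ecdim_def)
qed

lemma ecdim_le_card: "finite B \<Longrightarrow> V \<subseteq> cspan B \<Longrightarrow> ecdim V \<le> enat (card B)"
  using complex_vector.dim_le_card [of V B] by (auto simp: ecdim_def)

lemma ecdim_ge_card:
  assumes C: "finite C" "C \<subseteq> V" "complex_vector.independent C"
  shows "enat (card C) \<le> ecdim V"
proof (cases rule: ecdim_cases [of V])
  case (finite B)
  then show ?thesis
    using complex_vector.independent_span_bound [OF finite(1) C(3)] C(2) by auto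
qed simp

text \<open>The device for comparing indices: injectivity on \<open>V\<close> will come from
  definiteness of a form, not from any inverse.\<close>

lemma ecdim_le_of_inj:
  assumes A: "bop A" and V: "complex_vector.subspace V" and inj: "\<And>x. x \<in> V \<Longrightarrow> A x = 0 \<Longrightarrow> x = 0"
    and W: "A ` V \<subseteq> W"
  shows "ecdim V \<le> ecdim W"
proof (cases rule: ecdim_cases [of W])
  case (finite B)
  obtain C where C: "C \<subseteq> V" "complex_vector.independent C" "V \<subseteq> cspan C" "card C = cdim V"
    using complex_vector.basis_exists by blast
  note im = independent_bop_image [OF A V inj C(1,2)]
  have "A ` C \<subseteq> cspan B" using C(1) W finite(4) by blast
  from complex_vector.independent_span_bound [OF finite(1) im(1) this]
  have "finite (A ` C)" "card (A ` C) \<le> card B" by auto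
  then have "finite C" "card C \<le> card B" using im(2) by (auto simp: finite_image_iff card_image)
  then show ?thesis using ecdim_le_card [OF _ C(3)] finite(5) by (metis enat_ord_simps(1) order_trans)
qed simp

lemma bop_inl: "bop (\<lambda>x. (x, 0))" and bop_inr: "bop (\<lambda>x. (0, x))"
  by (rule bop_Pair [OF bop_id bop_0], rule bop_Pair [OF bop_0 bop_id])

text \<open>A dependence relation is projected to one factor, where the vectors of the other factor
  become \<open>0\<close>; hence the harmless \<open>insert 0\<close>.\<close>

lemma independent_inl_inr:
  assumes B: "complex_vector.independent B" and C: "complex_vector.independent C"
  shows "complex_vector.independent ((\<lambda>x. (x, 0)) ` B \<union> (\<lambda>y. (0, y)) ` C)"
  unfolding complex_vector.dependent_def
proof safe
  let ?D = "(\<lambda>x. (x, 0)) ` B \<union> (\<lambda>y. (0, y)) ` C"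
  fix b assume b: "b \<in> B" and d: "(b, 0) \<in> cspan (?D - {(b, 0)})"
  have "b \<in> fst ` cspan (?D - {(b, 0)})" using d by (rule image_eqI [rotated]) simp
  also have "\<dots> = cspan (fst ` (?D - {(b, 0)}))" by (rule bop_image_cspan [OF bop_fst])
  also have "\<dots> \<subseteq> cspan (insert 0 (B - {b}))" by (rule complex_vector.span_mono) auto
  finally have "b \<in> cspan (B - {b})" by simp
  then show False using B b unfolding complex_vector.dependent_def by blast
next
  let ?D = "(\<lambda>x. (x, 0)) ` B \<union> (\<lambda>y. (0, y)) ` C"
  fix b assume b: "b \<in> C" and d: "(0, b) \<in> cspan (?D - {(0, b)})"
  have "b \<in> snd ` cspan (?D - {(0, b)})" using d by (rule image_eqI [rotated]) simp
  also have "\<dots> = cspan (snd ` (?D - {(0, b)}))" by (rule bop_image_cspan [OF bop_snd])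
  also have "\<dots> \<subseteq> cspan (insert 0 (C - {b}))" by (rule complex_vector.span_mono) auto
  finally have "b \<in> cspan (C - {b})" by simp
  then show False using C b unfolding complex_vector.dependent_def by blast
qed

lemma subspace_Times:
  "complex_vector.subspace V \<Longrightarrow> complex_vector.subspace W \<Longrightarrow> complex_vector.subspace (V \<times> W)"
  by (auto simp: complex_vector.subspace_def zero_prod_def)

lemma ecdim_Times:
  assumes V: "complex_vector.subspace V" and W: "complex_vector.subspace W"
  shows "ecdim (V \<times> W) = ecdim V + ecdim W"
proof -
  have leV: "ecdim V \<le> ecdim (V \<times> W)"
    by (rule ecdim_le_of_inj [OF bop_inl V]) (use W in \<open>auto simp: zero_prod_def complex_vector.subspace_0\<close>)
  have leW: "ecdim W \<le> ecdim (V \<times> W)"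
    by (rule ecdim_le_of_inj [OF bop_inr W]) (use V in \<open>auto simp: zero_prod_def complex_vector.subspace_0\<close>)
  show ?thesis
  proof (cases rule: ecdim_cases [of V])
    case infinite
    then show ?thesis using leV by simp
  next
    case (finite B)
    note B = this
    show ?thesis
    proof (cases rule: ecdim_cases [of W])
      case infinite
      then show ?thesis using leW by simp
    next
      case (finite C)
      let ?B = "(\<lambda>x. (x, 0)) ` B" and ?C = "(\<lambda>y. (0, y)) ` C"
      have fin: "finite (?B \<union> ?C)" using B finite by simp
      have ind: "complex_vector.independent (?B \<union> ?C)" by (rule independent_inl_inr [OF B(3) finite(3)])
      have sub: "?B \<union> ?C \<subseteq> V \<times> W"
        using B(2) finite(2) V W by (auto simp: complex_vector.subspace_0)
      have span: "V \<times> W \<subseteq> cspan (?B \<union> ?C)"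
      proof clarify
        fix v w assume "v \<in> V" "w \<in> W"
        then have "(v, 0) \<in> cspan ?B" "(0, w) \<in> cspan ?C"
          unfolding bop_image_cspan [OF bop_inl, symmetric] bop_image_cspan [OF bop_inr, symmetric]
          using B(4) finite(4) by auto
        then have "(v, 0) \<in> cspan (?B \<union> ?C)" "(0, w) \<in> cspan (?B \<union> ?C)"
          using complex_vector.span_mono [OF Un_upper1, of ?B ?C] complex_vector.span_mono [OF Un_upper2, of ?C ?B] by blast+
        then have "(v, 0) + (0, w) \<in> cspan (?B \<union> ?C)" by (rule complex_vector.span_add)
        then show "(v, w) \<in> cspan (?B \<union> ?C)" by simp
      qed
      have "?B \<inter> ?C = {}"
        using B(3) complex_vector.dependent_zero by auto
      then have "card (?B \<union> ?C) = card B + card C"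
        using B(1) finite(1) by (simp add: card_Un_disjoint card_image inj_on_def)
      then show ?thesis
        using ecdim_le_card [OF fin span] ecdim_ge_card [OF fin sub ind] B(5) finite(5) by auto
    qed
  qed
qed

section \<open>Bases that are orthonormal for a definite form\<close>

definition gram_family :: "('a::complex_inner \<Rightarrow> 'a) \<Rightarrow> 'a set \<Rightarrow> nat \<Rightarrow> (nat \<Rightarrow> 'a) \<Rightarrow> bool"
  where "gram_family Y N m f \<longleftrightarrow> (\<forall>i<m. f i \<in> N) \<and> (\<forall>i<m. \<forall>j<m. cinner (Y (f i)) (f j) = (if i = j then 1 else 0))"

lemma cinner_gram_sum:
  assumes Y: "bop Y" and f: "gram_family Y N m f" and j: "j < m"
  shows "cinner (Y (\<Sum>i<m. c i *\<^sub>C f i)) (f j) = c j"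
proof -
  have "cinner (Y (\<Sum>i<m. c i *\<^sub>C f i)) (f j) = (\<Sum>i<m. c i * cinner (Y (f i)) (f j))"
    by (simp add: bop_sum [OF Y] bop_scaleC [OF Y] cinner.sum_left cinner_scaleC_left)
  also have "\<dots> = (\<Sum>i<m. if i = j then c j else 0)"
    using f j by (intro sum.cong) (auto simp: gram_family_def)
  also have "\<dots> = c j" using j by simp
  finally show ?thesis .
qed

lemma gram_family_independent:
  assumes Y: "bop Y" and f: "gram_family Y N m f"
  shows "complex_vector.independent (f ` {..<m})" "inj_on f {..<m}"
proof -
  show inj: "inj_on f {..<m}"
  proof (rule inj_onI)
    fix i j assume ij: "i \<in> {..<m}" "j \<in> {..<m}" "f i = f j"
    have "cinner (Y (f i)) (f i) = 1" "cinner (Y (f i)) (f j) = (if i = j then 1 else 0)"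
      using f ij(1,2) by (auto simp: gram_family_def)
    then show "i = j" using ij(3) by (auto split: if_splits)
  qed
  show "complex_vector.independent (f ` {..<m})"
  proof (rule complex_vector.independent_if_scalars_zero)
    fix c x assume 0: "(\<Sum>x\<in>f ` {..<m}. c x *\<^sub>C x) = 0" and "x \<in> f ` {..<m}"
    then obtain j where j: "j < m" "x = f j" by auto
    have "(\<Sum>i<m. c (f i) *\<^sub>C f i) = 0" using 0 inj by (simp add: sum.reindex)
    then show "c x = 0" using cinner_gram_sum [OF Y f j(1), of "\<lambda>i. c (f i)"] j(2) by (simp add: bop_zero [OF Y])
  qed simp
qed

text \<open>Gram-Schmidt for the inner product given by \<open>Y\<close>, as a maximal orthonormal family.\<close>

lemma gram_basis_exists:
  assumes Y: "selfadjoint Y" and N: "complex_vector.subspace N" and dim: "ecdim N = enat n"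
    and pos: "\<And>x. x \<in> N \<Longrightarrow> x \<noteq> 0 \<Longrightarrow> 0 < Re (cinner (Y x) x)"
  shows "\<exists>f. gram_family Y N n f \<and> (\<forall>x\<in>N. x = (\<Sum>i<n. cinner (Y x) (f i) *\<^sub>C f i))"
proof -
  have bY: "bop Y" using Y by (rule selfadjoint_bop)
  have le: "m \<le> n" if "gram_family Y N m f" for m f
  proof -
    have "enat (card (f ` {..<m})) \<le> ecdim N"
      using that gram_family_independent [OF bY that] by (intro ecdim_ge_card) (auto simp: gram_family_def)
    then show ?thesis using gram_family_independent(2) [OF bY that] dim by (simp add: card_image)
  qed
  have "\<exists>m f. gram_family Y N m f \<and> (\<forall>m' f'. gram_family Y N m' f' \<longrightarrow> m' \<le> m)"
  proof -
    have "\<exists>f. gram_family Y N 0 f" by (simp add: gram_family_def)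
    then have "\<exists>m. (\<exists>f. gram_family Y N m f) \<and> (\<forall>m'. (\<exists>f. gram_family Y N m' f) \<longrightarrow> m' \<le> m)"
      by (rule ex_has_greatest_nat [where b = "Suc n" and f = "\<lambda>m. m"]) (use le in \<open>auto simp: less_Suc_eq_le\<close>)
    then show ?thesis by blast
  qed
  then obtain m f where f: "gram_family Y N m f" and max: "\<And>m' f'. gram_family Y N m' f' \<Longrightarrow> m' \<le> m"
    by blast
  have fN: "(\<Sum>i<m. c i *\<^sub>C f i) \<in> N" for c
    using f N by (intro complex_vector.subspace_sum complex_vector.subspace_scale) (auto simp: gram_family_def)
  have exp: "x = (\<Sum>i<m. cinner (Y x) (f i) *\<^sub>C f i)" if x: "x \<in> N" for x
  proof (rule ccontr)
    let ?s = "\<Sum>i<m. cinner (Y x) (f i) *\<^sub>C f i"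
    assume "x \<noteq> ?s"
    \<comment> \<open>A nonzero remainder of the expansion would, once normalised, extend the
      maximal family.\<close>
    define r where "r = x - ?s"
    have r: "r \<in> N" "r \<noteq> 0" using x fN N \<open>x \<noteq> ?s\<close> by (simp_all add: r_def complex_vector.subspace_diff)
    have r0: "cinner (Y r) (f j) = 0" if "j < m" for j
      using cinner_gram_sum [OF bY f that] by (simp add: r_def bop_diff [OF bY] cinner.diff_left)
    have r0': "cinner (Y (f j)) r = 0" if "j < m" for j
      using r0 [OF that] selfadjoint_cinner [OF Y, of "f j" r] cinner_commute [of "f j" "Y r"] by simp
    define q where "q = Re (cinner (Y r) r)"
    have q: "q > 0" "cinner (Y r) r = of_real q"
      using pos [OF r] selfadjoint_Re [OF Y, of r] by (simp_all add: q_def)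
    define e where "e = (1 / sqrt q) *\<^sub>R r"
    have ee: "cinner (Y e) e = 1"
      using q by (simp add: e_def bop_scaleR [OF bY] scaleR_cinner_left scaleR_cinner_right scaleR_conv_of_real flip: of_real_mult)
    have e0: "cinner (Y e) (f j) = 0" "cinner (Y (f j)) e = 0" if "j < m" for j
      using r0 [OF that] r0' [OF that] by (simp_all add: e_def bop_scaleR [OF bY] scaleR_cinner_left scaleR_cinner_right)
    have "e \<in> N" using r(1) N by (simp add: e_def subspace_imp_real subspace_scale)
    then have "gram_family Y N (Suc m) (f(m := e))"
      using f ee e0 by (auto simp: gram_family_def less_Suc_eq)
    from max [OF this] show False by simp
  qed
  have "m = n"
  proof (rule antisym)
    show "m \<le> n" by (rule le [OF f])
    have "N \<subseteq> cspan (f ` {..<m})"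
    proof
      fix x assume "x \<in> N"
      have "(\<Sum>i<m. cinner (Y x) (f i) *\<^sub>C f i) \<in> cspan (f ` {..<m})"
        by (intro complex_vector.span_sum complex_vector.span_scale complex_vector.span_base) simp
      then show "x \<in> cspan (f ` {..<m})" using exp [OF \<open>x \<in> N\<close>] by simp
    qed
    then have "ecdim N \<le> enat (card (f ` {..<m}))" by (intro ecdim_le_card) auto
    also have "\<dots> \<le> enat m" using card_image_le [of "{..<m}" f] by simp
    finally show "n \<le> m" using dim by simp
  qed
  with f exp show ?thesis by blast
qed

text \<open>Gram-Schmidt for \<open>- A\<close>, which is positive definite on the negative spectral
  subspace; hence the signs in the Gram matrix and in the expansion.\<close>

lemma negative_subspace_basis:
  fixes A :: "'a::chilbert_space \<Rightarrow> 'a"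
  assumes A: "selfadjoint A" and dim: "nu_minus A = enat n"
  obtains f where "\<And>i. i < n \<Longrightarrow> neg_proj A (f i) = f i"
    and "\<And>i j. i < n \<Longrightarrow> j < n \<Longrightarrow> cinner (A (f i)) (f j) = (if i = j then -1 else 0)"
    and "\<And>x. neg_proj A x = x \<Longrightarrow> x = (\<Sum>i<n. - cinner (A x) (f i) *\<^sub>C f i)"
proof -
  have P: "orth_projection (neg_proj A)" by (rule orth_projection_neg_proj [OF A])
  have N: "x \<in> range (neg_proj A) \<longleftrightarrow> neg_proj A x = x" for x
    using orth_projection_idem [OF P] by (metis rangeE rangeI)
  have Y: "selfadjoint (\<lambda>x. 0 - A x)" by (intro selfadjoint_sub selfadjoint_zero A)
  have "complex_vector.subspace (range (neg_proj A))"
    using P by (intro subspace_range) (simp add: orth_projection_def)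
  from gram_basis_exists [OF Y this dim [unfolded nu_minus_eq [OF A]]] neg_proj_form_neg [OF A]
  obtain f where f: "gram_family (\<lambda>x. 0 - A x) (range (neg_proj A)) n f"
    and exp: "\<forall>x\<in>range (neg_proj A). x = (\<Sum>i<n. cinner (0 - A x) (f i) *\<^sub>C f i)"
    by (auto simp: N cinner.minus_left)
  show ?thesis
  proof (rule that)
    show "neg_proj A (f i) = f i" if "i < n" for i using f that by (auto simp: gram_family_def N [symmetric])
    show "cinner (A (f i)) (f j) = (if i = j then -1 else 0)" if "i < n" "j < n" for i j
    proof -
      have "- cinner (A (f i)) (f j) = (if i = j then 1 else 0)"
        using f that by (simp add: gram_family_def cinner.minus_left)
      then show ?thesis by (simp add: minus_equation_iff split: if_splits)
    qed
    show "x = (\<Sum>i<n. - cinner (A x) (f i) *\<^sub>C f i)" if "neg_proj A x = x" for x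
    proof -
      have "x \<in> range (neg_proj A)" using that by (simp add: N)
      from bspec [OF exp this] show ?thesis unfolding diff_0 cinner.minus_left .
    qed
  qed
qed

section \<open>Factorisation\<close>

text \<open>
  Krein's lemma; the proof iterates the Cauchy-Schwarz inequality of the semi-inner product
  \<open>\<langle>A x, y\<rangle>\<close> along the powers \<open>K, K\<^sup>2, K\<^sup>4, \<dots>\<close>.
\<close>

lemma symmetrisable_form_bound:
  fixes A :: "'a::chilbert_space \<Rightarrow> 'a"
  assumes A: "positive_op A" and K: "bop K" and sym: "\<And>x y. cinner (A (K x)) y = cinner (A x) (K y)"
  shows "\<exists>c\<ge>0. \<forall>x. Re (cinner (A (K x)) x) \<le> c * Re (cinner (A x) x)"
proof -
  obtain k where k0: "k \<ge> 0" "\<And>x. norm (K x) \<le> k * norm x" using bop_bound [OF K] by blast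
  define c where "c = k + 1"
  have c: "c > 0" "norm (K x) \<le> c * norm x" for x
    using k0(1) k0(2)[of x] norm_ge_zero [of x] unfolding c_def distrib_right by linarith+
  obtain a where a: "a \<ge> 0" "\<And>x. norm (A x) \<le> a * norm x" using bop_bound [OF positive_op_bop [OF A]] by blast
  have pow: "norm ((K ^^ m) x) \<le> c ^ m * norm x" for m x
  proof (induction m)
    case (Suc m)
    have "norm (K ((K ^^ m) x)) \<le> c * norm ((K ^^ m) x)" by (rule c(2))
    also have "\<dots> \<le> c * (c ^ m * norm x)" using Suc c(1) by (intro mult_left_mono) auto
    finally show ?case by (simp add: mult_ac)
  qed simp
  have symp: "cinner (A ((K ^^ m) x)) y = cinner (A x) ((K ^^ m) y)" for m x y
  proof (induction m arbitrary: y)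
    case (Suc m)
    have "cinner (A ((K ^^ Suc m) x)) y = cinner (A ((K ^^ m) x)) (K y)" by (simp add: sym)
    also have "\<dots> = cinner (A x) ((K ^^ m) (K y))" by (rule Suc)
    finally show ?case by (simp add: funpow_swap1)
  qed simp
  have main: "Re (cinner (A (K x)) x) \<le> c * Re (cinner (A x) x)" for x
  proof (cases "Re (cinner (A (K x)) x) \<le> 0")
    case True
    then show ?thesis using c(1) positive_op_nonneg [OF A, of x] by (meson mult_nonneg_nonneg less_imp_le order_trans)
  next
    case False
    define t where "t = Re (cinner (A (K x)) x)"
    define q where "q = Re (cinner (A x) x)"
    have t: "t > 0" using False by (simp add: t_def)
    have q: "q > 0"
    proof (rule ccontr)
      assume "\<not> q > 0"
      then have "A x = 0" using positive_op_nonneg [OF A, of x] by (intro positive_op_zero [OF A]) (simp add: q_def)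
      then show False using t sym [of x x] by (simp add: t_def)
    qed
    \<comment> \<open>Doubling: Cauchy-Schwarz bounds the square of
      \<open>\<langle>A K^m x, x\<rangle>\<close> by
      \<open>q \<langle>A K^m x, K^m x\<rangle>\<close>, and symmetry moves the second power of
      \<open>K\<close> to the left.\<close>
    have step: "t ^ (2 ^ n) \<le> Re (cinner (A ((K ^^ (2 ^ n)) x)) x) * q ^ (2 ^ n - 1)" for n
    proof (induction n)
      case 0
      show ?case by (simp add: t_def)
    next
      case (Suc n)
      let ?m = "2 ^ n :: nat"
      let ?v = "(K ^^ ?m) x"
      have "t ^ (2 ^ Suc n) = (t ^ ?m)\<^sup>2" by (simp add: power_mult mult.commute flip: power_mult)
      also have "\<dots> \<le> (Re (cinner (A ?v) x) * q ^ (?m - 1))\<^sup>2"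
        using Suc t by (intro power_mono) auto
      also have "\<dots> = (Re (cinner (A ?v) x))\<^sup>2 * (q ^ (?m - 1))\<^sup>2" by (simp add: power_mult_distrib)
      also have "\<dots> \<le> (Re (cinner (A ?v) ?v) * q) * (q ^ (?m - 1))\<^sup>2"
        unfolding q_def by (intro mult_right_mono positive_op_Cauchy_Schwarz [OF A]) simp
      also have "cinner (A ?v) ?v = cinner (A ((K ^^ (2 ^ Suc n)) x)) x"
      proof -
        have "(K ^^ (2 ^ Suc n)) x = (K ^^ ?m) ?v" by (simp add: mult_2 funpow_add)
        then show ?thesis by (simp add: symp)
      qed
      also have "(Re \<dots> * q) * (q ^ (?m - 1))\<^sup>2 = Re (cinner (A ((K ^^ (2 ^ Suc n)) x)) x) * (q ^ (2 ^ Suc n - 1))"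
      proof -
        obtain l where "?m = Suc l" by (metis not0_implies_Suc power_not_zero zero_neq_numeral)
        then have "Suc ((?m - 1) * 2) = 2 ^ Suc n - 1" by simp
        then have "q * (q ^ (?m - 1))\<^sup>2 = q ^ (2 ^ Suc n - 1)" by (metis power_Suc power_mult)
        then show ?thesis by (simp only: mult.assoc)
      qed
      finally show ?case .
    qed
    \<comment> \<open>\<open>K^m\<close> is bounded by \<open>c^m\<close>, so all these powers stay
      below one constant; this excludes a base larger than \<open>1\<close>.\<close>
    have bound: "(t / (q * c)) ^ (2 ^ n) \<le> a * (norm x)\<^sup>2 / q" for n
    proof -
      let ?m = "2 ^ n :: nat"
      have qm: "q ^ ?m = q * q ^ (?m - 1)" by (metis power_minus_mult pos2 zero_less_power mult.commute)
      have "Re (cinner (A ((K ^^ ?m) x)) x) \<le> norm (A ((K ^^ ?m) x)) * norm x" using Re_cinner_le by (metis abs_le_D1)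
      also have "\<dots> \<le> a * (c ^ ?m * norm x) * norm x"
        using a pow [of ?m x] by (intro mult_right_mono order_trans [OF a(2)] mult_left_mono) auto
      finally have 1: "Re (cinner (A ((K ^^ ?m) x)) x) \<le> c ^ ?m * (a * (norm x)\<^sup>2)"
        by (simp add: power2_eq_square mult_ac)
      have "t ^ ?m \<le> (c ^ ?m * (a * (norm x)\<^sup>2)) * q ^ (?m - 1)"
        using q by (intro order_trans [OF step] mult_right_mono 1) simp
      then have "t ^ ?m * q \<le> (q * c) ^ ?m * (a * (norm x)\<^sup>2)"
        using q mult_right_mono [of "t ^ ?m" "(c ^ ?m * (a * (norm x)\<^sup>2)) * q ^ (?m - 1)" q]
        by (simp add: power_mult_distrib qm mult_ac)
      then show ?thesis using q c(1) by (simp add: power_divide divide_simps mult_ac)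
    qed
    have "t / (q * c) \<le> 1"
    proof (rule ccontr)
      assume "\<not> t / (q * c) \<le> 1"
      then have gt: "1 < t / (q * c)" by simp
      obtain n where n: "a * (norm x)\<^sup>2 / q < (t / (q * c)) ^ n" using real_arch_pow [OF gt] by blast
      have "(t / (q * c)) ^ n \<le> (t / (q * c)) ^ (2 ^ n)"
        using gt by (intro power_increasing) (auto intro: less_imp_le less_exp)
      with n bound [of n] show False by linarith
    qed
    then show ?thesis using q c(1) by (simp add: t_def q_def divide_simps mult_ac)
  qed
  then show ?thesis using c(1) by (intro exI [of _ c]) auto
qed

text \<open>The inequality makes \<open>D x \<mapsto> C x\<close> well defined and uniformly
  continuous on the range of \<open>D\<close>. It extends to the closure, and by zero to the
  orthogonal complement, which is what the clause with \<open>proj_onto\<close> records.\<close>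

lemma douglas_factorisation:
  fixes C :: "'a::chilbert_space \<Rightarrow> 'c::chilbert_space" and D :: "'a \<Rightarrow> 'b::chilbert_space"
  assumes C: "bop C" and D: "bop D" and k: "k \<ge> 0" "\<And>x. norm (C x) \<le> k * norm (D x)"
  shows "\<exists>R. bop R \<and> (\<forall>x. R (D x) = C x) \<and> (\<forall>y. R (proj_onto (closure (range D)) y) = R y) \<and>
    (\<forall>y. norm (R y) \<le> k * norm y) \<and> (\<forall>y. R y \<in> closure (range C))"
proof -
  let ?M = "closure (range D)"
  have M: "closed ?M" "complex_vector.subspace ?M"
    using subspace_closure [OF subspace_range [OF D]] by simp_all
  define f where "f y = C (SOME x. D x = y)" for y
  have f: "f (D x) = C x" for x
  proof -
    have "D (SOME z. D z = D x) = D x" by (rule someI) simp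
    then have "D ((SOME z. D z = D x) - x) = 0" by (simp add: bop_diff [OF D])
    then have "norm (C ((SOME z. D z = D x) - x)) \<le> 0" using k(2) [of "(SOME z. D z = D x) - x"] by simp
    then show ?thesis by (simp add: f_def bop_diff [OF C])
  qed
  have uc: "uniformly_continuous_on (range D) f"
    unfolding uniformly_continuous_on_def
  proof (intro allI impI)
    fix e :: real assume "e > 0"
    show "\<exists>d>0. \<forall>x\<in>range D. \<forall>x'\<in>range D. dist x' x < d \<longrightarrow> dist (f x') (f x) < e"
    proof (intro exI conjI ballI impI)
      \<comment> \<open>\<open>k + 1\<close> in place of \<open>k\<close>, which may be
        \<open>0\<close>.\<close>
      show "e / (k + 1) > 0" using \<open>e > 0\<close> k by simp
      fix u v assume uv: "u \<in> range D" "v \<in> range D" "dist v u < e / (k + 1)"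
      then obtain x y where xy: "u = D x" "v = D y" by blast
      have "dist (f v) (f u) = norm (C (y - x))" by (simp add: xy f dist_norm bop_diff [OF C])
      also have "\<dots> \<le> k * norm (D (y - x))" by (rule k)
      also have "\<dots> \<le> (k + 1) * dist v u" by (simp add: xy dist_norm bop_diff [OF D] mult_right_mono)
      also have "\<dots> < e" using uv(3) k by (simp add: field_simps)
      finally show "dist (f v) (f u) < e" .
    qed
  qed
  obtain g where gu: "uniformly_continuous_on ?M g" and g0: "\<And>x. x \<in> range D \<Longrightarrow> f x = g x"
    by (rule uniformly_continuous_on_extension_on_closure [OF uc]) (rule that)
  have gD: "g (D x) = C x" for x using g0 [of "D x"] f by simp
  have lim: "\<exists>X. (\<lambda>n. D (X n)) \<longlonglongrightarrow> y \<and> (\<lambda>n. C (X n)) \<longlonglongrightarrow> g y" if y: "y \<in> ?M" for y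
  proof -
    obtain Z where Z: "\<forall>n. Z n \<in> range D" "Z \<longlonglongrightarrow> y" using y unfolding closure_sequential by blast
    then have "\<forall>n. \<exists>x. Z n = D x" by blast
    then obtain X where X: "\<And>n. Z n = D (X n)" using choice [of "\<lambda>n x. Z n = D x"] by blast
    have "(\<lambda>n. g (Z n)) \<longlonglongrightarrow> g y"
      using uniformly_continuous_imp_continuous [OF gu] Z(2) y
      by (rule continuous_on_tendsto_compose) (rule always_eventually, use Z(1) closure_subset [of "range D"] in blast)
    moreover have "Z = (\<lambda>n. D (X n))" using X by auto
    ultimately show ?thesis using Z(2) by (auto simp: gD)
  qed
  have uniq: "z = g y" if "y \<in> ?M" "(\<lambda>n. D (X n)) \<longlonglongrightarrow> y" "(\<lambda>n. C (X n)) \<longlonglongrightarrow> z" for X y z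
  proof (rule LIMSEQ_unique [OF that(3)])
    show "(\<lambda>n. C (X n)) \<longlonglongrightarrow> g y"
      using continuous_on_tendsto_compose [OF uniformly_continuous_imp_continuous [OF gu] that(2,1)] closure_subset [of "range D"]
      by (simp add: gD subset_iff)
  qed
  define R where "R y = g (proj_onto ?M y)" for y
  note pM = proj_onto_in [OF M]
  note bP = selfadjoint_bop [OF selfadjoint_proj_onto [OF M]]
  have nR: "norm (R x) \<le> k * norm x" for x
  proof -
    obtain U where U: "(\<lambda>n. D (U n)) \<longlonglongrightarrow> proj_onto ?M x" "(\<lambda>n. C (U n)) \<longlonglongrightarrow> R x"
      unfolding R_def using lim [OF pM] by meson
    have "norm (R x) \<le> k * norm (proj_onto ?M x)"
      by (rule LIMSEQ_le [OF tendsto_norm [OF U(2)] tendsto_mult [OF tendsto_const tendsto_norm [OF U(1)]]])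
         (use k(2) in blast)
    also have "\<dots> \<le> k * norm x"
      by (intro mult_left_mono orth_projection_norm_le orth_projection_proj_onto [OF M] k)
    finally show ?thesis .
  qed
  have "bop R"
  proof (rule bopI [of _ k])
    show "R (x + y) = R x + R y" for x y
    proof -
      obtain U V where U: "(\<lambda>n. D (U n)) \<longlonglongrightarrow> proj_onto ?M x" "(\<lambda>n. C (U n)) \<longlonglongrightarrow> R x"
        and V: "(\<lambda>n. D (V n)) \<longlonglongrightarrow> proj_onto ?M y" "(\<lambda>n. C (V n)) \<longlonglongrightarrow> R y"
        unfolding R_def using lim [OF pM] by meson
      have "(\<lambda>n. D (U n + V n)) \<longlonglongrightarrow> proj_onto ?M (x + y)"
        using tendsto_add [OF U(1) V(1)] by (simp add: bop_add [OF D] bop_add [OF bP])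
      moreover have "(\<lambda>n. C (U n + V n)) \<longlonglongrightarrow> R x + R y"
        using tendsto_add [OF U(2) V(2)] by (simp add: bop_add [OF C])
      ultimately show ?thesis using uniq [OF pM] by (simp add: R_def)
    qed
    show "R (c *\<^sub>C x) = c *\<^sub>C R x" for c x
    proof -
      obtain U where U: "(\<lambda>n. D (U n)) \<longlonglongrightarrow> proj_onto ?M x" "(\<lambda>n. C (U n)) \<longlonglongrightarrow> R x"
        unfolding R_def using lim [OF pM] by meson
      have "(\<lambda>n. D (c *\<^sub>C U n)) \<longlonglongrightarrow> proj_onto ?M (c *\<^sub>C x)"
        using bounded_linear.tendsto [OF bounded_linear_scaleC U(1), of c] by (simp add: bop_scaleC [OF D] bop_scaleC [OF bP])
      moreover have "(\<lambda>n. C (c *\<^sub>C U n)) \<longlonglongrightarrow> c *\<^sub>C R x"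
        using bounded_linear.tendsto [OF bounded_linear_scaleC U(2), of c] by (simp add: bop_scaleC [OF C])
      ultimately show ?thesis using uniq [OF pM] by (simp add: R_def)
    qed
    show "norm (R x) \<le> k * norm x" for x by (rule nR)
  qed
  moreover have "\<forall>y. norm (R y) \<le> k * norm y" using nR by blast
  moreover have "R (D x) = C x" for x
  proof -
    have "D x \<in> ?M" by (rule subsetD [OF closure_subset rangeI])
    then show ?thesis by (simp add: R_def proj_onto_id [OF M] gD)
  qed
  moreover have "R (proj_onto ?M y) = R y" for y
    by (simp add: R_def proj_onto_id [OF M] pM)
  moreover have "R y \<in> closure (range C)" for y
  proof -
    obtain U where U: "(\<lambda>n. D (U n)) \<longlonglongrightarrow> proj_onto ?M y" "(\<lambda>n. C (U n)) \<longlonglongrightarrow> R y"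
      unfolding R_def using lim [OF pM] by meson
    then show ?thesis unfolding closure_sequential by (intro exI [of _ "\<lambda>n. C (U n)"]) simp
  qed
  ultimately show ?thesis by blast
qed

section \<open>Defect operators\<close>

lemma cinner_cnj_swap: "cinner x y = 0 \<Longrightarrow> cinner y (x::'a::complex_inner) = 0"
  by (subst cinner_commute) simp

lemma Re_cinner_scaleC_both: "Re (cinner (c *\<^sub>C x) (c *\<^sub>C y)) = (cmod c)\<^sup>2 * Re (cinner x (y::'a::complex_inner))"
proof -
  have "cinner (c *\<^sub>C x) (c *\<^sub>C y) = (c * cnj c) * cinner x y"
    by (simp add: cinner_scaleC_left cinner_scaleC_right)
  also have "c * cnj c = of_real ((cmod c)\<^sup>2)" by (rule complex_norm_square [symmetric])
  finally show ?thesis by simp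
qed

lemma selfadjoint_eq_0_on_closure_range:
  assumes D: "selfadjoint D" and "x \<in> closure (range D)" "D x = 0"
  shows "x = 0"
proof -
  have "closed {z. cinner z x = 0}"
    by (intro closed_Collect_eq continuous_on_const linear_continuous_on cinner.bounded_linear_left)
  moreover have "range D \<subseteq> {z. cinner z x = 0}"
    using assms(3) by (auto simp: selfadjoint_cinner [OF D])
  ultimately have "closure (range D) \<subseteq> {z. cinner z x = 0}" by (intro closure_minimal)
  then have "cinner x x = 0" using assms(2) by blast
  then show ?thesis by (simp add: cinner_self)
qed

text \<open>If \<open>A\<close> is the defect form of \<open>T\<close>, this is the defect operator,
  and the closure of its range is the defect space. What follows uses of \<open>A\<close> only that
  it is selfadjoint.\<close>

definition mod_root :: "('a::complex_inner \<Rightarrow> 'a) \<Rightarrow> 'a \<Rightarrow> 'a"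
  where "mod_root A = sqrt_op (abs_op A)"

definition mod_space :: "('a::complex_inner \<Rightarrow> 'a) \<Rightarrow> 'a set"
  where "mod_space A = closure (range (mod_root A))"

context
  fixes A :: "'a::chilbert_space \<Rightarrow> 'a"
  assumes A: "selfadjoint A"
begin

lemma bop_self: "bop A"
  using A by (rule selfadjoint_bop)

lemma selfadjoint_neg_proj: "selfadjoint (neg_proj A)"
  by (rule orth_projection_selfadjoint [OF orth_projection_neg_proj [OF A]])

lemma bop_neg_proj: "bop (neg_proj A)"
  by (rule selfadjoint_bop [OF selfadjoint_neg_proj])

lemma neg_proj_idem: "neg_proj A (neg_proj A x) = neg_proj A x"
  by (rule orth_projection_idem [OF orth_projection_neg_proj [OF A]])

lemma selfadjoint_sign: "selfadjoint (sign_op A)"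
  unfolding sign_op_eq [OF A] by (intro selfadjoint_sub selfadjoint_id selfadjoint_scaleR selfadjoint_neg_proj)

lemma bop_sign: "bop (sign_op A)"
  by (rule selfadjoint_bop [OF selfadjoint_sign])

lemma sign_sign: "sign_op A (sign_op A x) = x"
  by (simp add: sign_op_eq [OF A] scaleR_2 bop_diff [OF bop_neg_proj] bop_add [OF bop_neg_proj] neg_proj_idem)

lemma sign_commute: "sign_op A (A x) = A (sign_op A x)"
  by (simp add: sign_op_eq [OF A] bop_diff [OF bop_self] bop_scaleR [OF bop_self] neg_proj_commute [OF A])

lemma form_split_neg_proj:
  "Re (cinner (A x) x) = Re (cinner (A (neg_proj A x)) (neg_proj A x)) + Re (cinner (A (x - neg_proj A x)) (x - neg_proj A x))"
proof -
  have "cinner (A (neg_proj A x)) (x - neg_proj A x) = 0"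
    by (simp add: neg_proj_commute [OF A] selfadjoint_cinner [OF selfadjoint_neg_proj]
        bop_diff [OF bop_neg_proj] neg_proj_idem)
  then show ?thesis using selfadjoint_form_add [OF A, of "neg_proj A x" "x - neg_proj A x"] by simp
qed

lemma neg_proj_form_nonpos: "Re (cinner (A (neg_proj A x)) (neg_proj A x)) \<le> 0"
  using neg_proj_form_neg [OF A, of "neg_proj A x"] neg_proj_idem [of x]
  by (cases "neg_proj A x = 0") (auto simp: bop_zero [OF bop_self])

lemma compl_form_nonneg: "0 \<le> Re (cinner (A (x - neg_proj A x)) (x - neg_proj A x))"
  by (rule neg_proj_form_nonneg [OF A]) (simp add: bop_diff [OF bop_neg_proj] neg_proj_idem)

text \<open>The polar decomposition. \<open>A\<close> commutes with its negative projection, is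
  negative on the range of it and nonnegative on the complement, so flipping the sign there gives a
  positive root of \<open>A A\<close>.\<close>

lemma abs_op_eq: "abs_op A = (\<lambda>x. A (sign_op A x))"
proof (rule abs_op_eqI [OF A])
  show "A (sign_op A (A (sign_op A x))) = A (A x)" for x by (simp add: sign_commute sign_sign)
  show "positive_op (\<lambda>x. A (sign_op A x))"
  proof (rule positive_opI)
    show "selfadjoint (\<lambda>x. A (sign_op A x))"
      by (rule selfadjoint_compose [OF A selfadjoint_sign]) (simp add: sign_commute)
    fix x
    let ?p = "neg_proj A x" and ?q = "x - neg_proj A x"
    have 0: "cinner (A ?p) ?q = 0"
      by (simp add: neg_proj_commute [OF A] selfadjoint_cinner [OF selfadjoint_neg_proj]
          bop_diff [OF bop_neg_proj] neg_proj_idem)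
    then have 1: "cinner (A ?q) ?p = 0"
      unfolding selfadjoint_cinner [OF A, of ?q] by (rule cinner_cnj_swap)
    have "sign_op A x = ?q - ?p" by (simp add: sign_op_eq [OF A] scaleR_2)
    then have "cinner (A (sign_op A x)) x = cinner (A (?q - ?p)) (?p + ?q)" by simp
    also have "\<dots> = cinner (A ?q) ?q - cinner (A ?p) ?p"
      unfolding bop_diff [OF bop_self, of ?q ?p] cinner.diff_left cinner_add_right 0 1 by simp
    finally show "0 \<le> Re (cinner (A (sign_op A x)) x)"
      using neg_proj_form_nonpos [of x] compl_form_nonneg [of x] by simp
  qed
qed

lemma positive_mod_root: "positive_op (mod_root A)"
  unfolding mod_root_def by (rule positive_sqrt_op [OF positive_abs_op [OF A]])

lemma selfadjoint_mod_root: "selfadjoint (mod_root A)"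
  by (rule positive_op_selfadjoint [OF positive_mod_root])

lemma bop_mod_root: "bop (mod_root A)"
  by (rule selfadjoint_bop [OF selfadjoint_mod_root])

lemma mod_root_mod_root: "mod_root A (mod_root A x) = A (sign_op A x)"
  unfolding mod_root_def by (subst sqrt_op_sqrt_op [OF positive_abs_op [OF A]]) (simp add: abs_op_eq)

lemma mod_root_commute:
  assumes C: "bop C" "\<And>x. C (A x) = A (C x)"
  shows "C (mod_root A x) = mod_root A (C x)"
  unfolding mod_root_def
  by (rule sqrt_op_commute [OF positive_abs_op [OF A] C(1)]) (rule abs_op_commute [OF A C])

lemma sign_mod_root: "sign_op A (mod_root A x) = mod_root A (sign_op A x)"
  by (rule mod_root_commute [OF bop_sign sign_commute])

lemma neg_proj_mod_root: "neg_proj A (mod_root A x) = mod_root A (neg_proj A x)"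
  by (rule mod_root_commute [OF bop_neg_proj]) (simp add: neg_proj_commute [OF A])

lemma mod_root_sign_mod_root: "mod_root A (sign_op A (mod_root A x)) = A x"
  by (simp add: sign_mod_root mod_root_mod_root sign_sign)

lemma sign_form_mod_root: "cinner (sign_op A (mod_root A x)) (mod_root A y) = cinner (A x) y"
  by (simp add: mod_root_sign_mod_root flip: selfadjoint_cinner [OF selfadjoint_mod_root])

lemma mod_space: "closed (mod_space A)" "complex_vector.subspace (mod_space A)"
  unfolding mod_space_def using subspace_closure [OF subspace_range [OF bop_mod_root]] by simp_all

lemma mod_root_in_mod_space: "mod_root A x \<in> mod_space A"
  unfolding mod_space_def by (rule subsetD [OF closure_subset rangeI])

lemma mod_root_proj: "mod_root A (proj_onto (mod_space A) x) = mod_root A x"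
proof (rule cinner_eqI)
  fix y
  have "cinner y (mod_root A (proj_onto (mod_space A) x)) = cinner (mod_root A y) (proj_onto (mod_space A) x)"
    by (rule selfadjoint_cinner [OF selfadjoint_mod_root, symmetric])
  also have "\<dots> = cinner (mod_root A y) x"
    by (rule proj_onto_cinner [OF mod_space mod_root_in_mod_space])
  also have "\<dots> = cinner y (mod_root A x)"
    by (rule selfadjoint_cinner [OF selfadjoint_mod_root])
  finally show "cinner y (mod_root A (proj_onto (mod_space A) x)) = cinner y (mod_root A x)" .
qed

lemma mod_root_eq_0_on_mod_space: "x \<in> mod_space A \<Longrightarrow> mod_root A x = 0 \<Longrightarrow> x = 0"
  unfolding mod_space_def by (rule selfadjoint_eq_0_on_closure_range [OF selfadjoint_mod_root])

lemma sign_in_mod_space: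
  assumes "x \<in> mod_space A" shows "sign_op A x \<in> mod_space A"
proof -
  have "sign_op A ` closure (range (mod_root A)) \<subseteq> closure (range (mod_root A))"
  proof (rule image_closure_subset)
    show "sign_op A ` range (mod_root A) \<subseteq> closure (range (mod_root A))"
      using mod_root_in_mod_space unfolding mod_space_def by (auto simp: sign_mod_root)
  qed (simp_all add: bop_continuous_on [OF bop_sign])
  then show ?thesis using assms unfolding mod_space_def by blast
qed

lemma sign_proj: "sign_op A (proj_onto (mod_space A) x) = proj_onto (mod_space A) (sign_op A x)"
  by (rule proj_onto_commute [OF mod_space selfadjoint_sign sign_in_mod_space])

lemma sign_form: "Re (cinner (sign_op A x) x) = (norm (x - neg_proj A x))\<^sup>2 - (norm (neg_proj A x))\<^sup>2"
proof -
  have "Re (cinner (sign_op A x) x) = (norm x)\<^sup>2 - 2 * (norm (neg_proj A x))\<^sup>2"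
    by (simp add: sign_op_eq [OF A] cinner.diff_left scaleR_cinner_left cinner_self
        orth_projection_form [OF orth_projection_neg_proj [OF A]])
  then show ?thesis using orth_projection_pythagoras [OF orth_projection_neg_proj [OF A], of x] by simp
qed

lemma range_neg_proj_iff: "x \<in> range (neg_proj A) \<longleftrightarrow> neg_proj A x = x"
  using neg_proj_idem by (metis rangeE rangeI)

lemma subspace_range_neg_proj: "complex_vector.subspace (range (neg_proj A))"
  by (rule subspace_range [OF bop_neg_proj])

end

section \<open>Counting negative squares of a form\<close>

text \<open>\<open>G\<close> is negative on \<open>N\<close> enlarged by \<open>z\<close> and
  nonnegative on the kernel of \<open>\<Phi>\<close>, so \<open>\<Phi>\<close> embeds a space of
  dimension \<open>k + 1\<close> in \<open>W\<close>. The domain is the product of \<open>N\<close>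
  and the line through \<open>z\<close>; that \<open>z\<close> is independent of the image of
  \<open>N\<close> need not be checked separately.\<close>

lemma no_extra_negative:
  fixes N :: "'n::complex_inner set" and \<iota> :: "'n \<Rightarrow> 'v::complex_inner" and \<Phi> :: "'v \<Rightarrow> 'w::complex_inner"
  assumes N: "complex_vector.subspace N" "ecdim N = enat k" and \<iota>: "bop \<iota>" and \<Phi>: "bop \<Phi>"
    and neg: "\<And>n c. n \<in> N \<Longrightarrow> n \<noteq> 0 \<or> c \<noteq> 0 \<Longrightarrow> G (\<iota> n + c *\<^sub>C z) < (0::real)"
    and nonneg: "\<And>x. \<Phi> x = 0 \<Longrightarrow> 0 \<le> G x"
    and W: "range \<Phi> \<subseteq> W" "ecdim W \<le> enat k"
  shows False
proof -
  have 0: "0 \<in> N" using N(1) by (rule complex_vector.subspace_0)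
  \<comment> \<open>For \<open>z = 0\<close> the case \<open>n = 0\<close>, \<open>c = 1\<close>
    would make \<open>G\<close> negative at \<open>0\<close>, which lies in the kernel of
    \<open>\<Phi>\<close>.\<close>
  have z: "z \<noteq> 0"
  proof
    assume "z = 0"
    then have "G 0 < 0" using neg [OF 0, of 1] by (simp add: bop_zero [OF \<iota>])
    then show False using nonneg [of 0] by (simp add: bop_zero [OF \<Phi>])
  qed
  have "ecdim (N \<times> cspan {z}) \<le> ecdim W"
  proof (rule ecdim_le_of_inj)
    show "bop (\<lambda>p. \<Phi> (\<iota> (fst p) + snd p))"
      by (rule bop_compose [OF \<Phi> bop_plus [OF bop_compose [OF \<iota> bop_fst] bop_snd]])
    show "complex_vector.subspace (N \<times> cspan {z})"
      by (rule subspace_Times [OF N(1) complex_vector.subspace_span])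
    fix p assume p: "p \<in> N \<times> cspan {z}" "\<Phi> (\<iota> (fst p) + snd p) = 0"
    then have "snd p \<in> cspan {z}" by auto
    then obtain c where c: "snd p = c *\<^sub>C z" unfolding complex_vector.span_singleton by blast
    have "\<not> (fst p \<noteq> 0 \<or> c \<noteq> 0)"
      using neg [of "fst p" c] nonneg [OF p(2)] p(1) c by (auto simp: mem_Times_iff)
    then show "p = 0" using c by (simp add: prod_eq_iff)
  qed (use W(1) in auto)
  then have "ecdim N + ecdim (cspan {z}) \<le> enat k"
    using W(2) by (simp add: ecdim_Times [OF N(1) complex_vector.subspace_span])
  moreover have "enat 1 \<le> ecdim (cspan {z})"
    using ecdim_ge_card [of "{z}" "cspan {z}"] z complex_vector.span_superset [of "{z}"] by simp
  ultimately have "enat k + enat 1 \<le> enat k" using N(2) by (metis add_left_mono order_trans)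
  then show False by simp
qed

text \<open>
  The hypotheses say that \<open>A - C\<^sup>* J C\<close> has at most \<open>\<nu>\<^sub>-(A) - \<nu>\<^sub>-(J)\<close> negative squares; the form
  \<open>\<langle>A x, x\<rangle> + 2 Re \<langle>C x, y\<rangle> + \<langle>J y, y\<rangle>\<close> then has at most \<open>\<nu>\<^sub>-(A)\<close> of them, hence it is
  nonnegative on the orthogonal complement, with respect to this form, of the negative subspace of \<open>A\<close>.
\<close>

lemma factor_bound:
  fixes A :: "'a::chilbert_space \<Rightarrow> 'a" and J :: "'b::chilbert_space \<Rightarrow> 'b"
    and C :: "'a \<Rightarrow> 'b" and X :: "'v::chilbert_space \<Rightarrow> 'v"
  assumes A: "selfadjoint A" and J: "selfadjoint J" "\<And>y. J (J y) = y" and C: "bop C"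
    and X: "selfadjoint X" and \<iota>: "bop \<iota>"
    and X\<iota>: "\<And>x. Re (cinner (X (\<iota> x)) (\<iota> x)) = Re (cinner (A x) x) - Re (cinner (J (C x)) (C x))"
    and fin: "nu_minus A = enat k" and le: "nu_minus X + nu_minus J \<le> enat k"
  shows "\<exists>K\<ge>0. \<forall>x. norm (C x) \<le> K * norm (mod_root A x)"
proof -
  let ?P = "neg_proj A" and ?D = "mod_root A"
  note bP = bop_neg_proj [OF A] and bA = selfadjoint_bop [OF A] and bJ = selfadjoint_bop [OF J(1)]
  obtain f where f: "\<And>i. i < k \<Longrightarrow> ?P (f i) = f i"
    and ff: "\<And>i j. i < k \<Longrightarrow> j < k \<Longrightarrow> cinner (A (f i)) (f j) = (if i = j then -1 else 0)"
    and exp: "\<And>x. ?P x = x \<Longrightarrow> x = (\<Sum>i<k. - cinner (A x) (f i) *\<^sub>C f i)"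
    by (rule negative_subspace_basis [OF A fin]) (rule that)
  define G where "G p = Re (cinner (A (fst p)) (fst p)) + 2 * Re (cinner (C (fst p)) (snd p)) + Re (cinner (J (snd p)) (snd p))"
    for p :: "'a \<times> 'b"
  \<comment> \<open>Completing the square in the second variable turns \<open>G\<close> into the sum
    of the forms of \<open>X\<close> and \<open>J\<close>, whose negative squares are counted in
    \<open>le\<close>.\<close>
  have G_eq: "G p = Re (cinner (X (\<iota> (fst p))) (\<iota> (fst p))) + Re (cinner (J (snd p + J (C (fst p)))) (snd p + J (C (fst p))))" for p
  proof -
    have "Re (cinner (snd p) (C (fst p))) = Re (cinner (C (fst p)) (snd p))" by (rule Re_cinner_commute)
    then show ?thesis
      unfolding selfadjoint_form_add [OF J(1)] G_def X\<iota>
      using selfadjoint_cinner [OF J(1), of "snd p" "J (C (fst p))"] Re_cinner_commute [of "C (fst p)" "J (C (fst p))"]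
      by (simp add: J(2))
  qed
  define \<Phi> where "\<Phi> p = (neg_proj X (\<iota> (fst p)), neg_proj J (snd p + J (C (fst p))))" for p
  have b\<Phi>: "bop \<Phi>"
    unfolding \<Phi>_def [abs_def]
    by (intro bop_Pair bop_compose [OF bop_neg_proj [OF X] bop_compose [OF \<iota> bop_fst]]
        bop_compose [OF bop_neg_proj [OF J(1)]] bop_plus bop_snd bop_compose [OF bJ bop_compose [OF C bop_fst]])
  have nonneg: "0 \<le> G p" if "\<Phi> p = 0" for p
    using that neg_proj_form_nonneg [OF X, of "\<iota> (fst p)"] neg_proj_form_nonneg [OF J(1), of "snd p + J (C (fst p))"]
    by (simp add: G_eq \<Phi>_def zero_prod_def)
  have W: "range \<Phi> \<subseteq> range (neg_proj X) \<times> range (neg_proj J)" by (auto simp: \<Phi>_def)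
  have Wk: "ecdim (range (neg_proj X) \<times> range (neg_proj J)) \<le> enat k"
    using le by (simp add: ecdim_Times subspace_range_neg_proj X J(1) nu_minus_eq)
  \<comment> \<open>This vector of the negative subspace of \<open>A\<close> solves
    \<open>\<langle>A m, n y\<rangle> = - \<langle>C m, y\<rangle>\<close> for all \<open>m\<close>
    there, so \<open>(n y, y)\<close> is orthogonal to that subspace with respect to
    \<open>G\<close>.\<close>
  define n where "n y = (\<Sum>i<k. cinner y (C (f i)) *\<^sub>C f i)" for y
  have Pn: "?P (n y) = n y" for y
    by (simp add: n_def bop_sum [OF bP] bop_scaleC [OF bP] f)
  have An: "cinner (A m) (n y) + cinner (C m) y = 0" if m: "?P m = m" for m y
  proof -
    define b where "b i = - cinner (A m) (f i)" for i
    have mb: "m = (\<Sum>i<k. b i *\<^sub>C f i)" using exp [OF m] by (simp add: b_def)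
    have "cinner (A (f i)) (n y) = - cinner (C (f i)) y" if i: "i < k" for i
    proof -
      have "cinner (A (f i)) (n y) = (\<Sum>j<k. cnj (cinner y (C (f j))) * cinner (A (f i)) (f j))"
        by (simp add: n_def cinner.sum_right cinner_scaleC_right)
      also have "\<dots> = (\<Sum>j<k. if j = i then - cnj (cinner y (C (f i))) else 0)"
        using i by (intro sum.cong) (auto simp: ff)
      also have "\<dots> = - cinner (C (f i)) y" using i cinner_commute [of "C (f i)" y] by simp
      finally show ?thesis .
    qed
    then have "cinner (A m) (n y) = - cinner (C m) y"
      by (subst (1 2) mb) (simp add: bop_sum [OF bA] bop_sum [OF C] bop_scaleC [OF bA] bop_scaleC [OF C]
          cinner.sum_left cinner_scaleC_left sum_negf)
    then show ?thesis by simp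
  qed
  \<comment> \<open>A negative value would add a direction to the negative subspace of
    \<open>A\<close>, orthogonal to it for \<open>G\<close>; there is no room for
    \<open>k + 1\<close> of them.\<close>
  have Gz: "0 \<le> G (x + n y, y)" if Px: "?P x = 0" for x y
  proof (rule ccontr)
    assume "\<not> 0 \<le> G (x + n y, y)"
    then have Gneg: "G (x + n y, y) < 0" by simp
    show False
    proof (rule no_extra_negative [where N = "range ?P" and \<iota> = "\<lambda>m. (m, 0)" and \<Phi> = \<Phi> and G = G
          and z = "(x + n y, y)", OF subspace_range_neg_proj [OF A] fin [unfolded nu_minus_eq [OF A]] bop_inl b\<Phi> _ nonneg W Wk])
      fix m and c :: complex assume m: "m \<in> range ?P" and mc: "m \<noteq> 0 \<or> c \<noteq> 0"
      have Pm: "?P m = m" using m range_neg_proj_iff [OF A] by blast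
      have Ax: "cinner (A m) x = 0"
      proof -
        have "cinner (A m) x = cinner (A (?P m)) x" by (simp add: Pm)
        also have "\<dots> = cinner (A m) (?P x)"
          by (simp add: neg_proj_commute [OF A] selfadjoint_cinner [OF selfadjoint_neg_proj [OF A]])
        finally show ?thesis by (simp add: Px)
      qed
      have cross: "cinner (A m) (c *\<^sub>C (x + n y)) + cinner (C m) (c *\<^sub>C y) = 0"
      proof -
        have "cinner (A m) (c *\<^sub>C (x + n y)) + cinner (C m) (c *\<^sub>C y) = cnj c * (cinner (A m) x + (cinner (A m) (n y) + cinner (C m) y))"
          by (simp add: cinner_scaleC_right cinner_add_right algebra_simps)
        then show ?thesis by (simp add: Ax An [OF Pm])
      qed
      have "G ((m, 0) + c *\<^sub>C (x + n y, y)) = Re (cinner (A m) m) + (cmod c)\<^sup>2 * G (x + n y, y)"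
      proof -
        have "G ((m, 0) + c *\<^sub>C (x + n y, y)) = Re (cinner (A m) m)
          + 2 * Re (cinner (A m) (c *\<^sub>C (x + n y)) + cinner (C m) (c *\<^sub>C y))
          + (Re (cinner (A (c *\<^sub>C (x + n y))) (c *\<^sub>C (x + n y))) + 2 * Re (cinner (C (c *\<^sub>C (x + n y))) (c *\<^sub>C y)) + Re (cinner (J (c *\<^sub>C y)) (c *\<^sub>C y)))"
          by (simp add: G_def selfadjoint_form_add [OF A] bop_add [OF C] cinner_add_left)
        also have "\<dots> = Re (cinner (A m) m) + (cmod c)\<^sup>2 * G (x + n y, y)"
          unfolding cross G_def bop_scaleC [OF bA] bop_scaleC [OF C] bop_scaleC [OF bJ] Re_cinner_scaleC_both
          by (simp add: algebra_simps)
        finally show ?thesis .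
      qed
      moreover have "Re (cinner (A m) m) \<le> 0" "m \<noteq> 0 \<Longrightarrow> Re (cinner (A m) m) < 0"
        using neg_proj_form_nonpos [OF A, of m] neg_proj_form_neg [OF A Pm] by (simp_all add: Pm)
      moreover have "(cmod c)\<^sup>2 * G (x + n y, y) \<le> 0" "c \<noteq> 0 \<Longrightarrow> (cmod c)\<^sup>2 * G (x + n y, y) < 0"
        using Gneg by (auto simp: mult_le_0_iff mult_less_0_iff)
      ultimately show "G ((m, 0) + c *\<^sub>C (x + n y, y)) < 0"
        using mc by fastforce
    qed
  qed
  obtain cC where cC: "cC \<ge> 0" "\<And>x. norm (C x) \<le> cC * norm x" using bop_bound [OF C] by blast
  obtain cJ where cJ: "cJ \<ge> 0" "\<And>x. norm (J x) \<le> cJ * norm x" using bop_bound [OF bJ] by blast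
  define s where "s = (\<Sum>i<k. norm (C (f i)) * norm (f i))"
  have s0: "s \<ge> 0" by (simp add: s_def sum_nonneg)
  have ns: "norm (n y) \<le> norm y * s" for y
  proof -
    have "norm (n y) \<le> (\<Sum>i<k. norm (cinner y (C (f i)) *\<^sub>C f i))" unfolding n_def by (rule norm_sum)
    also have "\<dots> \<le> (\<Sum>i<k. norm y * (norm (C (f i)) * norm (f i)))"
      by (intro sum_mono) (simp add: norm_scaleC mult.assoc [symmetric] mult_right_mono norm_cinner_le)
    finally show ?thesis by (simp add: s_def sum_distrib_left)
  qed
  \<comment> \<open>Bounds the terms quadratic in \<open>y\<close> after \<open>n y\<close> has been
    inserted; the form of \<open>A\<close> at \<open>n y\<close> is nonpositive and drops out. The
    summand \<open>1\<close> makes \<open>c0\<close> positive.\<close>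
  define c0 where "c0 = 2 * (cC * s) + cJ + 1"
  have c0: "c0 > 0" using s0 cC(1) cJ(1) by (simp add: c0_def add_nonneg_pos)
  have low: "0 \<le> Re (cinner (A x) x) + 2 * Re (cinner (C x) y) + c0 * (norm y)\<^sup>2" if Px: "?P x = 0" for x y
  proof -
    have "cinner (A (n y)) x = cinner (A (n y)) (?P x)"
    proof -
      have "cinner (A (?P (n y))) x = cinner (A (n y)) (?P x)"
        by (simp add: neg_proj_commute [OF A] selfadjoint_cinner [OF selfadjoint_neg_proj [OF A]])
      then show ?thesis by (simp add: Pn)
    qed
    then have x0: "Re (cinner (A x) (n y)) = 0"
      using Px selfadjoint_cinner [OF A, of x "n y"] Re_cinner_commute [of x "A (n y)"] by simp
    have "0 \<le> G (x + n y, y)" by (rule Gz [OF Px])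
    also have "\<dots> = Re (cinner (A x) x) + Re (cinner (A (n y)) (n y)) + 2 * Re (cinner (C x) y)
        + 2 * Re (cinner (C (n y)) y) + Re (cinner (J y) y)"
      by (simp add: G_def selfadjoint_form_add [OF A] x0 bop_add [OF C] cinner_add_left)
    also have "Re (cinner (A (n y)) (n y)) \<le> 0"
      using neg_proj_form_nonpos [OF A, of "n y"] by (simp add: Pn)
    also have "Re (cinner (C (n y)) y) \<le> cC * s * (norm y)\<^sup>2"
    proof -
      have "Re (cinner (C (n y)) y) \<le> norm (C (n y)) * norm y" using Re_cinner_le [of "C (n y)" y] by linarith
      also have "\<dots> \<le> cC * (norm y * s) * norm y"
        by (intro mult_right_mono order_trans [OF cC(2)] mult_left_mono ns cC(1)) simp
      finally show ?thesis by (simp add: power2_eq_square mult_ac)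
    qed
    also have "Re (cinner (J y) y) \<le> cJ * (norm y)\<^sup>2"
    proof -
      have "Re (cinner (J y) y) \<le> norm (J y) * norm y" using Re_cinner_le [of "J y" y] by linarith
      also have "\<dots> \<le> cJ * norm y * norm y" by (intro mult_right_mono cJ(2)) simp
      finally show ?thesis by (simp add: power2_eq_square mult_ac)
    qed
    finally have "0 \<le> Re (cinner (A x) x) + 2 * Re (cinner (C x) y) + (2 * (cC * s) + cJ) * (norm y)\<^sup>2"
      by (simp add: algebra_simps)
    also have "\<dots> \<le> Re (cinner (A x) x) + 2 * Re (cinner (C x) y) + c0 * (norm y)\<^sup>2"
      by (simp add: c0_def algebra_simps)
    finally show ?thesis .
  qed
  have on_compl: "norm (C x) \<le> sqrt c0 * norm (?D x)" if Px: "?P x = 0" for x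
  proof -
    \<comment> \<open>The minimiser in \<open>y\<close> of the right-hand side of
      \<open>low\<close>.\<close>
    let ?y = "(- 1 / c0) *\<^sub>R C x"
    have "0 \<le> Re (cinner (A x) x) - (norm (C x))\<^sup>2 / c0"
    proof -
      have "c0 * (norm ?y)\<^sup>2 = (norm (C x))\<^sup>2 / c0"
        using c0 by (simp add: power_mult_distrib power_divide power2_eq_square)
      moreover have "Re (cinner (C x) ?y) = - ((norm (C x))\<^sup>2 / c0)"
        by (simp add: scaleR_cinner_right cinner_self cinner.minus_right)
      ultimately show ?thesis using low [OF Px, of ?y] by simp
    qed
    moreover have "Re (cinner (A x) x) = (norm (?D x))\<^sup>2"
    proof -
      have "sign_op A x = x" by (simp add: sign_op_eq [OF A] Px)
      then have "cinner (?D x) (?D x) = cinner (A x) x" using sign_form_mod_root [OF A, of x x]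
        by (simp add: sign_mod_root [OF A])
      then show ?thesis by (simp add: cinner_self flip: of_real_power) (metis Re_complex_of_real)
    qed
    ultimately have "(norm (C x))\<^sup>2 \<le> c0 * (norm (?D x))\<^sup>2" using c0 by (simp add: field_simps)
    also have "\<dots> = (sqrt c0 * norm (?D x))\<^sup>2" using c0 by (simp add: power_mult_distrib)
    finally show ?thesis by (rule power2_le_imp_le) (use c0 in simp)
  qed
  \<comment> \<open>On the finite-dimensional negative subspace \<open>D\<close> is bounded below:
    the coefficients of \<open>m\<close> are the inner products of \<open>D m\<close> with the fixed
    vectors \<open>D (sign_op A (f i))\<close>, up to sign.\<close>
  define r where "r = (\<Sum>i<k. norm (?D (sign_op A (f i))) * norm (f i))"
  have r0: "r \<ge> 0" by (simp add: r_def sum_nonneg)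
  have on_neg: "norm m \<le> norm (?D m) * r" if Pm: "?P m = m" for m
  proof -
    have "norm m = norm (\<Sum>i<k. - cinner (A m) (f i) *\<^sub>C f i)" using exp [OF Pm] by simp
    also have "\<dots> \<le> (\<Sum>i<k. norm (- cinner (A m) (f i) *\<^sub>C f i))" by (rule norm_sum)
    also have "\<dots> \<le> (\<Sum>i<k. norm (?D m) * (norm (?D (sign_op A (f i))) * norm (f i)))"
    proof (rule sum_mono)
      fix i
      have "cinner (A m) (f i) = cinner (?D m) (?D (sign_op A (f i)))"
        using sign_form_mod_root [OF A, of m "f i"] selfadjoint_cinner [OF selfadjoint_sign [OF A], of "?D m" "?D (f i)"]
        by (simp only: sign_mod_root [OF A])
      then show "norm (- cinner (A m) (f i) *\<^sub>C f i) \<le> norm (?D m) * (norm (?D (sign_op A (f i))) * norm (f i))"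
        by (simp add: norm_scaleC mult.assoc [symmetric] mult_right_mono norm_cinner_le)
    qed
    finally show ?thesis by (simp add: r_def sum_distrib_left)
  qed
  have "norm (C x) \<le> (cC * r + sqrt c0) * norm (?D x)" for x
  proof -
    note PP = orth_projection_neg_proj [OF A]
    have D1: "norm (?D (?P x)) \<le> norm (?D x)"
      using orth_projection_norm_le [OF PP, of "?D x"] by (simp add: neg_proj_mod_root [OF A])
    have D2: "norm (?D (x - ?P x)) \<le> norm (?D x)"
      using orth_projection_norm_le [OF orth_projection_compl [OF PP], of "?D x"]
      by (simp add: neg_proj_mod_root [OF A] bop_diff [OF bop_mod_root [OF A]])
    have "norm (C x) \<le> norm (C (?P x)) + norm (C (x - ?P x))"
      using norm_triangle_ineq [of "C (?P x)" "C (x - ?P x)"] by (simp add: bop_diff [OF C])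
    also have "norm (C (?P x)) \<le> cC * norm (?P x)" by (rule cC(2))
    also have "\<dots> \<le> cC * (norm (?D (?P x)) * r)"
      by (intro mult_left_mono on_neg cC(1)) (simp add: neg_proj_idem [OF A])
    also have "\<dots> \<le> cC * (norm (?D x) * r)"
      by (intro mult_left_mono mult_right_mono D1 cC(1) r0)
    also have "norm (C (x - ?P x)) \<le> sqrt c0 * norm (?D (x - ?P x))"
      by (rule on_compl) (simp add: bop_diff [OF bP] neg_proj_idem [OF A])
    also have "\<dots> \<le> sqrt c0 * norm (?D x)" using c0 by (intro mult_left_mono D2) simp
    finally show ?thesis by (simp add: algebra_simps)
  qed
  moreover have "0 \<le> cC * r + sqrt c0" using cC(1) r0 c0 by simp
  ultimately show ?thesis by blast
qed

lemma neg_gram_form: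
  fixes n :: nat
  assumes B: "bop B" and f: "\<And>i j. i < n \<Longrightarrow> j < n \<Longrightarrow> cinner (B (f i)) (f j) = (if i = j then -1 else 0)"
  shows "Re (cinner (B (\<Sum>i<n. c i *\<^sub>C f i)) (\<Sum>i<n. c i *\<^sub>C f i)) = - (\<Sum>i<n. (cmod (c i))\<^sup>2)"
proof -
  have "cinner (B (\<Sum>i<n. c i *\<^sub>C f i)) (f j) = - c j" if "j < n" for j
  proof -
    have "cinner (B (\<Sum>i<n. c i *\<^sub>C f i)) (f j) = (\<Sum>i<n. c i * cinner (B (f i)) (f j))"
      by (simp add: bop_sum [OF B] bop_scaleC [OF B] cinner.sum_left cinner_scaleC_left)
    also have "\<dots> = (\<Sum>i<n. if i = j then - c j else 0)"
      using f that by (intro sum.cong) auto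
    also have "\<dots> = - c j" using that by simp
    finally show ?thesis .
  qed
  then have "cinner (B (\<Sum>i<n. c i *\<^sub>C f i)) (\<Sum>i<n. c i *\<^sub>C f i) = (\<Sum>j<n. - (c j * cnj (c j)))"
    unfolding cinner.sum_right cinner_scaleC_right by (intro sum.cong) auto
  then show ?thesis by (simp add: sum_negf flip: complex_norm_square)
qed

text \<open>\<open>V\<close> sends the negative basis of \<open>J\<close> to the images under
  \<open>mod_root A\<close> of the first \<open>n\<close> vectors of that of \<open>A\<close>, and
  kills the complementary spectral subspace. So the form at \<open>V y\<close> is the form of
  \<open>J\<close> at the negative component of \<open>y\<close>, which is at most the form at
  \<open>y\<close>.\<close>

lemma J_contraction_exists:
  fixes A :: "'a::chilbert_space \<Rightarrow> 'a" and J :: "'b::chilbert_space \<Rightarrow> 'b"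
  assumes A: "selfadjoint A" and J: "selfadjoint J"
    and fin: "nu_minus A = enat k" "nu_minus J = enat n" and le: "n \<le> k"
  shows "\<exists>V. bop V \<and> (\<forall>y. V y \<in> mod_space A) \<and>
    (\<forall>y. Re (cinner (sign_op A (V y)) (V y)) \<le> Re (cinner (J y) y))"
proof -
  note bJ = selfadjoint_bop [OF J] and bD = bop_mod_root [OF A]
  obtain f where f: "\<And>i. i < n \<Longrightarrow> neg_proj J (f i) = f i"
    and ff: "\<And>i j. i < n \<Longrightarrow> j < n \<Longrightarrow> cinner (J (f i)) (f j) = (if i = j then -1 else 0)"
    and exp: "\<And>x. neg_proj J x = x \<Longrightarrow> x = (\<Sum>i<n. - cinner (J x) (f i) *\<^sub>C f i)"
    by (rule negative_subspace_basis [OF J fin(2)]) (rule that)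
  obtain g where gg: "\<And>i j. i < k \<Longrightarrow> j < k \<Longrightarrow> cinner (A (g i)) (g j) = (if i = j then -1 else 0)"
    by (rule negative_subspace_basis [OF A fin(1)]) (rule that)
  define c where "c y i = - cinner (J y) (f i)" for y i
  define V where "V y = mod_root A (\<Sum>i<n. c y i *\<^sub>C g i)" for y
  obtain K where K: "K \<ge> 0" "\<And>x. norm (J x) \<le> K * norm x" using bop_bound [OF bJ] by blast
  have b: "bop (\<lambda>y. \<Sum>i<n. c y i *\<^sub>C g i)"
  proof (rule bopI [of _ "\<Sum>i<n. K * norm (f i) * norm (g i)"])
    show "(\<Sum>i<n. c (x + y) i *\<^sub>C g i) = (\<Sum>i<n. c x i *\<^sub>C g i) + (\<Sum>i<n. c y i *\<^sub>C g i)" for x y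
      by (simp add: c_def bop_add [OF bJ] cinner_add_left scaleC_add_left complex_vector.scale_left_diff_distrib flip: sum.distrib)
    show "(\<Sum>i<n. c (a *\<^sub>C x) i *\<^sub>C g i) = a *\<^sub>C (\<Sum>i<n. c x i *\<^sub>C g i)" for a x
      by (simp add: c_def bop_scaleC [OF bJ] cinner_scaleC_left scaleC_scaleC complex_vector.scale_sum_right)
    fix x
    have "norm (\<Sum>i<n. c x i *\<^sub>C g i) \<le> (\<Sum>i<n. norm (c x i *\<^sub>C g i))" by (rule norm_sum)
    also have "\<dots> \<le> (\<Sum>i<n. K * norm (f i) * norm (g i) * norm x)"
    proof (rule sum_mono)
      fix i
      have "norm (c x i *\<^sub>C g i) \<le> norm (J x) * norm (f i) * norm (g i)"
        by (simp add: c_def norm_scaleC mult_right_mono norm_cinner_le)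
      also have "\<dots> \<le> K * norm x * norm (f i) * norm (g i)"
        by (intro mult_right_mono K(2)) simp_all
      finally show "norm (c x i *\<^sub>C g i) \<le> K * norm (f i) * norm (g i) * norm x" by (simp add: mult_ac)
    qed
    finally show "norm (\<Sum>i<n. c x i *\<^sub>C g i) \<le> (\<Sum>i<n. K * norm (f i) * norm (g i)) * norm x"
      by (simp add: sum_distrib_right)
  qed
  have "Re (cinner (sign_op A (V y)) (V y)) \<le> Re (cinner (J y) y)" for y
  proof -
    let ?p = "neg_proj J y"
    have "Re (cinner (sign_op A (V y)) (V y)) = - (\<Sum>i<n. (cmod (c y i))\<^sup>2)"
      unfolding V_def sign_form_mod_root [OF A]
      by (rule neg_gram_form [OF selfadjoint_bop [OF A]]) (use gg le in auto)
    also have "\<dots> = Re (cinner (J ?p) ?p)"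
    proof -
      have "c ?p i = c y i" if "i < n" for i
        using f [OF that] selfadjoint_cinner [OF selfadjoint_neg_proj [OF J], of "J y" "f i"]
        by (simp add: c_def neg_proj_commute [OF J])
      moreover have "?p = (\<Sum>i<n. c ?p i *\<^sub>C f i)"
        using exp [of ?p] by (simp add: c_def neg_proj_idem [OF J])
      ultimately have p: "?p = (\<Sum>i<n. c y i *\<^sub>C f i)" by simp
      show ?thesis unfolding p by (rule neg_gram_form [OF bJ ff, symmetric])
    qed
    also have "\<dots> \<le> Re (cinner (J y) y)"
      using form_split_neg_proj [OF J, of y] compl_form_nonneg [OF J, of y] by linarith
    finally show ?thesis .
  qed
  moreover have "bop V" unfolding V_def [abs_def] by (rule bop_compose [OF bD b])
  moreover have "V y \<in> mod_space A" for y unfolding V_def by (rule mod_root_in_mod_space [OF A])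
  ultimately show ?thesis by blast
qed

section \<open>The link operator and the Julia operator\<close>

lemma adjoint_pairD: "adjoint_pair A B \<Longrightarrow> cinner (A x) y = cinner x (B y)"
  by (simp add: adjoint_pair_def)

text \<open>\<open>Ts\<close>, \<open>A\<close> and \<open>B\<close> are parameters, so that the
  dual instance exchanges \<open>T\<close> with \<open>Ts\<close> and \<open>A\<close> with
  \<open>B\<close> literally, without rewriting double adjoints.\<close>

locale krein_pair =
  fixes J1 :: "'h1::chilbert_space \<Rightarrow> 'h1" and J2 :: "'h2::chilbert_space \<Rightarrow> 'h2"
    and T :: "'h1 \<Rightarrow> 'h2" and Ts :: "'h2 \<Rightarrow> 'h1" and A :: "'h1 \<Rightarrow> 'h1" and B :: "'h2 \<Rightarrow> 'h2"
  assumes J1: "selfadjoint J1" "J1 (J1 x) = x" and J2: "selfadjoint J2" "J2 (J2 y) = y"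
    and T: "bop T" and Ts: "adjoint_pair T Ts"
    and A_def: "A = (\<lambda>x. J1 x - Ts (J2 (T x)))" and B_def: "B = (\<lambda>y. J2 y - T (J1 (Ts y)))"
begin

lemma bop_Ts: "bop Ts"
  by (rule bop_of_adjoint_pair [OF T Ts])

lemma bop_J: "bop J1" "bop J2"
  using J1 J2 selfadjoint_bop by blast+

lemma krein_pair_dual: "krein_pair J2 J1 Ts T B A"
  by (rule krein_pair.intro) (simp_all add: J1 J2 bop_Ts adjoint_pair_sym [OF Ts] A_def B_def)

lemma selfadjoint_A: "selfadjoint A"
proof (rule selfadjointI)
  show "bop A" unfolding A_def
    by (rule bop_sub [OF bop_J(1) bop_compose [OF bop_Ts bop_compose [OF bop_J(2) T]]])
  show "cinner (A x) y = cinner x (A y)" for x y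
    by (simp add: A_def cinner.diff_left cinner.diff_right selfadjoint_cinner [OF J1(1)]
        adjoint_pairD [OF adjoint_pair_sym [OF Ts]] selfadjoint_cinner [OF J2(1)] adjoint_pairD [OF Ts])
qed

lemma selfadjoint_B: "selfadjoint B"
  using krein_pair.selfadjoint_A [OF krein_pair_dual] .

text \<open>Both sides equal \<open>T x - T J1 Ts J2 T x\<close>; through this relation statements
  about \<open>A\<close> are carried over to \<open>B\<close>.\<close>

lemma intertwine: "T (J1 (A x)) = B (J2 (T x))"
  by (simp add: A_def B_def bop_diff [OF bop_J(1)] bop_diff [OF T] J1(2) J2(2))

abbreviation "S \<equiv> sign_op A"
abbreviation "Ss \<equiv> sign_op B"
abbreviation "D \<equiv> mod_root A"
abbreviation "Ds \<equiv> mod_root B"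

lemmas bops = T bop_Ts bop_J bop_self [OF selfadjoint_A] bop_self [OF selfadjoint_B] bop_sign [OF selfadjoint_A] bop_sign [OF selfadjoint_B]
  bop_mod_root [OF selfadjoint_A] bop_mod_root [OF selfadjoint_B]

text \<open>
  With \<open>M = T J\<^sub>1\<close> and \<open>|A| = A S\<close>, the intertwining relation turns \<open>M |A| M\<^sup>*\<close> into \<open>|B| K\<close> with \<open>K\<close> bounded,
  so that Krein's lemma bounds it by \<open>|B|\<close>; Douglas factorisation then yields the adjoint of the
  link operator.
\<close>

lemma link_exists:
  "\<exists>R. bop R \<and> (\<forall>y. R (Ds y) = D (J1 (Ts y))) \<and> (\<forall>y. R (proj_onto (mod_space B) y) = R y) \<and> (\<forall>y. R y \<in> mod_space A)"
proof -
  \<comment> \<open>The factor \<open>Ss\<close> cancels the one in \<open>|B| = B Ss\<close>, after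
    which the intertwining relation replaces \<open>B J2 T\<close> by \<open>T J1 A\<close>.\<close>
  define K where "K y = Ss (J2 (T (S (J1 (Ts y)))))" for y
  have K: "bop K" unfolding K_def [abs_def]
    by (intro bop_compose [OF bops(8)] bop_compose [OF bops(4)] bop_compose [OF T] bop_compose [OF bops(7)]
        bop_compose [OF bops(3)] bop_Ts)
  have BK: "abs_op B (K y) = T (J1 (A (S (J1 (Ts y)))))" for y
    by (simp add: abs_op_eq [OF selfadjoint_B] K_def sign_sign [OF selfadjoint_B] intertwine)
  have abs: "selfadjoint (abs_op A)" "selfadjoint (abs_op B)"
    using positive_op_selfadjoint positive_abs_op selfadjoint_A selfadjoint_B by blast+
  have form: "cinner (abs_op B (K x)) y = cinner (abs_op A (J1 (Ts x))) (J1 (Ts y))" for x y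
    by (simp add: BK abs_op_eq [OF selfadjoint_A] adjoint_pairD [OF Ts] selfadjoint_cinner [OF J1(1)])
  have "cinner (abs_op B (K x)) y = cinner (abs_op B x) (K y)" for x y
  proof -
    have "cinner (abs_op B x) (K y) = cinner x (abs_op B (K y))" by (rule selfadjoint_cinner [OF abs(2)])
    also have "\<dots> = cnj (cinner (abs_op B (K y)) x)" by (rule cinner_commute)
    also have "\<dots> = cinner (J1 (Ts x)) (abs_op A (J1 (Ts y)))" unfolding form by (rule cinner_commute [symmetric])
    also have "\<dots> = cinner (abs_op B (K x)) y" unfolding form by (rule selfadjoint_cinner [OF abs(1), symmetric])
    finally show ?thesis ..
  qed
  from symmetrisable_form_bound [OF positive_abs_op [OF selfadjoint_B] K this]
  obtain c where c: "c \<ge> 0" "\<And>x. Re (cinner (abs_op B (K x)) x) \<le> c * Re (cinner (abs_op B x) x)" by blast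
  have nD: "(norm (D x))\<^sup>2 = Re (cinner (abs_op A x) x)" for x
    unfolding mod_root_def by (rule norm_sqrt_op [OF positive_abs_op [OF selfadjoint_A]])
  have nDs: "(norm (Ds x))\<^sup>2 = Re (cinner (abs_op B x) x)" for x
    unfolding mod_root_def by (rule norm_sqrt_op [OF positive_abs_op [OF selfadjoint_B]])
  have "norm (D (J1 (Ts y))) \<le> sqrt c * norm (Ds y)" for y
  proof (rule power2_le_imp_le)
    show "(norm (D (J1 (Ts y))))\<^sup>2 \<le> (sqrt c * norm (Ds y))\<^sup>2"
      using c(2)[of y] c(1) by (simp add: power_mult_distrib nD nDs form)
    show "0 \<le> sqrt c * norm (Ds y)" using c(1) by simp
  qed
  from douglas_factorisation [OF bop_compose [OF bops(9) bop_compose [OF bops(3) bop_Ts]] bops(10) _ this]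
  obtain R where R: "bop R" "\<And>y. R (Ds y) = D (J1 (Ts y))" "\<And>y. R (proj_onto (mod_space B) y) = R y"
    "\<And>y. R y \<in> closure (range (\<lambda>y. D (J1 (Ts y))))"
    using c(1) unfolding mod_space_def by auto
  have "closure (range (\<lambda>y. D (J1 (Ts y)))) \<subseteq> mod_space A"
    unfolding mod_space_def by (rule closure_mono) auto
  with R show ?thesis by blast
qed

end

text \<open>\<open>R\<close> is the adjoint of the link operator, extended by zero off the defect
  space of the adjoint of \<open>T\<close>. It is a parameter because the dual instance needs a
  different operator in its place.\<close>

locale julia = krein_pair +
  fixes R
  assumes R: "bop R" and R_root: "R (Ds y) = D (J1 (Ts y))"
    and R_proj: "R (proj_onto (mod_space B) y) = R y" and R_in: "R y \<in> mod_space A"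
begin

definition "L = adj R"

lemma bop_L: "bop L"
  unfolding L_def by (rule bop_adj [OF R])

lemma RL: "cinner (R y) x = cinner y (L x)"
  unfolding L_def by (rule cinner_adj(1) [OF R])

lemma LR: "cinner (L x) y = cinner x (R y)"
  by (metis RL cinner_commute)

lemma root_L: "Ds (L x) = T (J1 (D x))"
proof (rule cinner_eqI_left)
  fix y
  have "cinner (Ds (L x)) y = cinner x (R (Ds y))"
    by (simp add: selfadjoint_cinner [OF selfadjoint_mod_root [OF selfadjoint_B]] LR)
  also have "\<dots> = cinner (T (J1 (D x))) y"
    by (simp add: R_root adjoint_pairD [OF Ts] selfadjoint_cinner [OF J1(1)]
        selfadjoint_cinner [OF selfadjoint_mod_root [OF selfadjoint_A]])
  finally show "cinner (Ds (L x)) y = cinner (T (J1 (D x))) y" .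
qed

lemma L_in: "L x \<in> mod_space B"
proof -
  have "proj_onto (mod_space B) (L x) = L x"
    by (rule cinner_eqI_left)
       (simp add: selfadjoint_cinner [OF selfadjoint_proj_onto [OF mod_space [OF selfadjoint_B]]] LR R_proj)
  then show ?thesis by (simp add: proj_onto_iff [OF mod_space [OF selfadjoint_B]])
qed

lemma L_proj: "L (proj_onto (mod_space A) x) = L x"
  by (rule cinner_eqI_left)
     (simp add: selfadjoint_cinner [OF selfadjoint_proj_onto [OF mod_space [OF selfadjoint_A]]] LR
        proj_onto_id [OF mod_space [OF selfadjoint_A] R_in])

lemma R_sign_root: "R (Ss (Ds y)) = D (J1 (Ts (Ss y)))"
  by (simp add: sign_mod_root [OF selfadjoint_B] R_root)

lemma intertwine_dual: "Ts (J2 (B y)) = A (J1 (Ts y))"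
  by (rule krein_pair.intertwine [OF krein_pair_dual])

lemma mod_space_B_induct:
  assumes "closed {e. P e}" "\<And>y. P (Ds y)" "e \<in> mod_space B"
  shows "P e"
proof -
  have "mod_space B \<subseteq> {e. P e}" unfolding mod_space_def using assms(1,2) by (intro closure_minimal) auto
  with assms(3) show ?thesis by blast
qed

text \<open>The companion of \<open>R_root\<close>: \<open>S R Ss\<close> acts as the link operator
  of \<open>Ts\<close>. On the range of \<open>Ds\<close> this is the dual intertwining relation;
  the rest is continuity.\<close>

lemma root_sign_R:
  assumes "e \<in> mod_space B"
  shows "D (S (R (Ss e))) = Ts (J2 (Ds e))"
proof (rule mod_space_B_induct [OF _ _ assms])
  show "closed {e. D (S (R (Ss e))) = Ts (J2 (Ds e))}"
    by (intro closed_Collect_eq bop_continuous_on bop_compose [OF bops(9)] bop_compose [OF bops(7)]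
        bop_compose [OF R] bop_compose [OF bop_Ts] bop_compose [OF bops(4)] bops)
  fix y
  have "D (S (R (Ss (Ds y)))) = A (J1 (Ts (Ss y)))"
    unfolding R_sign_root by (rule mod_root_sign_mod_root [OF selfadjoint_A])
  also have "\<dots> = Ts (J2 (B (Ss y)))" by (simp add: intertwine_dual)
  finally show "D (S (R (Ss (Ds y)))) = Ts (J2 (Ds (Ds y)))" by (simp add: mod_root_mod_root [OF selfadjoint_B])
qed

text \<open>The second column of the Julia operator is isometric. On the range of \<open>Ds\<close>
  both sides become forms in \<open>z = Ss y\<close>, and the identity reduces to
  \<open>T J1 Ts z = J2 z - B z\<close>.\<close>

lemma sign_identity:
  assumes "e \<in> mod_space B"
  shows "Re (cinner (Ss e) e) = Re (cinner (J2 (Ds e)) (Ds e)) + Re (cinner (S (R (Ss e))) (R (Ss e)))"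
proof (rule mod_space_B_induct [OF _ _ assms])
  show "closed {e. Re (cinner (Ss e) e) = Re (cinner (J2 (Ds e)) (Ds e)) + Re (cinner (S (R (Ss e))) (R (Ss e)))}"
    by (intro closed_Collect_eq continuous_intros cinner.continuous_on bop_continuous_on bop_compose [OF bops(7)]
        bop_compose [OF R] bop_compose [OF bops(4)] bops bop_id)
  fix y
  define z where "z = Ss y"
  have y: "y = Ss z" by (simp add: z_def sign_sign [OF selfadjoint_B])
  have e: "Ds y = Ss (Ds z)" by (simp add: y sign_mod_root [OF selfadjoint_B])
  have DD: "Ds (Ds y) = B z"
    by (simp add: e mod_root_sign_mod_root [OF selfadjoint_B])
  have "cinner (S (R (Ss (Ds y)))) (R (Ss (Ds y))) = cinner (A (J1 (Ts z))) (J1 (Ts z))"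
    by (simp add: R_sign_root z_def sign_form_mod_root [OF selfadjoint_A])
  also have "\<dots> = cinner (T (J1 (A (J1 (Ts z))))) z"
    by (simp add: adjoint_pairD [OF Ts] selfadjoint_cinner [OF J1(1)])
  also have "T (J1 (A (J1 (Ts z)))) = B (J2 (J2 z - B z))"
    by (simp add: intertwine) (simp add: B_def)
  also have "\<dots> = B z - B (J2 (B z))"
    by (simp add: bop_diff [OF bops(4)] bop_diff [OF bops(6)] J2(2))
  also have "cinner (B z - B (J2 (B z))) z = cinner (B z) z - cinner (J2 (B z)) (B z)"
    by (simp add: cinner.diff_left selfadjoint_cinner [OF selfadjoint_B, of "J2 (B z)"])
  also have "cinner (B z) z = cinner (Ss (Ds y)) (Ds y)"
    by (simp add: e sign_form_mod_root [OF selfadjoint_B, symmetric] sign_sign [OF selfadjoint_B]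
        selfadjoint_cinner [OF selfadjoint_sign [OF selfadjoint_B]])
  finally show "Re (cinner (Ss (Ds y)) (Ds y)) = Re (cinner (J2 (Ds (Ds y))) (Ds (Ds y))) + Re (cinner (S (R (Ss (Ds y)))) (R (Ss (Ds y))))"
    by (simp add: DD)
qed

text \<open>The first column is isometric by the definition of \<open>A\<close>, the second by
  \<open>sign_identity\<close>; the mixed terms cancel by \<open>root_sign_R\<close>.\<close>

lemma julia_isometry:
  fixes x and e
  assumes e: "e \<in> mod_space B"
  defines "h \<equiv> T x + Ds e" and "d \<equiv> D x - R (Ss e)"
  shows "Re (cinner (J1 x) x) + Re (cinner (Ss e) e) = Re (cinner (J2 h) h) + Re (cinner (S d) d)"
proof -
  have h: "Re (cinner (J2 h) h) = Re (cinner (J2 (T x)) (T x)) + 2 * Re (cinner (J2 (T x)) (Ds e)) + Re (cinner (J2 (Ds e)) (Ds e))"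
    unfolding h_def by (rule selfadjoint_form_add [OF J2(1)])
  have "Re (cinner (S d) d) = Re (cinner (S (D x)) (D x)) + 2 * Re (cinner (S (D x)) (- R (Ss e))) + Re (cinner (S (- R (Ss e))) (- R (Ss e)))"
    using selfadjoint_form_add [OF selfadjoint_sign [OF selfadjoint_A], of "D x" "- R (Ss e)"] by (simp add: d_def)
  then have d: "Re (cinner (S d) d) = Re (cinner (A x) x) - 2 * Re (cinner (S (D x)) (R (Ss e))) + Re (cinner (S (R (Ss e))) (R (Ss e)))"
    by (simp add: bop_minus [OF bops(7)] cinner.minus_left cinner.minus_right sign_form_mod_root [OF selfadjoint_A])
  have "cinner (S (D x)) (R (Ss e)) = cinner x (D (S (R (Ss e))))"
    by (simp add: selfadjoint_cinner [OF selfadjoint_sign [OF selfadjoint_A]] selfadjoint_cinner [OF selfadjoint_mod_root [OF selfadjoint_A]])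
  also have "\<dots> = cinner (J2 (T x)) (Ds e)"
    by (simp add: root_sign_R [OF e] selfadjoint_cinner [OF J2(1)] adjoint_pairD [OF Ts])
  finally have cross: "cinner (S (D x)) (R (Ss e)) = cinner (J2 (T x)) (Ds e)" .
  have "Re (cinner (A x) x) = Re (cinner (J1 x) x) - Re (cinner (J2 (T x)) (T x))"
    by (simp add: A_def cinner.diff_left adjoint_pairD [OF adjoint_pair_sym [OF Ts]])
  then show ?thesis using sign_identity [OF e] by (simp add: h d cross)
qed

text \<open>The adjoint form of \<open>root_sign_R\<close>. The projection is inserted because that
  identity is restricted to the defect space, while \<open>v\<close> is arbitrary.\<close>

lemma sign_L_sign_root: "Ss (L (S (D u))) = Ds (J2 (T u))"
proof (rule cinner_eqI_left)
  fix v
  have "R (Ss v) = R (Ss (proj_onto (mod_space B) v))"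
    by (simp add: sign_proj [OF selfadjoint_B] R_proj)
  then have "cinner (Ss (L (S (D u)))) v = cinner u (D (S (R (Ss (proj_onto (mod_space B) v)))))"
    by (simp add: selfadjoint_cinner [OF selfadjoint_sign [OF selfadjoint_B]] LR
        selfadjoint_cinner [OF selfadjoint_sign [OF selfadjoint_A]] selfadjoint_cinner [OF selfadjoint_mod_root [OF selfadjoint_A]])
  also have "\<dots> = cinner u (Ts (J2 (Ds v)))"
    by (simp add: root_sign_R proj_onto_in [OF mod_space [OF selfadjoint_B]] mod_root_proj [OF selfadjoint_B])
  also have "\<dots> = cinner (Ds (J2 (T u))) v"
    by (simp add: selfadjoint_cinner [OF selfadjoint_mod_root [OF selfadjoint_B]] selfadjoint_cinner [OF J2(1)] adjoint_pairD [OF Ts])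
  finally show "cinner (Ss (L (S (D u)))) v = cinner (Ds (J2 (T u))) v" .
qed

text \<open>For \<open>Ts\<close> the role of \<open>R\<close> falls to the adjoint of its link
  operator \<open>S R Ss\<close>, and this adjoint is \<open>Ss L S\<close>.\<close>

lemma julia_dual: "julia J2 J1 Ts T B A (\<lambda>x. Ss (L (S x)))"
proof (intro julia.intro krein_pair_dual julia_axioms.intro)
  show "bop (\<lambda>x. Ss (L (S x)))" by (rule bop_compose [OF bops(8) bop_compose [OF bop_L bops(7)]])
  show "Ss (L (S (D y))) = Ds (J2 (T y))" for y by (rule sign_L_sign_root)
  show "Ss (L (S (proj_onto (mod_space A) y))) = Ss (L (S y))" for y
    by (simp add: sign_proj [OF selfadjoint_A] L_proj)
  show "Ss (L (S y)) \<in> mod_space B" for y by (rule sign_in_mod_space [OF selfadjoint_B L_in])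
qed

end

section \<open>The index of a completion\<close>

text \<open>The completion itself is not a parameter: its defect operator enters as
  \<open>X\<close>, through its quadratic form. Hence the same locale can be instantiated for the
  adjoint, with \<open>G1\<close> and \<open>G2\<close> replaced by the adjoints of
  \<open>G2\<close> and \<open>G1\<close>.\<close>

locale julia_completion = julia +
  fixes J1' :: "'k1::chilbert_space \<Rightarrow> 'k1" and J2' :: "'k2::chilbert_space \<Rightarrow> 'k2"
    and G1 G2 G2s Y X
  assumes J2': "selfadjoint J2'" "J2' (J2' z) = z" and J1': "bop J1'"
    and G1: "bop G1" "G1 v \<in> mod_space B" and G2: "bop G2" and G2s: "adjoint_pair G2 G2s" "G2s z \<in> mod_space A"
    and Y: "bop Y" and X: "selfadjoint X"
    and X_form: "Re (cinner (X (x, v)) (x, v)) = Re (cinner (J1 x) x) + Re (cinner (J1' v) v)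
      - Re (cinner (J2 (T x + Ds (G1 v))) (T x + Ds (G1 v)))
      - Re (cinner (J2' (G2 (D x - R (Ss (G1 v))) + Y v)) (G2 (D x - R (Ss (G1 v))) + Y v))"
begin

definition "middle p = D (fst p) - R (Ss (G1 (snd p)))"
definition "lower p = G2 (middle p) + Y (snd p)"

lemma bop_middle: "bop middle"
  unfolding middle_def [abs_def]
  by (intro bop_sub bop_compose [OF bops(9) bop_fst] bop_compose [OF R bop_compose [OF bops(8) bop_compose [OF G1(1) bop_snd]]])

lemma bop_lower: "bop lower"
  unfolding lower_def [abs_def] by (intro bop_plus bop_compose [OF G2 bop_middle] bop_compose [OF Y bop_snd])

lemma bop_G2s: "bop G2s"
  by (rule bop_of_adjoint_pair [OF G2 G2s(1)])

text \<open>The form of the hermitian block operator with diagonal entries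
  \<open>J1' - G1^* Ss G1\<close> and \<open>J2' - G2 S G2^*\<close> and corner \<open>Y\<close>,
  written so that no adjoint of \<open>G1\<close> occurs.\<close>

definition "residual_form v z = Re (cinner (J1' v) v) - Re (cinner (Ss (G1 v)) (G1 v)) + 2 * Re (cinner (Y v) z)
  + Re (cinner (J2' z) z) - Re (cinner (S (G2s z)) (G2s z))"

lemma residual_form_scaleC: "residual_form (c *\<^sub>C v) (c *\<^sub>C z) = (cmod c)\<^sup>2 * residual_form v z"
  unfolding residual_form_def bop_scaleC [OF J1'] bop_scaleC [OF G1(1)] bop_scaleC [OF bops(8)] bop_scaleC [OF Y]
    bop_scaleC [OF bop_self [OF J2'(1)]] bop_scaleC [OF bop_G2s] bop_scaleC [OF bops(7)] Re_cinner_scaleC_both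
  by (simp add: algebra_simps)

text \<open>One form, diagonalised in two ways: with respect to the output in \<open>H\<^sub>2'\<close> and with respect to \<open>D\<^sub>T\<close>.\<close>

definition "joint_form p = Re (cinner (X (fst p)) (fst p)) + Re (cinner (J2' (snd p + J2' (lower (fst p)))) (snd p + J2' (lower (fst p))))"

text \<open>The Julia isometry trades the forms of \<open>J1\<close>, \<open>J2\<close> and
  \<open>Ss\<close> for that of \<open>S\<close>. The square with \<open>J2'\<close> then leaves the
  pairing of \<open>z\<close> with the lower output, and a square with \<open>S\<close> absorbs the
  part of this pairing that comes from \<open>G2\<close>.\<close>

lemma joint_form_eq:
  "joint_form p = Re (cinner (S (middle (fst p) + S (G2s (snd p)))) (middle (fst p) + S (G2s (snd p)))) + residual_form (snd (fst p)) (snd p)"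
proof -
  obtain x v z where p: "p = ((x, v), z)" by (metis prod.collapse)
  let ?d = "D x - R (Ss (G1 v))"
  have d: "middle (x, v) = ?d" and w: "lower (x, v) = G2 ?d + Y v" by (simp_all add: middle_def lower_def)
  note jul = julia_isometry [OF G1(2), of x v]
  have 1: "Re (cinner (X (x, v)) (x, v)) = Re (cinner (S ?d) ?d) + Re (cinner (J1' v) v)
      - Re (cinner (Ss (G1 v)) (G1 v)) - Re (cinner (J2' (lower (x, v))) (lower (x, v)))"
    using jul unfolding X_form w by linarith
  have 2: "Re (cinner (J2' (z + J2' (lower (x, v)))) (z + J2' (lower (x, v))))
      = Re (cinner (J2' z) z) + 2 * Re (cinner (lower (x, v)) z) + Re (cinner (J2' (lower (x, v))) (lower (x, v)))"
    unfolding selfadjoint_form_add [OF J2'(1)]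
    using selfadjoint_cinner [OF J2'(1), of z "J2' (lower (x, v))"] Re_cinner_commute [of "lower (x, v)" z]
      Re_cinner_commute [of "lower (x, v)" "J2' (lower (x, v))"]
    by (simp add: J2'(2))
  have 3: "Re (cinner (S (?d + S (G2s z))) (?d + S (G2s z)))
      = Re (cinner (S ?d) ?d) + 2 * Re (cinner (G2 ?d) z) + Re (cinner (S (G2s z)) (G2s z))"
    unfolding selfadjoint_form_add [OF selfadjoint_sign [OF selfadjoint_A]]
    using selfadjoint_cinner [OF selfadjoint_sign [OF selfadjoint_A], of ?d "S (G2s z)"]
      Re_cinner_commute [of "G2s z" "S (G2s z)"]
    by (simp add: sign_sign [OF selfadjoint_A] adjoint_pairD [OF G2s(1)])
  show ?thesis
    unfolding p fst_conv snd_conv joint_form_def 1 2 d 3 residual_form_def by (simp add: w cinner_add_left)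
qed

text \<open>These maps record the negative components of the squares in the two diagonalisations;
  where they vanish, \<open>joint_form\<close> is nonnegative, for \<open>\<Phi>A\<close> provided
  that the residual form is.\<close>

definition "\<Phi>X p = (neg_proj X (fst p), neg_proj J2' (snd p + J2' (lower (fst p))))"
definition "\<Phi>A p = neg_proj A (middle (fst p) + S (G2s (snd p)))"

lemma bop_\<Phi>X: "bop \<Phi>X"
  unfolding \<Phi>X_def [abs_def]
  by (intro bop_Pair bop_compose [OF bop_neg_proj [OF X] bop_fst] bop_compose [OF bop_neg_proj [OF J2'(1)]]
      bop_plus bop_snd bop_compose [OF bop_self [OF J2'(1)] bop_compose [OF bop_lower bop_fst]])

lemma bop_\<Phi>A: "bop \<Phi>A"
  unfolding \<Phi>A_def [abs_def]
  by (intro bop_compose [OF bop_neg_proj [OF selfadjoint_A]] bop_plus bop_compose [OF bop_middle bop_fst]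
      bop_compose [OF bops(7) bop_compose [OF bop_G2s bop_snd]])

lemma joint_form_nonneg_\<Phi>X: "\<Phi>X p = 0 \<Longrightarrow> 0 \<le> joint_form p"
  using neg_proj_form_nonneg [OF X, of "fst p"] neg_proj_form_nonneg [OF J2'(1), of "snd p + J2' (lower (fst p))"]
  by (simp add: joint_form_def \<Phi>X_def zero_prod_def)

lemma joint_form_nonneg_\<Phi>A:
  assumes "\<And>v z. 0 \<le> residual_form v z" "\<Phi>A p = 0"
  shows "0 \<le> joint_form p"
  using assms unfolding joint_form_eq sign_form [OF selfadjoint_A] \<Phi>A_def by simp

lemma range_\<Phi>X: "range \<Phi>X \<subseteq> range (neg_proj X) \<times> range (neg_proj J2')"
  by (auto simp: \<Phi>X_def)

lemma ecdim_target: "ecdim (range (neg_proj X) \<times> range (neg_proj J2')) = nu_minus X + nu_minus J2'"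
  by (simp add: ecdim_Times subspace_range_neg_proj X J2'(1) nu_minus_eq)

lemma joint_form_inl: "joint_form ((x, 0), 0) = Re (cinner (A x) x)"
proof -
  have "middle (x, 0) = D x"
    by (simp add: middle_def bop_zero [OF G1(1)] bop_zero [OF bops(8)] bop_zero [OF R])
  moreover have "residual_form 0 0 = 0"
    by (simp add: residual_form_def bop_zero [OF G1(1)] bop_zero [OF bops(8)] bop_zero [OF bop_G2s] bop_zero [OF bops(7)])
  ultimately show ?thesis
    by (simp add: joint_form_eq bop_zero [OF bop_G2s] bop_zero [OF bops(7)] sign_form_mod_root [OF selfadjoint_A])
qed

text \<open>Two embeddings. The joint form restricts to the form of \<open>A\<close> on the vectors
  \<open>((x, 0), 0)\<close>, so the negative subspace of \<open>A\<close> goes injectively under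
  \<open>\<Phi>X\<close>; the negative subspaces of \<open>X\<close> and \<open>J2'\<close> go
  injectively under a shifted \<open>\<Phi>A\<close>, where \<open>Q\<close> is used.\<close>

lemma index_eq:
  assumes Q: "\<And>v z. 0 \<le> residual_form v z"
  shows "nu_minus X + nu_minus J2' = nu_minus A"
proof (rule antisym)
  have "ecdim (range (neg_proj A)) \<le> ecdim (range (neg_proj X) \<times> range (neg_proj J2'))"
  proof (rule ecdim_le_of_inj)
    show "bop (\<lambda>x. \<Phi>X ((x, 0), 0))"
      by (rule bop_compose [OF bop_\<Phi>X bop_Pair [OF bop_inl bop_0]])
    show "complex_vector.subspace (range (neg_proj A))" by (rule subspace_range_neg_proj [OF selfadjoint_A])
    fix x assume "x \<in> range (neg_proj A)" and 0: "\<Phi>X ((x, 0), 0) = 0"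
    then have "neg_proj A x = x" using range_neg_proj_iff [OF selfadjoint_A] by blast
    then show "x = 0"
      using neg_proj_form_neg [OF selfadjoint_A, of x] joint_form_nonneg_\<Phi>X [OF 0] unfolding joint_form_inl by fastforce
  qed (use range_\<Phi>X in auto)
  then show "nu_minus A \<le> nu_minus X + nu_minus J2'"
    by (simp add: ecdim_target nu_minus_eq [OF selfadjoint_A])
  have "ecdim (range (neg_proj X) \<times> range (neg_proj J2')) \<le> ecdim (range (neg_proj A))"
  proof (rule ecdim_le_of_inj)
    \<comment> \<open>The shift undoes the completed square, so that the joint form becomes the sum
      of the forms of \<open>X\<close> and \<open>J2'\<close>.\<close>
    show "bop (\<lambda>p. \<Phi>A (fst p, snd p - J2' (lower (fst p))))"
      by (rule bop_compose [OF bop_\<Phi>A])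
         (intro bop_Pair bop_fst bop_sub bop_snd bop_compose [OF bop_self [OF J2'(1)] bop_compose [OF bop_lower bop_fst]])
    show "complex_vector.subspace (range (neg_proj X) \<times> range (neg_proj J2'))"
      by (intro subspace_Times subspace_range_neg_proj X J2'(1))
    fix p assume p: "p \<in> range (neg_proj X) \<times> range (neg_proj J2')" and 0: "\<Phi>A (fst p, snd p - J2' (lower (fst p))) = 0"
    then have P: "neg_proj X (fst p) = fst p" "neg_proj J2' (snd p) = snd p"
      using range_neg_proj_iff [OF X] range_neg_proj_iff [OF J2'(1)] by (auto simp: mem_Times_iff)
    have "0 \<le> Re (cinner (X (fst p)) (fst p)) + Re (cinner (J2' (snd p)) (snd p))"
      using joint_form_nonneg_\<Phi>A [OF Q 0] by (simp add: joint_form_def)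
    then show "p = 0"
      using neg_proj_form_neg [OF X P(1)] neg_proj_form_neg [OF J2'(1) P(2)]
        neg_proj_form_nonpos [OF X, of "fst p"] neg_proj_form_nonpos [OF J2'(1), of "snd p"]
      by (fastforce simp: P prod_eq_iff)
  qed (auto simp: \<Phi>A_def)
  then show "nu_minus X + nu_minus J2' \<le> nu_minus A"
    by (simp add: ecdim_target nu_minus_eq [OF selfadjoint_A])
qed

text \<open>
  A vector with \<open>residual_form v z < 0\<close> would enlarge the negative subspace of \<open>A\<close>: since \<open>ran D\<close> is dense in the
  defect space, \<open>u\<close> can be chosen such that \<open>((u, v), z)\<close> is nearly orthogonal to it.
\<close>

lemma residual_form_nonneg:
  assumes fin: "nu_minus A = enat k" and le: "nu_minus X + nu_minus J2' \<le> enat k"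
  shows "0 \<le> residual_form v z"
proof (rule ccontr)
  assume "\<not> 0 \<le> residual_form v z"
  then have Q: "residual_form v z < 0" by simp
  \<comment> \<open>If \<open>D u\<close> is close to this vector, the argument of the square with
    \<open>S\<close> at \<open>((u, v), z)\<close> is the small remainder \<open>r\<close>; the
    tolerance keeps \<open>|r|^2\<close> below \<open>- residual_form v z\<close>.\<close>
  let ?s = "R (Ss (G1 v)) - S (G2s z)"
  have "?s \<in> mod_space A"
    by (intro complex_vector.subspace_diff mod_space selfadjoint_A R_in sign_in_mod_space G2s)
  then have "\<exists>u. dist (D u) ?s < sqrt (- residual_form v z)"
    unfolding mod_space_def closure_approachable using Q by (metis neg_0_less_iff_less rangeE real_sqrt_gt_zero)
  then obtain u where u: "norm (D u - ?s) < sqrt (- residual_form v z)" by (auto simp: dist_norm)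
  define r where "r = D u - ?s"
  have r: "(norm r)\<^sup>2 + residual_form v z < 0"
  proof -
    have "(norm r)\<^sup>2 < (sqrt (- residual_form v z))\<^sup>2" using u unfolding r_def by (intro power_strict_mono) auto
    then show ?thesis using Q by simp
  qed
  show False
  proof (rule no_extra_negative [where N = "range (neg_proj A)" and \<iota> = "\<lambda>x. ((x, 0), 0)" and \<Phi> = \<Phi>X and G = joint_form
        and z = "((u, v), z)" and W = "range (neg_proj X) \<times> range (neg_proj J2')",
        OF subspace_range_neg_proj [OF selfadjoint_A] fin [unfolded nu_minus_eq [OF selfadjoint_A]]
           bop_Pair [OF bop_inl bop_0] bop_\<Phi>X _ joint_form_nonneg_\<Phi>X range_\<Phi>X le [folded ecdim_target]])
    fix n and c :: complex assume n: "n \<in> range (neg_proj A)" and nc: "n \<noteq> 0 \<or> c \<noteq> 0"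
    have Pn: "neg_proj A n = n" using n range_neg_proj_iff [OF selfadjoint_A] by blast
    show "joint_form (((n, 0), 0) + c *\<^sub>C ((u, v), z)) < 0"
    proof (cases "c = 0")
      case True
      then show ?thesis using nc neg_proj_form_neg [OF selfadjoint_A Pn] by (simp add: joint_form_inl)
    next
      case False
      let ?P = "neg_proj A"
      note bP = bop_neg_proj [OF selfadjoint_A]
      have e: "middle (n + c *\<^sub>C u, c *\<^sub>C v) + S (G2s (c *\<^sub>C z)) = D n + c *\<^sub>C r"
        by (simp add: middle_def r_def bop_add [OF bops(9)] bop_scaleC [OF bops(9)] bop_scaleC [OF G1(1)] bop_scaleC [OF bops(8)]
            bop_scaleC [OF R] bop_scaleC [OF bop_G2s] bop_scaleC [OF bops(7)] complex_vector.scale_right_diff_distrib scaleC_add_right)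
      \<comment> \<open>\<open>D n\<close> stays in the negative subspace, since \<open>D\<close>
        commutes with the projection; adding \<open>n\<close> thus leaves the nonnegative component
        unchanged, and this is the part that has to be small.\<close>
      have c: "(D n + c *\<^sub>C r) - ?P (D n + c *\<^sub>C r) = c *\<^sub>C (r - ?P r)"
        by (simp add: bop_add [OF bP] bop_scaleC [OF bP] neg_proj_mod_root [OF selfadjoint_A] Pn complex_vector.scale_right_diff_distrib)
      have "norm (r - ?P r) \<le> norm r"
        by (rule orth_projection_norm_le [OF orth_projection_compl [OF orth_projection_neg_proj [OF selfadjoint_A]]])
      then have rr: "(norm (r - ?P r))\<^sup>2 \<le> (norm r)\<^sup>2" by (rule power_mono) simp
      have "joint_form (((n, 0), 0) + c *\<^sub>C ((u, v), z)) = Re (cinner (S (D n + c *\<^sub>C r)) (D n + c *\<^sub>C r)) + (cmod c)\<^sup>2 * residual_form v z"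
        by (simp add: joint_form_eq e residual_form_scaleC)
      also have "\<dots> \<le> (cmod c)\<^sup>2 * ((norm (r - ?P r))\<^sup>2 + residual_form v z)"
        unfolding sign_form [OF selfadjoint_A] c by (simp add: norm_scaleC power_mult_distrib distrib_left)
      also have "\<dots> < 0"
      proof (rule mult_pos_neg)
        show "0 < (cmod c)\<^sup>2" using False by simp
        show "(norm (r - ?P r))\<^sup>2 + residual_form v z < 0" using rr r by linarith
      qed
      finally show ?thesis .
    qed
  qed
qed

end

section \<open>Operators between closed subspaces\<close>

lemma bops_UNIV_bop: "G \<in> bops UNIV N \<Longrightarrow> bop G"
  and bops_UNIV_in: "G \<in> bops UNIV N \<Longrightarrow> G x \<in> N"
  and bops_UNIVI: "bop G \<Longrightarrow> (\<And>x. G x \<in> N) \<Longrightarrow> G \<in> bops UNIV N"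
  by (auto simp: bops_def)

lemma bops_in: "G \<in> bops M N \<Longrightarrow> x \<in> M \<Longrightarrow> G x \<in> N"
  by (auto simp: bops_def)

lemma restrict_in_bops:
  assumes A: "bop A" and M: "complex_vector.subspace M" and N: "\<And>x. x \<in> M \<Longrightarrow> A x \<in> N"
  shows "restrict A M \<in> bops M N"
proof -
  obtain K where "\<And>x. norm (A x) \<le> K * norm x" using bop_bound [OF A] by blast
  then show ?thesis
    using M N
    by (auto simp: bops_def complex_vector.subspace_add complex_vector.subspace_scale
        bop_add [OF A] bop_scaleC [OF A] intro!: exI [of _ K])
qed

lemma bops_eqI:
  assumes "G \<in> bops M N" "G' \<in> bops M N" "\<And>x. x \<in> M \<Longrightarrow> G x = G' x"
  shows "G = G'"
proof
  fix x
  show "G x = G' x" using assms by (cases "x \<in> M") (auto simp: bops_def PiE_def extensional_def)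
qed

context
  fixes M :: "'a::chilbert_space set"
  assumes M: "closed M" "complex_vector.subspace M"
begin

lemma bop_extension:
  assumes G: "G \<in> bops M N"
  shows "bop (\<lambda>x. G (proj_onto M x))"
proof -
  note bP = selfadjoint_bop [OF selfadjoint_proj_onto [OF M]] and inM = proj_onto_in [OF M]
  have "\<exists>K. \<forall>x\<in>M. norm (G x) \<le> K * norm x" using G by (simp add: bops_def)
  then obtain K where K: "\<And>x. x \<in> M \<Longrightarrow> norm (G x) \<le> K * norm x" by blast
  show ?thesis
  proof (rule bopI [of _ "\<bar>K\<bar>"])
    show "G (proj_onto M (x + y)) = G (proj_onto M x) + G (proj_onto M y)" for x y
      using G inM by (simp add: bop_add [OF bP] bops_def)
    show "G (proj_onto M (c *\<^sub>C x)) = c *\<^sub>C G (proj_onto M x)" for c x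
      using G inM by (simp add: bop_scaleC [OF bP] bops_def)
    show "norm (G (proj_onto M x)) \<le> \<bar>K\<bar> * norm x" for x
    proof -
      have "norm (G (proj_onto M x)) \<le> \<bar>K\<bar> * norm (proj_onto M x)"
        by (rule order_trans [OF K [OF inM]]) (simp add: mult_right_mono)
      also have "\<dots> \<le> \<bar>K\<bar> * norm x"
        by (intro mult_left_mono orth_projection_norm_le orth_projection_proj_onto [OF M]) simp
      finally show ?thesis .
    qed
  qed
qed

text \<open>Adjoints between subspaces are reduced to adjoints between whole spaces by extending
  \<open>G\<close> by zero off \<open>M\<close>; the adjoint of the extension has values in
  \<open>M\<close> automatically.\<close>

lemma adj_on_eq_restrict:
  fixes G :: "'a \<Rightarrow> 'b::chilbert_space"
  assumes G: "G \<in> bops M N" and N: "complex_vector.subspace N"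
  shows "adj_on M N G = restrict (adj (\<lambda>x. G (proj_onto M x))) N"
proof (rule adj_on_eqI [OF M(2)])
  let ?G = "\<lambda>x. G (proj_onto M x)"
  note bG = bop_extension [OF G]
  have "proj_onto M (adj ?G y) = adj ?G y" for y
  proof (rule cinner_eqI)
    fix x
    have "cinner x (proj_onto M (adj ?G y)) = cinner (?G (proj_onto M x)) y"
      by (simp add: cinner_adj(1) [OF bG] flip: selfadjoint_cinner [OF selfadjoint_proj_onto [OF M]])
    also have "\<dots> = cinner x (adj ?G y)"
      by (simp add: proj_onto_id [OF M proj_onto_in [OF M]] flip: cinner_adj(1) [OF bG])
    finally show "cinner x (proj_onto M (adj ?G y)) = cinner x (adj ?G y)" .
  qed
  then have "adj ?G y \<in> M" for y by (simp add: proj_onto_iff [OF M])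
  then show "restrict (adj ?G) N \<in> bops N M" by (intro restrict_in_bops [OF bop_adj [OF bG] N])
  show "cinner (G x) y = cinner x (restrict (adj ?G) N y)" if "x \<in> M" "y \<in> N" for x y
    using that cinner_adj(1) [OF bG, of x y] by (simp add: proj_onto_id [OF M])
qed

end

lemma bops_eq_on_dense:
  fixes D :: "'a::chilbert_space \<Rightarrow> 'c::chilbert_space"
  assumes D: "bop D" and G: "G \<in> bops (closure (range D)) N" "G' \<in> bops (closure (range D)) N"
    and eq: "\<And>x. G (D x) = G' (D x)"
  shows "G = G'"
proof (rule bops_eqI [OF G])
  let ?M = "closure (range D)"
  have M: "closed ?M" "complex_vector.subspace ?M" using subspace_closure [OF subspace_range [OF D]] by simp_all
  fix x assume x: "x \<in> ?M"
  have "closed {x. G (proj_onto ?M x) = G' (proj_onto ?M x)}"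
    by (intro closed_Collect_eq bop_continuous_on bop_extension [OF M G(1)] bop_extension [OF M G(2)])
  moreover have "D z \<in> ?M" for z by (rule subsetD [OF closure_subset rangeI])
  then have "range D \<subseteq> {x. G (proj_onto ?M x) = G' (proj_onto ?M x)}"
    by (auto simp: proj_onto_id [OF M] eq)
  ultimately have "?M \<subseteq> {x. G (proj_onto ?M x) = G' (proj_onto ?M x)}" by (intro closure_minimal)
  then show "G x = G' x" using x by (auto simp: proj_onto_id [OF M])
qed

lemma proj_onto_UNIV: "proj_onto UNIV x = (x :: 'a::chilbert_space)"
  by (rule proj_onto_id) simp_all

text \<open>Nonnegativity means \<open>|Re \<langle>Y v, z\<rangle>| \<le> |D1 v| |D2 z|\<close>.
  Factoring the adjoint of \<open>Y\<close> through \<open>D2\<close> gives \<open>Y = D2 F\<close>;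
  density of the range of \<open>D2\<close> turns the inequality into
  \<open>|F v| \<le> |D1 v|\<close>, and a second factorisation splits off \<open>D1\<close> with
  norm at most \<open>1\<close>.\<close>

lemma contraction_factor:
  fixes Y :: "'a::chilbert_space \<Rightarrow> 'b::chilbert_space"
  assumes Y: "bop Y" and D1: "selfadjoint D1" and D2: "selfadjoint D2"
    and nonneg: "\<And>v z. 0 \<le> (norm (D1 v))\<^sup>2 + 2 * Re (cinner (Y v) z) + (norm (D2 z))\<^sup>2"
  shows "\<exists>G. bop G \<and> (\<forall>v. Y v = D2 (G (D1 v))) \<and> (\<forall>x. norm (G x) \<le> norm x) \<and> (\<forall>x. G x \<in> closure (range D2))"
proof -
  note b1 = selfadjoint_bop [OF D1] and b2 = selfadjoint_bop [OF D2]
  have bound: "\<bar>Re (cinner (Y v) z)\<bar> \<le> norm (D1 v) * norm (D2 z)" for v z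
  proof -
    have "(Re (cinner (Y v) z))\<^sup>2 \<le> (norm (D2 z))\<^sup>2 * (norm (D1 v))\<^sup>2"
    proof (rule quadratic_nonneg_imp_discriminant)
      show "0 \<le> (norm (D2 z))\<^sup>2 * t\<^sup>2 + 2 * t * Re (cinner (Y v) z) + (norm (D1 v))\<^sup>2" for t
        using nonneg [of v "t *\<^sub>R z"]
        by (simp add: bop_scaleR [OF b2] scaleR_cinner_right power_mult_distrib algebra_simps)
    qed simp
    then have "\<bar>Re (cinner (Y v) z)\<bar>\<^sup>2 \<le> (norm (D1 v) * norm (D2 z))\<^sup>2"
      by (simp add: power_mult_distrib mult.commute)
    then show ?thesis by (rule power2_le_imp_le) simp
  qed
  obtain c where c: "c \<ge> 0" "\<And>x. norm (D1 x) \<le> c * norm x" using bop_bound [OF b1] by blast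
  \<comment> \<open>The crude constant \<open>c\<close> suffices here; the sharp one is recovered
    from the inequality for \<open>F\<close>.\<close>
  have "norm (adj Y z) \<le> c * norm (D2 z)" for z
  proof (cases "adj Y z = 0")
    case False
    have "(norm (adj Y z))\<^sup>2 = Re (cinner (Y (adj Y z)) z)" by (simp add: cinner_adj(1) [OF Y] cinner_self)
    also have "\<dots> \<le> norm (D1 (adj Y z)) * norm (D2 z)" using bound [of "adj Y z" z] by linarith
    also have "\<dots> \<le> c * norm (adj Y z) * norm (D2 z)" by (intro mult_right_mono c) simp
    finally have "norm (adj Y z) * norm (adj Y z) \<le> norm (adj Y z) * (c * norm (D2 z))"
      by (simp add: power2_eq_square mult_ac)
    then show ?thesis using False by simp
  qed (use c in simp)
  from douglas_factorisation [OF bop_adj [OF Y] b2 c(1) this]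
  obtain E where E: "bop E" "\<And>z. E (D2 z) = adj Y z" "\<And>z. E (proj_onto (closure (range D2)) z) = E z" by blast
  have M: "closed (closure (range D2))" "complex_vector.subspace (closure (range D2))"
    using subspace_closure [OF subspace_range [OF b2]] by simp_all
  define F where "F = adj E"
  have F: "bop F" unfolding F_def by (rule bop_adj [OF E(1)])
  have FE: "cinner (F v) w = cinner v (E w)" for v w
    unfolding F_def by (metis cinner_adj(2) [OF E(1)])
  have YF: "Y v = D2 (F v)" for v
    by (rule cinner_eqI_left) (simp add: selfadjoint_cinner [OF D2] FE E(2) cinner_adj(1) [OF Y])
  have "proj_onto (closure (range D2)) (F v) = F v" for v
    by (rule cinner_eqI_left) (simp add: selfadjoint_cinner [OF selfadjoint_proj_onto [OF M]] FE E(3))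
  then have Fin: "F v \<in> closure (range D2)" for v by (simp add: proj_onto_iff [OF M])
  have "norm (F v) \<le> 1 * norm (D1 v)" for v
  proof (cases "F v = 0")
    case False
    have "closure (range D2) \<subseteq> {e. Re (cinner (F v) e) \<le> norm (D1 v) * norm e}"
    proof (rule closure_minimal)
      show "closed {e. Re (cinner (F v) e) \<le> norm (D1 v) * norm e}"
        by (intro closed_Collect_le continuous_intros cinner.continuous_on)
      show "range D2 \<subseteq> {e. Re (cinner (F v) e) \<le> norm (D1 v) * norm e}"
      proof clarify
        fix z
        have "cinner (F v) (D2 z) = cinner (Y v) z" by (simp add: YF selfadjoint_cinner [OF D2])
        then show "Re (cinner (F v) (D2 z)) \<le> norm (D1 v) * norm (D2 z)" using bound [of v z] by simp
      qed
    qed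
    then have "Re (cinner (F v) (F v)) \<le> norm (D1 v) * norm (F v)" using Fin by blast
    then have "norm (F v) * norm (F v) \<le> norm (D1 v) * norm (F v)" by (simp add: cinner_self power2_eq_square)
    then show ?thesis using False by simp
  qed simp
  from douglas_factorisation [OF F b1 _ this]
  obtain G where G: "bop G" "\<And>v. G (D1 v) = F v" "\<And>x. norm (G x) \<le> 1 * norm x" "\<And>x. G x \<in> closure (range F)"
    by auto
  have "closure (range F) \<subseteq> closure (range D2)"
    by (rule closure_minimal) (use Fin in auto)
  with G YF show ?thesis by (intro exI [of _ G]) auto
qed

section \<open>The correspondence\<close>

lemma
  fixes J :: "'a::chilbert_space \<Rightarrow> 'a"
  assumes "symmetry J"
  shows symmetry_selfadjoint: "selfadjoint J" and symmetry_involution: "J (J x) = x"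
  using assms surj_f_inv_f [of J x] by (auto simp: symmetry_def selfadjoint_iff bij_is_surj)

lemma krein_pair_defect:
  fixes J1 :: "'h1::chilbert_space \<Rightarrow> 'h1" and J2 :: "'h2::chilbert_space \<Rightarrow> 'h2"
  assumes "selfadjoint J1" "\<And>x. J1 (J1 x) = x" "selfadjoint J2" "\<And>x. J2 (J2 x) = x" and T: "bop T"
  shows "krein_pair J1 J2 T (adj T) (defect_form J1 J2 T) (defect_form_star J1 J2 T)"
  by (rule krein_pair.intro)
     (use assms adjoint_pair_adj [OF T] in \<open>auto simp: defect_form_def [abs_def] defect_form_star_def [abs_def]\<close>)

lemma selfadjoint_map_prod:
  assumes "selfadjoint J" "selfadjoint J'"
  shows "selfadjoint (map_prod J J')"
proof (rule selfadjointI)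
  have "bop (\<lambda>p. (J (fst p), J' (snd p)))"
    by (intro bop_Pair bop_compose [OF selfadjoint_bop [OF assms(1)] bop_fst] bop_compose [OF selfadjoint_bop [OF assms(2)] bop_snd])
  then show "bop (map_prod J J')" by (simp add: map_prod_def case_prod_beta')
  show "cinner (map_prod J J' p) q = cinner p (map_prod J J' q)" for p q
    by (cases p; cases q) (simp add: cinner_Pair selfadjoint_cinner [OF assms(1)] selfadjoint_cinner [OF assms(2)])
qed

locale krein_quadruple = julia J1 J2 T Ts A B R
  for J1 :: "'h1::chilbert_space \<Rightarrow> 'h1" and J2 :: "'h2::chilbert_space \<Rightarrow> 'h2" and T Ts A B R +
  fixes J1' :: "'k1::chilbert_space \<Rightarrow> 'k1" and J2' :: "'k2::chilbert_space \<Rightarrow> 'k2"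
  assumes J1': "selfadjoint J1'" "J1' (J1' v) = v" and J2': "selfadjoint J2'" "J2' (J2' z) = z"
begin

lemma Ts_eq: "Ts = adj T"
  using adj_eqI [OF Ts bop_Ts] by simp

lemma A_eq: "defect_form J1 J2 T = A" and B_eq: "defect_form_star J1 J2 T = B"
  unfolding defect_form_def defect_form_star_def A_def B_def Ts_eq by simp_all

abbreviation "J1t \<equiv> map_prod J1 J1'"
abbreviation "J2t \<equiv> map_prod J2 J2'"
abbreviation "Xt Tt \<equiv> defect_form J1t J2t Tt"
abbreviation "Xts Tt \<equiv> defect_form_star J1t J2t Tt"

lemma krein_pair_sum: "bop Tt \<Longrightarrow> krein_pair J1t J2t Tt (adj Tt) (Xt Tt) (Xts Tt)"
  by (rule krein_pair_defect)
     (auto simp: selfadjoint_map_prod J1 J2 J1' J2' split: prod.splits)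

lemma XX_form:
  assumes Tt: "bop Tt"
  shows "Re (cinner (Xt Tt (x, v)) (x, v)) = Re (cinner (J1 x) x) + Re (cinner (J1' v) v)
    - Re (cinner (J2 (fst (Tt (x, v)))) (fst (Tt (x, v)))) - Re (cinner (J2' (snd (Tt (x, v)))) (snd (Tt (x, v))))"
  by (simp add: defect_form_def cinner.diff_left cinner_Pair flip: cinner_adj(2) [OF Tt])
     (simp add: cinner_prod_def)

lemma XXs_form:
  assumes Tt: "bop Tt"
  shows "Re (cinner (Xts Tt (y, z)) (y, z)) = Re (cinner (J2 y) y) + Re (cinner (J2' z) z)
    - Re (cinner (J1 (fst (adj Tt (y, z)))) (fst (adj Tt (y, z)))) - Re (cinner (J1' (snd (adj Tt (y, z)))) (snd (adj Tt (y, z))))"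
  by (simp add: defect_form_star_def cinner.diff_left cinner_Pair cinner_adj(1) [OF Tt])
     (simp add: cinner_prod_def)

section \<open>Completions with prescribed parameters\<close>

text \<open>\<open>G1\<close> and \<open>G2\<close> live on whole spaces and \<open>Y\<close> is
  still arbitrary. The link term is merged with \<open>G2 D\<close>, so that \<open>G2\<close> is
  applied to the second output of the Julia operator.\<close>

definition completed :: "('k1 \<Rightarrow> 'h2) \<Rightarrow> ('h1 \<Rightarrow> 'k2) \<Rightarrow> ('k1 \<Rightarrow> 'k2) \<Rightarrow> 'h1 \<times> 'k1 \<Rightarrow> 'h2 \<times> 'k2"
  where "completed G1 G2 Y p = (T (fst p) + Ds (G1 (snd p)), G2 (D (fst p) - R (Ss (G1 (snd p)))) + Y (snd p))"

lemma bop_completed: "bop G1 \<Longrightarrow> bop G2 \<Longrightarrow> bop Y \<Longrightarrow> bop (completed G1 G2 Y)"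
proof -
  assume G: "bop G1" "bop G2" "bop Y"
  note c = bop_compose [OF G(1) bop_snd]
  show ?thesis
    unfolding completed_def [abs_def]
    by (intro bop_Pair bop_plus bop_compose [OF T bop_fst] bop_compose [OF bops(10) c] bop_compose [OF G(3) bop_snd]
        bop_compose [OF G(2) bop_sub] bop_compose [OF bops(9) bop_fst] bop_compose [OF R bop_compose [OF bops(8) c]])
qed

lemma adj_completed:
  assumes G: "bop G1" "bop G2" "bop Y"
  shows "adj (completed G1 G2 Y) =
    (\<lambda>p. (Ts (fst p) + D (adj G2 (snd p)), adj G1 (Ds (fst p) - Ss (L (adj G2 (snd p)))) + adj Y (snd p)))"
    (is "_ = ?B")
proof -
  have "adjoint_pair (completed G1 G2 Y) ?B"
    unfolding adjoint_pair_def
  proof (intro allI)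
    fix p :: "'h1 \<times> 'k1" and q :: "'h2 \<times> 'k2"
    have "cinner (G2 (R (Ss (G1 (snd p))))) (snd q) = cinner (snd p) (adj G1 (Ss (L (adj G2 (snd q)))))"
      by (simp add: cinner_adj(1) [OF G(1)] cinner_adj(1) [OF G(2)] RL
          selfadjoint_cinner [OF selfadjoint_sign [OF selfadjoint_B]])
    then show "cinner (completed G1 G2 Y p) q = cinner p (?B q)"
      by (simp add: cinner_prod_def completed_def cinner_add_left cinner_add_right
          bop_diff [OF G(2)] bop_diff [OF bop_adj [OF G(1)]] cinner.diff_left cinner.diff_right
          adjoint_pairD [OF Ts] selfadjoint_cinner [OF selfadjoint_mod_root [OF selfadjoint_A]]
          selfadjoint_cinner [OF selfadjoint_mod_root [OF selfadjoint_B]]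
          cinner_adj(1) [OF G(1)] cinner_adj(1) [OF G(2)] cinner_adj(1) [OF G(3)])
  qed
  then show ?thesis using adj_eqI bop_of_adjoint_pair [OF bop_completed [OF G]] by blast
qed

text \<open>Together with \<open>form2\<close> the contraction forms with ordinary adjoints; they
  agree with \<open>contraction_form\<close> when the values lie in the defect spaces.\<close>

definition form1 :: "('k1 \<Rightarrow> 'h2) \<Rightarrow> 'k1 \<Rightarrow> 'k1"
  where "form1 G1 = (\<lambda>v. J1' v - adj G1 (Ss (G1 v)))"
definition form2 :: "('h1 \<Rightarrow> 'k2) \<Rightarrow> 'k2 \<Rightarrow> 'k2"
  where "form2 G2 = (\<lambda>z. J2' z - G2 (S (adj G2 z)))"

lemma form1_form:
  assumes "bop G1"
  shows "Re (cinner (form1 G1 v) v) = Re (cinner (J1' v) v) - Re (cinner (Ss (G1 v)) (G1 v))"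
  by (simp add: form1_def cinner.diff_left flip: cinner_adj(2) [OF assms])

lemma form2_form:
  assumes "bop G2"
  shows "Re (cinner (form2 G2 z) z) = Re (cinner (J2' z) z) - Re (cinner (S (adj G2 z)) (adj G2 z))"
  by (simp add: form2_def cinner.diff_left cinner_adj(1) [OF assms])

lemma selfadjoint_form1:
  assumes G: "bop G1" shows "selfadjoint (form1 G1)"
proof (rule selfadjointI)
  show "bop (form1 G1)" unfolding form1_def
    by (rule bop_sub [OF selfadjoint_bop [OF J1'(1)] bop_compose [OF bop_adj [OF G] bop_compose [OF bops(8) G]]])
  show "cinner (form1 G1 v) w = cinner v (form1 G1 w)" for v w
    by (simp add: form1_def cinner.diff_left cinner.diff_right selfadjoint_cinner [OF J1'(1)]
        selfadjoint_cinner [OF selfadjoint_sign [OF selfadjoint_B]] cinner_adj(1) [OF G, symmetric] cinner_adj(2) [OF G, symmetric])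
qed

lemma selfadjoint_form2:
  assumes G: "bop G2" shows "selfadjoint (form2 G2)"
proof (rule selfadjointI)
  show "bop (form2 G2)" unfolding form2_def
    by (rule bop_sub [OF selfadjoint_bop [OF J2'(1)] bop_compose [OF G bop_compose [OF bops(7) bop_adj [OF G]]]])
  show "cinner (form2 G2 v) w = cinner v (form2 G2 w)" for v w
    by (simp add: form2_def cinner.diff_left cinner.diff_right selfadjoint_cinner [OF J2'(1)]
        selfadjoint_cinner [OF selfadjoint_sign [OF selfadjoint_A]] cinner_adj(1) [OF G] cinner_adj(2) [OF G])
qed

context
  fixes G1 :: "'k1 \<Rightarrow> 'h2" and G2 :: "'h1 \<Rightarrow> 'k2" and Y :: "'k1 \<Rightarrow> 'k2"
  assumes G1: "bop G1" "\<And>v. G1 v \<in> mod_space B" and G2: "bop G2" "\<And>z. adj G2 z \<in> mod_space A" and Y: "bop Y"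
begin

lemma completion_data:
  "julia_completion J1 J2 T Ts A B R J1' J2' G1 G2 (adj G2) Y (Xt (completed G1 G2 Y))"
proof (intro julia_completion.intro julia_completion_axioms.intro)
  show "julia J1 J2 T Ts A B R" by unfold_locales
  show "selfadjoint (Xt (completed G1 G2 Y))"
    by (rule krein_pair.selfadjoint_A [OF krein_pair_sum [OF bop_completed [OF G1(1) G2(1) Y]]])
qed (simp_all add: J1' J2' selfadjoint_bop G1 G2 Y adjoint_pair_adj XX_form bop_completed completed_def)

text \<open>The adjoint of a completed operator has the same shape for \<open>Ts\<close>, with
  parameters \<open>adj G2\<close>, \<open>adj G1\<close>, \<open>adj Y\<close>. The inner sign in
  \<open>Ss L S\<close> cancels, because the operator is applied to
  \<open>S (adj G2 z)\<close>.\<close>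

lemma completion_data_dual:
  "julia_completion J2 J1 Ts T B A (\<lambda>x. Ss (L (S x))) J2' J1' (adj G2) (adj G1) G1 (adj Y) (Xts (completed G1 G2 Y))"
proof (intro julia_completion.intro julia_completion_axioms.intro)
  show "julia J2 J1 Ts T B A (\<lambda>x. Ss (L (S x)))" by (rule julia_dual)
  show "selfadjoint (Xts (completed G1 G2 Y))"
    by (rule krein_pair.selfadjoint_B [OF krein_pair_sum [OF bop_completed [OF G1(1) G2(1) Y]]])
  show "adjoint_pair (adj G1) G1" by (rule adjoint_pair_sym [OF adjoint_pair_adj [OF G1(1)]])
qed (simp_all add: J1' J2' selfadjoint_bop G1 G2 Y bop_adj XXs_form bop_completed adj_completed
      sign_sign [OF selfadjoint_A])

lemma completed_index_eq:
  assumes "\<And>v z. 0 \<le> Re (cinner (form1 G1 v) v) + 2 * Re (cinner (Y v) z) + Re (cinner (form2 G2 z) z)"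
  shows "nu_minus (Xt (completed G1 G2 Y)) + nu_minus J2' = nu_minus A"
    and "nu_minus (Xts (completed G1 G2 Y)) + nu_minus J1' = nu_minus B"
proof -
  note Q = assms [unfolded form1_form [OF G1(1)] form2_form [OF G2(1)]]
  interpret c: julia_completion J1 J2 T Ts A B R J1' J2' G1 G2 "adj G2" Y "Xt (completed G1 G2 Y)"
    by (rule completion_data)
  interpret d: julia_completion J2 J1 Ts T B A "\<lambda>x. Ss (L (S x))" J2' J1' "adj G2" "adj G1" G1 "adj Y" "Xts (completed G1 G2 Y)"
    by (rule completion_data_dual)
  show "nu_minus (Xt (completed G1 G2 Y)) + nu_minus J2' = nu_minus A"
    by (rule c.index_eq) (use Q in \<open>simp add: c.residual_form_def algebra_simps\<close>)
  show "nu_minus (Xts (completed G1 G2 Y)) + nu_minus J1' = nu_minus B"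
  proof (rule d.index_eq)
    fix z v
    have "Re (cinner (adj Y z) v) = Re (cinner (Y v) z)"
      using cinner_adj(1) [OF Y, of v z] Re_cinner_commute [of v "adj Y z"] by simp
    then show "0 \<le> d.residual_form z v" using Q [of v z] by (simp add: d.residual_form_def)
  qed
qed

lemma completed_nonneg:
  assumes "nu_minus A = enat k" "nu_minus (Xt (completed G1 G2 Y)) + nu_minus J2' \<le> enat k"
  shows "0 \<le> Re (cinner (form1 G1 v) v) + 2 * Re (cinner (Y v) z) + Re (cinner (form2 G2 z) z)"
  using julia_completion.residual_form_nonneg [OF completion_data assms, of v z]
  by (simp add: julia_completion.residual_form_def [OF completion_data] form1_form [OF G1(1)] form2_form [OF G2(1)])

end

text \<open>On the first component the defect form of \<open>Tt\<close> is that of \<open>A\<close>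
  minus the \<open>J2'\<close>-form of the lower left entry, so \<open>factor_bound\<close> and
  Douglas factorisation give \<open>G2\<close>. The upper right entry is reached as the lower left
  entry of the adjoint, which gives \<open>G1\<close>.\<close>

lemma solution_completed:
  assumes Tt: "bop Tt" "\<And>x. fst (Tt (x, 0)) = T x"
    and A: "nu_minus A = enat k" "nu_minus (Xt Tt) + nu_minus J2' \<le> enat k"
    and B: "nu_minus B = enat l" "nu_minus (Xts Tt) + nu_minus J1' \<le> enat l"
  shows "\<exists>G1 G2 Y. bop G1 \<and> (\<forall>v. G1 v \<in> mod_space B) \<and> bop G2 \<and> (\<forall>x. G2 (proj_onto (mod_space A) x) = G2 x) \<and>
    bop Y \<and> Tt = completed G1 G2 Y"
proof -
  note kp = krein_pair_sum [OF Tt(1)]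
  note sX = krein_pair.selfadjoint_A [OF kp] and sXs = krein_pair.selfadjoint_B [OF kp]
  note bTs = bop_adj [OF Tt(1)]
  define C where "C x = snd (Tt (x, 0))" for x
  define C' where "C' y = snd (adj Tt (y, 0))" for y
  have C: "bop C" unfolding C_def [abs_def] by (rule bop_compose [OF bop_snd bop_compose [OF Tt(1) bop_inl]])
  have C': "bop C'" unfolding C'_def [abs_def] by (rule bop_compose [OF bop_snd bop_compose [OF bTs bop_inl]])
  have adj0: "fst (adj Tt (y, 0)) = Ts y" for y
  proof (rule cinner_eqI)
    fix x
    have "cinner x (fst (adj Tt (y, 0))) = cinner (x, 0) (adj Tt (y, 0))" by (simp add: cinner_prod_def)
    also have "\<dots> = cinner (Tt (x, 0)) (y, 0)" by (rule cinner_adj(1) [OF Tt(1), symmetric])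
    also have "\<dots> = cinner x (Ts y)" by (simp add: cinner_prod_def Tt(2) adjoint_pairD [OF Ts])
    finally show "cinner x (fst (adj Tt (y, 0))) = cinner x (Ts y)" .
  qed
  have fA: "Re (cinner (Xt Tt (x, 0)) (x, 0)) = Re (cinner (A x) x) - Re (cinner (J2' (C x)) (C x))" for x
    by (simp add: XX_form [OF Tt(1)] Tt(2) C_def A_def cinner.diff_left adjoint_pairD [OF adjoint_pair_sym [OF Ts]])
  have fB: "Re (cinner (Xts Tt (y, 0)) (y, 0)) = Re (cinner (B y) y) - Re (cinner (J1' (C' y)) (C' y))" for y
    by (simp add: XXs_form [OF Tt(1)] adj0 C'_def B_def cinner.diff_left adjoint_pairD [OF Ts])
  obtain K where K: "K \<ge> 0" "\<And>x. norm (C x) \<le> K * norm (D x)"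
    using factor_bound [OF selfadjoint_A J2' C sX bop_inl fA A] by blast
  obtain K' where K': "K' \<ge> 0" "\<And>x. norm (C' x) \<le> K' * norm (Ds x)"
    using factor_bound [OF selfadjoint_B J1' C' sXs bop_inl fB B] by blast
  obtain G2 where G2: "bop G2" "\<And>x. G2 (D x) = C x" "\<And>x. G2 (proj_onto (mod_space A) x) = G2 x"
    using douglas_factorisation [OF C bops(9) K] unfolding mod_space_def by blast
  obtain G1' where G1': "bop G1'" "\<And>x. G1' (Ds x) = C' x" "\<And>x. G1' (proj_onto (mod_space B) x) = G1' x"
    using douglas_factorisation [OF C' bops(10) K'] unfolding mod_space_def by blast
  define G1 where "G1 = adj G1'"
  have G1: "bop G1" unfolding G1_def by (rule bop_adj [OF G1'(1)])
  have G1c: "cinner (G1 v) y = cinner v (G1' y)" for v y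
    unfolding G1_def by (rule cinner_adj(2) [OF G1'(1), symmetric])
  have "proj_onto (mod_space B) (G1 v) = G1 v" for v
    by (rule cinner_eqI_left)
       (simp add: selfadjoint_cinner [OF selfadjoint_proj_onto [OF mod_space [OF selfadjoint_B]]] G1c G1'(3))
  then have G1in: "G1 v \<in> mod_space B" for v by (simp add: proj_onto_iff [OF mod_space [OF selfadjoint_B]])
  have fst0: "fst (Tt (0, v)) = Ds (G1 v)" for v
  proof (rule cinner_eqI_left)
    fix y
    have "cinner (fst (Tt (0, v))) y = cinner (Tt (0, v)) (y, 0)" by (simp add: cinner_prod_def)
    also have "\<dots> = cinner (0, v) (adj Tt (y, 0))" by (rule cinner_adj(1) [OF Tt(1)])
    also have "\<dots> = cinner v (C' y)" by (simp add: cinner_prod_def C'_def)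
    also have "\<dots> = cinner (Ds (G1 v)) y"
      by (simp add: selfadjoint_cinner [OF selfadjoint_mod_root [OF selfadjoint_B]] G1c G1'(2))
    finally show "cinner (fst (Tt (0, v))) y = cinner (Ds (G1 v)) y" .
  qed
  \<comment> \<open>What remains of the lower right entry once the term prescribed by the link
    operator is removed.\<close>
  define Y where "Y v = snd (Tt (0, v)) + G2 (R (Ss (G1 v)))" for v
  have Y: "bop Y" unfolding Y_def [abs_def]
    by (rule bop_plus [OF bop_compose [OF bop_snd bop_compose [OF Tt(1) bop_inr]]
        bop_compose [OF G2(1) bop_compose [OF R bop_compose [OF bops(8) G1]]]])
  have "Tt = completed G1 G2 Y"
  proof
    fix p
    have "Tt p = Tt (fst p, 0) + Tt (0, snd p)" by (simp flip: bop_add [OF Tt(1)])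
    then show "Tt p = completed G1 G2 Y p"
      by (simp add: completed_def prod_eq_iff Tt(2) fst0 bop_diff [OF G2(1)] G2(2) Y_def C_def)
  qed
  with G1 G1in G2 Y show ?thesis by blast
qed

section \<open>The notions of the statement in terms of \<open>mod_root\<close> and
  \<open>mod_space\<close>\<close>

lemma defect_space_eq: "defect_space J1 J2 T = mod_space A" "defect_space_star J1 J2 T = mod_space B"
  and defect_op_eq: "defect_op J1 J2 T = D" "defect_op_star J1 J2 T = Ds"
  and defect_sign_eq: "defect_sign J1 J2 T = S" "defect_sign_star J1 J2 T = Ss"
  by (simp_all add: defect_space_def defect_space_star_def defect_op_def defect_op_star_def
      defect_sign_def defect_sign_star_def mod_space_def mod_root_def A_eq B_eq)

lemma mod_spaces: "closed (mod_space A)" "complex_vector.subspace (mod_space A)"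
  "closed (mod_space B)" "complex_vector.subspace (mod_space B)"
  using mod_space [OF selfadjoint_A] mod_space [OF selfadjoint_B] by simp_all

text \<open>\<open>Ds\<close> is injective on its defect space, so the defining equation of the link
  operator has at most one solution.\<close>

lemma link_op_eq: "link_op J1 J2 T = restrict L (mod_space A)"
  unfolding link_op_def defect_space_eq defect_op_eq
proof (rule the_equality)
  show r: "restrict L (mod_space A) \<in> bops (mod_space A) (mod_space B) \<and>
    (\<forall>x\<in>mod_space A. Ds (restrict L (mod_space A) x) = T (J1 (D x)))"
    using restrict_in_bops [OF bop_L mod_spaces(2) L_in] by (simp add: root_L)
  fix L' assume L': "L' \<in> bops (mod_space A) (mod_space B) \<and> (\<forall>x\<in>mod_space A. Ds (L' x) = T (J1 (D x)))"
  show "L' = restrict L (mod_space A)"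
  proof (rule bops_eqI [OF conjunct1 [OF L'] conjunct1 [OF r]])
    fix x assume x: "x \<in> mod_space A"
    have "L' x - L x = 0"
    proof (rule mod_root_eq_0_on_mod_space [OF selfadjoint_B])
      show "L' x - L x \<in> mod_space B"
        using bops_in [OF conjunct1 [OF L'] x] by (intro complex_vector.subspace_diff mod_spaces L_in)
      show "Ds (L' x - L x) = 0" using L' x by (simp add: bop_diff [OF bops(10)] root_L)
    qed
    then show "L' x = restrict L (mod_space A) x" using x by simp
  qed
qed

lemma adj_link_op: "adj_on (mod_space A) (mod_space B) (link_op J1 J2 T) = restrict R (mod_space B)"
proof -
  have "restrict L (mod_space A) \<in> bops (mod_space A) (mod_space B)"
    by (rule restrict_in_bops [OF bop_L mod_spaces(2) L_in])
  from adj_on_eq_restrict [OF mod_spaces(1,2) this mod_spaces(4)]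
  have "adj_on (mod_space A) (mod_space B) (link_op J1 J2 T)
      = restrict (adj (\<lambda>x. L (proj_onto (mod_space A) x))) (mod_space B)"
    by (simp add: link_op_eq proj_onto_in [OF mod_spaces(1,2)])
  also have "adj (\<lambda>x. L (proj_onto (mod_space A) x)) = R"
    unfolding L_proj unfolding L_def by (rule adj_adj [OF R])
  finally show ?thesis .
qed

lemma contraction_form1:
  assumes "G1 \<in> bops UNIV (mod_space B)"
  shows "contraction_form J1' Ss (mod_space B) G1 = form1 G1"
proof
  fix v
  have "adj_on UNIV (mod_space B) G1 = restrict (adj G1) (mod_space B)"
    using adj_on_eq_restrict [OF closed_UNIV complex_vector.subspace_UNIV assms mod_spaces(4)] by (simp add: proj_onto_UNIV)
  then show "contraction_form J1' Ss (mod_space B) G1 v = form1 G1 v"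
    by (simp add: contraction_form_def form1_def sign_in_mod_space [OF selfadjoint_B] bops_UNIV_in [OF assms])
qed

text \<open>The second operator of a triplet is \<open>undefined\<close> off the defect space; this
  is its extension by zero.\<close>

abbreviation "ext2 G2 \<equiv> (\<lambda>x. G2 (proj_onto (mod_space A) x))"

lemma adj_on_ext2:
  fixes G2 :: "'h1 \<Rightarrow> 'k2"
  assumes "G2 \<in> bops (mod_space A) UNIV"
  shows "adj_on (mod_space A) UNIV G2 = adj (ext2 G2)"
  using adj_on_eq_restrict [OF mod_spaces(1,2) assms complex_vector.subspace_UNIV] by (simp add: restrict_def)

lemma adj_ext2_in:
  fixes G2 :: "'h1 \<Rightarrow> 'k2"
  assumes "bop G2" "\<And>x. G2 (proj_onto (mod_space A) x) = G2 x"
  shows "adj G2 z \<in> mod_space A"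
proof -
  have "proj_onto (mod_space A) (adj G2 z) = adj G2 z"
    by (rule cinner_eqI_left)
       (simp add: selfadjoint_cinner [OF selfadjoint_proj_onto [OF mod_spaces(1,2)]] assms(2) flip: cinner_adj(2) [OF assms(1)])
  then show ?thesis by (simp add: proj_onto_iff [OF mod_spaces(1,2)])
qed

lemma contraction_form2:
  assumes G2: "G2 \<in> bops (mod_space A) UNIV"
  shows "contraction_form J2' S (mod_space A) (adj (ext2 G2)) = form2 (ext2 G2)"
proof
  fix z
  note b = bop_extension [OF mod_spaces(1,2) G2]
  have adj_in: "adj (ext2 G2) z \<in> mod_space A" for z
    by (rule adj_ext2_in [OF b]) (simp add: proj_onto_id [OF mod_spaces(1,2) proj_onto_in [OF mod_spaces(1,2)]])
  have "adj (ext2 G2) \<in> bops UNIV (mod_space A)"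
    by (rule bops_UNIVI [OF bop_adj [OF b] adj_in])
  from adj_on_eq_restrict [OF closed_UNIV complex_vector.subspace_UNIV this mod_spaces(2)]
  have "adj_on UNIV (mod_space A) (adj (ext2 G2)) = restrict (ext2 G2) (mod_space A)"
    by (simp add: proj_onto_UNIV adj_adj [OF b])
  then show "contraction_form J2' S (mod_space A) (adj (ext2 G2)) z = form2 (ext2 G2) z"
    using sign_in_mod_space [OF selfadjoint_A adj_in] by (simp add: contraction_form_def form2_def)
qed

abbreviation "D1 G1 \<equiv> sqrt_op (form1 G1)"
abbreviation "D2 G2 \<equiv> sqrt_op (form2 G2)"

lemma mem_parameter_triplets:
  "(G1, G2, G) \<in> parameter_triplets J1 J1' J2 J2' T \<longleftrightarrow>
    G1 \<in> bops UNIV (mod_space B) \<and> positive_op (form1 G1) \<and>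
    G2 \<in> bops (mod_space A) UNIV \<and> positive_op (form2 (ext2 G2)) \<and>
    G \<in> bops (closure (range (D1 G1))) (closure (range (D2 (ext2 G2)))) \<and>
    (\<forall>x\<in>closure (range (D1 G1)). norm (G x) \<le> norm x)"
proof -
  have adj_in: "adj (ext2 G2) \<in> bops UNIV (mod_space A)" if G2: "G2 \<in> bops (mod_space A) UNIV"
    by (rule bops_UNIVI [OF bop_adj adj_ext2_in]; (rule bop_extension [OF mod_spaces(1,2) G2])?)
       (simp add: proj_onto_id [OF mod_spaces(1,2) proj_onto_in [OF mod_spaces(1,2)]])
  show ?thesis
    unfolding parameter_triplets_def Let_def defect_space_eq defect_sign_eq J_contraction_def
      contraction_defect_space_def contraction_defect_op_def
    using adj_in by (auto simp: contraction_form1 contraction_form2 adj_on_ext2)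
qed

lemma block_completion_eq:
  assumes P: "(G1, G2, G) \<in> parameter_triplets J1 J1' J2 J2' T"
  shows "block_completion J1 J1' J2 J2' T (G1, G2, G) = completed G1 (ext2 G2) (\<lambda>v. D2 (ext2 G2) (G (D1 G1 v)))"
proof
  fix p :: "'h1 \<times> 'k1"
  obtain x v where p: "p = (x, v)" by fastforce
  from P have G1: "G1 \<in> bops UNIV (mod_space B)" and G2: "G2 \<in> bops (mod_space A) UNIV"
    by (simp_all add: mem_parameter_triplets)
  have in1: "Ss (G1 v) \<in> mod_space B"
    by (rule sign_in_mod_space [OF selfadjoint_B bops_UNIV_in [OF G1]])
  have pr: "proj_onto (mod_space A) (R y) = R y" "proj_onto (mod_space A) (D w) = D w" for y w
    by (simp_all add: proj_onto_id [OF mod_spaces(1,2)] R_in mod_root_in_mod_space [OF selfadjoint_A])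
  have "ext2 G2 (D x - R (Ss (G1 v))) = ext2 G2 (D x) - ext2 G2 (R (Ss (G1 v)))"
    by (rule bop_diff [OF bop_extension [OF mod_spaces(1,2) G2]])
  then have d: "ext2 G2 (D x - R (Ss (G1 v))) = G2 (D x) - G2 (R (Ss (G1 v)))"
    by (simp add: pr)
  show "block_completion J1 J1' J2 J2' T (G1, G2, G) p = completed G1 (ext2 G2) (\<lambda>v. D2 (ext2 G2) (G (D1 G1 v))) p"
    unfolding block_completion_def Let_def defect_space_eq defect_sign_eq defect_op_eq
      contraction_defect_op_def adj_link_op adj_on_ext2 [OF G2] contraction_form1 [OF G1] contraction_form2 [OF G2]
    using in1 by (simp add: p completed_def d adj_on_ext2 [OF G2] contraction_form1 [OF G1] contraction_form2 [OF G2])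
qed

section \<open>Solvability and bijectivity for indices given as natural numbers\<close>

context
  fixes k l b a :: nat
  assumes nu: "nu_minus A = enat k" "nu_minus B = enat l" "nu_minus J2' = enat b" "nu_minus J1' = enat a"
    and le: "b \<le> k" "a \<le> l"
begin

lemma block_completion_solution:
  assumes P: "(G1, G2, G) \<in> parameter_triplets J1 J1' J2 J2' T"
  shows "block_completion J1 J1' J2 J2' T (G1, G2, G) \<in> completion_solutions J1 J1' J2 J2' T (enat (k - b)) (enat (l - a))"
proof -
  from P have G1: "G1 \<in> bops UNIV (mod_space B)" and p1: "positive_op (form1 G1)"
    and G2: "G2 \<in> bops (mod_space A) UNIV" and p2: "positive_op (form2 (ext2 G2))"
    and G: "G \<in> bops (closure (range (D1 G1))) (closure (range (D2 (ext2 G2))))"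
    and contr: "\<And>x. x \<in> closure (range (D1 G1)) \<Longrightarrow> norm (G x) \<le> norm x"
    by (auto simp: mem_parameter_triplets)
  note bG1 = bops_UNIV_bop [OF G1] and bG2 = bop_extension [OF mod_spaces(1,2) G2]
  have adj_in: "adj (ext2 G2) z \<in> mod_space A" for z
    by (rule adj_ext2_in [OF bG2]) (simp add: proj_onto_id [OF mod_spaces(1,2) proj_onto_in [OF mod_spaces(1,2)]])
  note d1 = positive_op_bop [OF positive_sqrt_op [OF p1]] and s2 = positive_op_selfadjoint [OF positive_sqrt_op [OF p2]]
  let ?M1 = "closure (range (D1 G1))"
  have M1: "closed ?M1" "complex_vector.subspace ?M1" using subspace_closure [OF subspace_range [OF d1]] by simp_all
  have D1_in: "D1 G1 v \<in> ?M1" for v by (rule subsetD [OF closure_subset rangeI])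
  define Y where "Y = (\<lambda>v. D2 (ext2 G2) (G (D1 G1 v)))"
  have "bop (\<lambda>v. D2 (ext2 G2) (G (proj_onto ?M1 (D1 G1 v))))"
    by (rule bop_compose [OF selfadjoint_bop [OF s2] bop_compose [OF bop_extension [OF M1 G] d1]])
  then have Y: "bop Y" by (simp add: Y_def proj_onto_id [OF M1 D1_in])
  have "0 \<le> Re (cinner (form1 G1 v) v) + 2 * Re (cinner (Y v) z) + Re (cinner (form2 (ext2 G2) z) z)" for v z
  proof -
    let ?g = "G (D1 G1 v)"
    \<comment> \<open>The residual form dominates a square because \<open>G\<close> is a
      contraction, which replaces \<open>|?g|\<close> by \<open>|D1 G1 v|\<close>.\<close>
    have "0 \<le> (norm (?g + D2 (ext2 G2) z))\<^sup>2" by simp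
    also have "\<dots> = (norm ?g)\<^sup>2 + 2 * Re (cinner (Y v) z) + (norm (D2 (ext2 G2) z))\<^sup>2"
      by (simp add: norm_add_sq Y_def selfadjoint_cinner [OF s2])
    also have "(norm ?g)\<^sup>2 \<le> (norm (D1 G1 v))\<^sup>2" by (intro power_mono contr D1_in) simp
    finally show ?thesis by (simp add: norm_sqrt_op [OF p1] norm_sqrt_op [OF p2])
  qed
  from completed_index_eq [OF bG1 bops_UNIV_in [OF G1] bG2 adj_in Y this]
  have "nu_minus (Xt (completed G1 (ext2 G2) Y)) + enat b = enat k"
    "nu_minus (Xts (completed G1 (ext2 G2) Y)) + enat a = enat l"
    by (simp_all add: nu)
  \<comment> \<open>Cancellation in \<open>enat\<close> is legitimate because \<open>b\<close> and
    \<open>a\<close> are finite.\<close>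
  then have "nu_minus (Xt (completed G1 (ext2 G2) Y)) = enat (k - b)"
    "nu_minus (Xts (completed G1 (ext2 G2) Y)) = enat (l - a)"
    by (cases "nu_minus (Xt (completed G1 (ext2 G2) Y))"; cases "nu_minus (Xts (completed G1 (ext2 G2) Y))"; auto)+
  moreover have "bop (completed G1 (ext2 G2) Y)" by (rule bop_completed [OF bG1 bG2 Y])
  moreover have "fst (completed G1 (ext2 G2) Y (x, 0)) = T x" for x
    by (simp add: completed_def bop_zero [OF bG1] bop_zero [OF bops(10)])
  ultimately show ?thesis
    unfolding block_completion_eq [OF P] by (simp add: completion_solutions_def Y_def)
qed

lemma solution_block_completion:
  assumes "Tt \<in> completion_solutions J1 J1' J2 J2' T (enat (k - b)) (enat (l - a))"
  shows "\<exists>P\<in>parameter_triplets J1 J1' J2 J2' T. block_completion J1 J1' J2 J2' T P = Tt"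
proof -
  from assms have Tt: "bop Tt" "\<And>x. fst (Tt (x, 0)) = T x" "nu_minus (Xt Tt) = enat (k - b)" "nu_minus (Xts Tt) = enat (l - a)"
    by (auto simp: completion_solutions_def)
  \<comment> \<open>\<open>b \<le> k\<close> and \<open>a \<le> l\<close> rule out truncation in the
    differences.\<close>
  have idx: "nu_minus (Xt Tt) + nu_minus J2' \<le> enat k" "nu_minus (Xts Tt) + nu_minus J1' \<le> enat l"
    using le by (simp_all add: Tt nu)
  obtain G1 G2 Y where G1: "bop G1" "\<And>v. G1 v \<in> mod_space B"
    and G2: "bop G2" "\<And>x. G2 (proj_onto (mod_space A) x) = G2 x" and Y: "bop Y" and eq: "Tt = completed G1 G2 Y"
    using solution_completed [OF Tt(1,2) nu(1) idx(1) nu(2) idx(2)] by metis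
  note Q = completed_nonneg [OF G1 G2(1) adj_ext2_in [OF G2] Y nu(1) idx(1) [unfolded eq]]
  \<comment> \<open>Setting one of the two variables to zero leaves a diagonal entry of the
    nonnegative form.\<close>
  have p1: "positive_op (form1 G1)"
    by (rule positive_opI [OF selfadjoint_form1 [OF G1(1)]]) (use Q [of _ 0] in simp)
  have p2: "positive_op (form2 G2)"
    by (rule positive_opI [OF selfadjoint_form2 [OF G2(1)]]) (use Q [of 0] in \<open>simp add: bop_zero [OF Y]\<close>)
  note s1 = positive_op_selfadjoint [OF positive_sqrt_op [OF p1]] and s2 = positive_op_selfadjoint [OF positive_sqrt_op [OF p2]]
  have "0 \<le> (norm (D1 G1 v))\<^sup>2 + 2 * Re (cinner (Y v) z) + (norm (D2 G2 z))\<^sup>2" for v z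
    using Q [of v z] by (simp add: norm_sqrt_op [OF p1] norm_sqrt_op [OF p2])
  from contraction_factor [OF Y s1 s2 this]
  obtain G where G: "bop G" "\<And>v. Y v = D2 G2 (G (D1 G1 v))" "\<And>x. norm (G x) \<le> norm x" "\<And>x. G x \<in> closure (range (D2 G2))"
    by blast
  let ?M1 = "closure (range (D1 G1))"
  have D1_in: "D1 G1 v \<in> ?M1" for v by (rule subsetD [OF closure_subset rangeI])
  have e: "ext2 (restrict G2 (mod_space A)) = G2"
    by (simp add: proj_onto_in [OF mod_spaces(1,2)] G2(2))
  have mem: "(G1, restrict G2 (mod_space A), restrict G ?M1) \<in> parameter_triplets J1 J1' J2 J2' T"
    unfolding mem_parameter_triplets e
    using bops_UNIVI [OF G1] p1 p2 restrict_in_bops [OF G2(1) mod_spaces(2), of UNIV]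
      restrict_in_bops [OF G(1) subspace_closure [OF subspace_range [OF selfadjoint_bop [OF s1]]] G(4)] G(3)
    by simp
  have "block_completion J1 J1' J2 J2' T (G1, restrict G2 (mod_space A), restrict G ?M1) = Tt"
  proof -
    have "(\<lambda>v. D2 G2 (restrict G ?M1 (D1 G1 v))) = Y" using D1_in G(2) by auto
    then show ?thesis unfolding block_completion_eq [OF mem] e eq by simp
  qed
  with mem show ?thesis by blast
qed

text \<open>The entries determine the parameters one after another: \<open>Ds\<close> is injective
  on its defect space, the range of \<open>D\<close> is dense in the domain of \<open>G2\<close>,
  \<open>D2\<close> is injective on the closure of its range, and the range of \<open>D1\<close> is
  dense in the domain of \<open>G\<close>.\<close>

lemma inj_block_completion:
  "inj_on (block_completion J1 J1' J2 J2' T) (parameter_triplets J1 J1' J2 J2' T)"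
proof (rule inj_onI)
  fix p q
  assume pq: "p \<in> parameter_triplets J1 J1' J2 J2' T" "q \<in> parameter_triplets J1 J1' J2 J2' T"
    "block_completion J1 J1' J2 J2' T p = block_completion J1 J1' J2 J2' T q"
  obtain G1 G2 G where p: "p = (G1, G2, G)" by (cases p)
  obtain H1 H2 H where q: "q = (H1, H2, H)" by (cases q)
  note P = pq(1) [unfolded p] and P' = pq(2) [unfolded q]
  have eq: "completed G1 (ext2 G2) (\<lambda>v. D2 (ext2 G2) (G (D1 G1 v))) p
      = completed H1 (ext2 H2) (\<lambda>v. D2 (ext2 H2) (H (D1 H1 v))) p" for p
    using pq(3) unfolding p q block_completion_eq [OF P] block_completion_eq [OF P'] by simp
  from P have G: "G1 \<in> bops UNIV (mod_space B)" "positive_op (form1 G1)"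
      "G2 \<in> bops (mod_space A) UNIV" "positive_op (form2 (ext2 G2))"
      "G \<in> bops (closure (range (D1 G1))) (closure (range (D2 (ext2 G2))))"
    by (auto simp: mem_parameter_triplets)
  from P' have H: "H1 \<in> bops UNIV (mod_space B)" "H2 \<in> bops (mod_space A) UNIV"
      "H \<in> bops (closure (range (D1 H1))) (closure (range (D2 (ext2 H2))))"
    by (auto simp: mem_parameter_triplets)
  have D_pr: "proj_onto (mod_space A) (D x) = D x" for x
    by (simp add: proj_onto_id [OF mod_spaces(1,2)] mod_root_in_mod_space [OF selfadjoint_A])
  have 1: "G1 = H1"
  proof
    fix v
    have "G1 v - H1 v = 0"
    proof (rule mod_root_eq_0_on_mod_space [OF selfadjoint_B])
      show "G1 v - H1 v \<in> mod_space B"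
        by (intro complex_vector.subspace_diff mod_spaces bops_UNIV_in [OF G(1)] bops_UNIV_in [OF H(1)])
      show "Ds (G1 v - H1 v) = 0"
        using arg_cong [OF eq [of "(0, v)"], of fst] by (simp add: completed_def bop_diff [OF bops(10)])
    qed
    then show "G1 v = H1 v" by simp
  qed
  have 00: "D1 G1 0 = 0" by (rule bop_zero [OF positive_op_bop [OF positive_sqrt_op [OF G(2)]]])
  have zero: "K 0 = 0" if "K \<in> bops M N" "complex_vector.subspace M" for K :: "'k1 \<Rightarrow> 'k2" and M N
  proof -
    have "\<forall>c. \<forall>x\<in>M. K (c *\<^sub>C x) = c *\<^sub>C K x" using that(1) by (simp add: bops_def)
    from this [rule_format, of 0 0] show ?thesis using complex_vector.subspace_0 [OF that(2)] by simp
  qed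
  have sub1: "complex_vector.subspace (closure (range (D1 G1)))"
    by (intro subspace_closure subspace_range positive_op_bop positive_sqrt_op G(2))
  have pos2: "positive_op (form2 (ext2 H2))" using P' by (simp add: mem_parameter_triplets)
  \<comment> \<open>At \<open>(x, 0)\<close> the link term and the term with \<open>G\<close>
    vanish, so the lower output is \<open>G2 (D x)\<close>.\<close>
  have 2: "G2 = H2"
  proof (rule bops_eq_on_dense [OF bops(9) G(3) [unfolded mod_space_def] H(2) [unfolded mod_space_def]])
    fix x
    have "R (Ss (G1 0)) = 0"
      by (simp add: bop_zero [OF bops_UNIV_bop [OF G(1)]] bop_zero [OF bops(8)] bop_zero [OF R])
    moreover have "D2 (ext2 K2) (K (D1 G1 0)) = 0"
      if "K \<in> bops (closure (range (D1 G1))) N" "positive_op (form2 (ext2 K2))" for K K2 N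
      by (simp add: 00 zero [OF that(1) sub1] bop_zero [OF positive_op_bop [OF positive_sqrt_op [OF that(2)]]])
    ultimately show "G2 (D x) = H2 (D x)"
      using arg_cong [OF eq [of "(x, 0)"], of snd] G(4,5) H(3) pos2
      by (simp add: completed_def D_pr 1 [symmetric])
  qed
  have "G = H"
  proof (rule bops_eq_on_dense [OF positive_op_bop [OF positive_sqrt_op [OF G(2)]] G(5) H(3) [folded 1 2]])
    fix v
    note s = positive_op_selfadjoint [OF positive_sqrt_op [OF G(4)]]
    have in1: "D1 G1 v \<in> closure (range (D1 G1))" by (rule subsetD [OF closure_subset rangeI])
    have "G (D1 G1 v) - H (D1 G1 v) = 0"
    proof (rule selfadjoint_eq_0_on_closure_range [OF s])
      show "G (D1 G1 v) - H (D1 G1 v) \<in> closure (range (D2 (ext2 G2)))"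
        by (intro complex_vector.subspace_diff subspace_closure subspace_range selfadjoint_bop [OF s]
            bops_in [OF G(5) in1] bops_in [OF H(3) [folded 1 2] in1])
      show "D2 (ext2 G2) (G (D1 G1 v) - H (D1 G1 v)) = 0"
        using arg_cong [OF eq [of "(0, v)"], of snd]
        by (simp add: completed_def bop_diff [OF selfadjoint_bop [OF s]] 1 [symmetric] 2 [symmetric])
    qed
    then show "G (D1 G1 v) = H (D1 G1 v)" by simp
  qed
  with 1 2 show "p = q" by (simp add: p q)
qed

text \<open>Both J-contractions exist since \<open>b \<le> k\<close> and \<open>a \<le> l\<close>;
  the first construction yields the adjoint of the second component. The zero operator is an
  admissible contraction.\<close>

lemma parameter_triplets_nonempty: "parameter_triplets J1 J1' J2 J2' T \<noteq> {}"
proof -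
  obtain V where V: "bop V" "\<And>z. V z \<in> mod_space A" "\<And>z. Re (cinner (S (V z)) (V z)) \<le> Re (cinner (J2' z) z)"
    using J_contraction_exists [OF selfadjoint_A J2'(1) nu(1,3) le(1)] by blast
  obtain W where W: "bop W" "\<And>v. W v \<in> mod_space B" "\<And>v. Re (cinner (Ss (W v)) (W v)) \<le> Re (cinner (J1' v) v)"
    using J_contraction_exists [OF selfadjoint_B J1'(1) nu(2,4) le(2)] by blast
  define G2 where "G2 = adj V"
  have G2: "bop G2" "adj G2 = V" unfolding G2_def by (rule bop_adj [OF V(1)], rule adj_adj [OF V(1)])
  have "G2 (proj_onto (mod_space A) x) = G2 x" for x
  proof (rule cinner_eqI)
    fix z
    have "cinner z (G2 (proj_onto (mod_space A) x)) = cinner (V z) (proj_onto (mod_space A) x)"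
      unfolding G2_def by (rule cinner_adj(1) [OF V(1), symmetric])
    also have "\<dots> = cinner (V z) x" by (rule proj_onto_cinner [OF mod_spaces(1,2) V(2)])
    also have "\<dots> = cinner z (G2 x)" unfolding G2_def by (rule cinner_adj(1) [OF V(1)])
    finally show "cinner z (G2 (proj_onto (mod_space A) x)) = cinner z (G2 x)" .
  qed
  then have e: "ext2 (restrict G2 (mod_space A)) = G2"
    by (simp add: proj_onto_in [OF mod_spaces(1,2)])
  have p1: "positive_op (form1 W)"
    by (rule positive_opI [OF selfadjoint_form1 [OF W(1)]]) (use W(3) in \<open>simp add: form1_form [OF W(1)]\<close>)
  have p2: "positive_op (form2 G2)"
    by (rule positive_opI [OF selfadjoint_form2 [OF G2(1)]]) (use V(3) in \<open>simp add: form2_form [OF G2(1)] G2(2)\<close>)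
  have sub: "complex_vector.subspace (closure (range (D1 W)))" "complex_vector.subspace (closure (range (D2 G2)))"
    by (intro subspace_closure subspace_range positive_op_bop positive_sqrt_op p1 p2)+
  have "(W, restrict G2 (mod_space A), restrict (\<lambda>x. 0) (closure (range (D1 W)))) \<in> parameter_triplets J1 J1' J2 J2' T"
    unfolding mem_parameter_triplets e
    using bops_UNIVI [OF W(1,2)] p1 p2 restrict_in_bops [OF G2(1) mod_spaces(2), of UNIV]
      restrict_in_bops [OF bop_0 sub(1) complex_vector.subspace_0 [OF sub(2)]]
    by simp
  then show ?thesis by blast
qed

lemma completion_correspondence:
  "completion_solutions J1 J1' J2 J2' T (enat (k - b)) (enat (l - a)) \<noteq> {} \<and>
    bij_betw (block_completion J1 J1' J2 J2' T) (parameter_triplets J1 J1' J2 J2' T)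
      (completion_solutions J1 J1' J2 J2' T (enat (k - b)) (enat (l - a)))"
proof -
  have "block_completion J1 J1' J2 J2' T ` parameter_triplets J1 J1' J2 J2' T
      = completion_solutions J1 J1' J2 J2' T (enat (k - b)) (enat (l - a))"
  proof (intro equalityI subsetI)
    fix Tt assume "Tt \<in> completion_solutions J1 J1' J2 J2' T (enat (k - b)) (enat (l - a))"
    from solution_block_completion [OF this] show "Tt \<in> block_completion J1 J1' J2 J2' T ` parameter_triplets J1 J1' J2 J2' T"
      by auto
  next
    fix Tt assume "Tt \<in> block_completion J1 J1' J2 J2' T ` parameter_triplets J1 J1' J2 J2' T"
    then obtain G1 G2 G where "(G1, G2, G) \<in> parameter_triplets J1 J1' J2 J2' T"
      "Tt = block_completion J1 J1' J2 J2' T (G1, G2, G)" by auto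
    then show "Tt \<in> completion_solutions J1 J1' J2 J2' T (enat (k - b)) (enat (l - a))"
      using block_completion_solution by blast
  qed
  then show ?thesis
    using inj_block_completion parameter_triplets_nonempty by (auto simp: bij_betw_def)
qed

end

end

theorem theorem4p7:
  fixes J1 :: "'h1::chilbert_space \<Rightarrow> 'h1" and J1' :: "'k1::chilbert_space \<Rightarrow> 'k1"
    and J2 :: "'h2::chilbert_space \<Rightarrow> 'h2" and J2' :: "'k2::chilbert_space \<Rightarrow> 'k2"
    and T :: "'h1 \<Rightarrow> 'h2"
    and \<kappa>1 \<kappa>2 \<kappa>1t \<kappa>2t :: enat
  assumes "symmetry J1" and "symmetry J1'" and "symmetry J2" and "symmetry J2'"
    and "nu_minus J1' < \<infinity>" and "nu_minus J2' < \<infinity>"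
    and "bop T"
    and "\<kappa>1 = nu_minus (defect_form J1 J2 T)" and "\<kappa>1 < \<infinity>"
    and "\<kappa>2 = nu_minus (defect_form_star J1 J2 T)" and "\<kappa>2 < \<infinity>"
    and "nu_minus J2' \<le> \<kappa>1" and "\<kappa>1 - nu_minus J2' = \<kappa>1t" and "\<kappa>1t < \<infinity>"
    and "nu_minus J1' \<le> \<kappa>2" and "\<kappa>2 - nu_minus J1' = \<kappa>2t" and "\<kappa>2t < \<infinity>"
  shows "completion_solutions J1 J1' J2 J2' T \<kappa>1t \<kappa>2t \<noteq> {} \<and>
    bij_betw (block_completion J1 J1' J2 J2' T)
      (parameter_triplets J1 J1' J2 J2' T)
      (completion_solutions J1 J1' J2 J2' T \<kappa>1t \<kappa>2t)"
proof -
  note sym = symmetry_selfadjoint symmetry_involution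
  let ?A = "defect_form J1 J2 T" and ?B = "defect_form_star J1 J2 T"
  interpret krein_pair J1 J2 T "adj T" ?A ?B
    by (rule krein_pair_defect [OF sym [OF assms(1)] sym [OF assms(3)] assms(7)])
  obtain R where R: "bop R" "\<And>y. R (mod_root ?B y) = mod_root ?A (J1 (adj T y))"
    "\<And>y. R (proj_onto (mod_space ?B) y) = R y" "\<And>y. R y \<in> mod_space ?A"
    using link_exists by blast
  interpret krein_quadruple J1 J2 T "adj T" ?A ?B R J1' J2'
    by unfold_locales (use R sym [OF assms(2)] sym [OF assms(4)] in auto)
  \<comment> \<open>All four indices are finite, so subtraction in \<open>enat\<close> becomes
    subtraction of natural numbers.\<close>
  obtain k l b a where kl: "\<kappa>1 = enat k" "\<kappa>2 = enat l" "nu_minus J2' = enat b" "nu_minus J1' = enat a"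
    using assms(5,6,9,11) by (metis less_infinityE)
  then have "\<kappa>1t = enat (k - b)" "\<kappa>2t = enat (l - a)" "b \<le> k" "a \<le> l"
    using assms(12,13,15,16) by auto
  then show ?thesis
    using completion_correspondence [of k l b a] kl assms(8,10) by simp
qed

end
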